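(* Let $\mathcal T$ be a simplicial triangulation of a bounded polyhedral domain $\Omega\subset\mathbb R^n$, let $r\ge1$ and $0\le k\le n$. For $f\in\Delta(\mathcal T)$ with $\dim f\ge k$, a multi-index $\alpha=(\alpha_i)_{i\in\mathcal I(f)}$ of nonnegative integers with $|\alpha|=r$, and an increasing map $\sigma:\{1,\dots,k\}\to\mathcal I(f)$, such that $\{i\mid\alpha_i>0\}\cup\sigma(\{1,\dots,k\})=\mathcal I(f)$, let $\omega_{f,\alpha,\sigma}$ be the piecewise polynomial $k$-form given by $\omega_{f,\alpha,\sigma}|_T=(\lambda^T)^\alpha\psi^{\alpha,f,T}_\sigma$ for $T\in\mathcal T$ containing $f$ and $\omega_{f,\alpha,\sigma}|_T=0$ for all other $T\in\mathcal T$. Then the forms $\omega_{f,\alpha,\sigma}$, over all such $(f,\alpha,\sigma)$, belong to and span $\mathcal P_r\Lambda^k(\mathcal T)$, and those $\omega_{f,\alpha,\sigma}$ for which in addition $\alpha_i=0$ whenever $i<\min[\mathcal I(f)\setminus\sigma(\{1,\dots,k\})]$ form a basis of $\mathcal P_r\Lambda^k(\mathcal T)$.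
   Context: A simplicial triangulation $\mathcal T$ of $\Omega$ is a finite set of closed $n$-simplices whose union is the closure of $\Omega$ and such that the intersection of any two is either empty or a common subsimplex of each. $\Delta(T)$ is the set of all nonempty faces of $T$ of all dimensions (including $T$), $\Delta(\mathcal T)=\bigcup_{T\in\mathcal T}\Delta(T)$. The vertices of $\mathcal T$ are numbered, $x_0,\dots,x_N$, and $\mathcal I(f)$ is the set of indices of the vertices of the simplex $f$. For $i\in\mathcal I(T)$, $\lambda_i^T$ is the affine function on $T$ with $\lambda_i^T(x_j)=\delta_{ij}$, $j\in\mathcal I(T)$; $(\lambda^T)^\alpha=\prod_i(\lambda_i^T)^{\alpha_i}$. For $f\in\Delta(T)$ and $\alpha,\sigma$ as in the statement, $$\psi_i^{\alpha,f,T}=d\lambda_i^T-\frac{\alpha_i}{|\alpha|}\sum_{j\in\mathcal I(f)}d\lambda_j^T\quad(i\in\mathcal I(f)),\qquad \psi_\sigma^{\alpha,f,T}=\psi^{\alpha,f,T}_{\sigma(1)}\wedge\cdots\wedge\psi^{\alpha,f,T}_{\sigma(k)}$$ (for $k=0$, $\sigma$ is the empty map and $\psi_\sigma^{\alpha,f,T}=1$). $\mathcal P_r\Lambda^k(T)$ is the space of differential $k$-forms on $T$ with coefficients polynomials of degree at most $r$. $\mathcal P_r\Lambda^k(\mathcal T)$ is the space of $\omega\in L^2\Lambda^k(\Omega)$ with $\omega|_T\in\mathcal P_r\Lambda^k(T)$ for all $T\in\mathcal T$ and such that for each $f\in\Delta(\mathcal T)$ with $k\le\dim f\le n-1$, $\operatorname{tr}_f\omega$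 is single-valued, i.e. the pullback of $\omega|_T$ to $f$ is the same for all $T\in\mathcal T$ containing $f$. *)

theory Defs
  imports "HOL-Analysis.Analysis"
begin

section \<open>Domains and triangulations\<close>

text \<open>The condition on the frontier is what ``polyhedral'' contributes; interior slits are allowed.\<close>

definition bounded_polyhedral_domain :: "(real ^ 'n) set \<Rightarrow> bool" where
  "bounded_polyhedral_domain \<Omega> \<longleftrightarrow>
     open \<Omega> \<and> connected \<Omega> \<and> bounded \<Omega> \<and> \<Omega> \<noteq> {} \<and>
     (\<exists>P. finite P \<and> (\<forall>F\<in>P. polytope F \<and> aff_dim F < int CARD('n)) \<and> frontier \<Omega> = \<Union>P)"

text \<open>
  The library predicate \<^const>\<open>triangulation\<close> requires a finite set of simplices any two of which
  meet in a common face, where the empty set counts as a face.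
\<close>

definition triangulation_of :: "(real ^ 'n) set set \<Rightarrow> (real ^ 'n) set \<Rightarrow> bool" where
  "triangulation_of \<T> \<Omega> \<longleftrightarrow>
     triangulation \<T> \<and> (\<forall>T\<in>\<T>. int CARD('n) simplex T) \<and> \<Union>\<T> = closure \<Omega>"

definition faces :: "'a::real_vector set \<Rightarrow> 'a set set" where
  "faces T = {f. f face_of T \<and> f \<noteq> {}}"

definition all_faces :: "'a::real_vector set set \<Rightarrow> 'a set set" where
  "all_faces \<T> = (\<Union>T\<in>\<T>. faces T)"

definition vertex_numbering ::
    "(nat \<Rightarrow> 'a::real_vector) \<Rightarrow> nat \<Rightarrow> 'a set set \<Rightarrow> bool" where
  "vertex_numbering x N \<T> \<longleftrightarrow> bij_betw x {0..N} (\<Union>T\<in>\<T>. {v. v extreme_point_of T})"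

definition vertex_indices :: "(nat \<Rightarrow> 'a::real_vector) \<Rightarrow> nat \<Rightarrow> 'a set \<Rightarrow> nat set" where
  "vertex_indices x N f = {i \<in> {0..N}. x i extreme_point_of f}"


section \<open>Alternating forms and differential forms\<close>

text \<open>
  A \<open>k\<close>-covector is a function of a sequence of vectors that only looks at the entries
  \<open>v 1, \<dots>, v k\<close>; a differential form assigns a covector to every point.
\<close>

type_synonym 'n covector = "(nat \<Rightarrow> real ^ 'n) \<Rightarrow> real"
type_synonym 'n diff_form = "real ^ 'n \<Rightarrow> 'n covector"

definition alternating :: "nat \<Rightarrow> 'n::finite covector \<Rightarrow> bool" where
  "alternating k w \<longleftrightarrow>
     (\<forall>v v'. (\<forall>i\<in>{1..k}. v i = v' i) \<longrightarrow> w v = w v') \<and>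
     (\<forall>v. \<forall>i\<in>{1..k}. linear (\<lambda>y. w (v(i := y)))) \<and>
     (\<forall>v. \<forall>i\<in>{1..k}. \<forall>j\<in>{1..k}. i \<noteq> j \<and> v i = v j \<longrightarrow> w v = 0)"

text \<open>The wedge product \<open>a 1 \<and> \<dots> \<and> a k\<close> of linear functionals, as the determinant of
  the values \<open>a i (v j)\<close>.\<close>

definition wedge :: "nat \<Rightarrow> (nat \<Rightarrow> real ^ 'n \<Rightarrow> real) \<Rightarrow> 'n::finite covector" where
  "wedge k a v = (\<Sum>p | p permutes {1..k}. of_int (sign p) * (\<Prod>i\<in>{1..k}. a i (v (p i))))"

definition polynomial_le :: "nat \<Rightarrow> (real ^ 'n::finite \<Rightarrow> real) \<Rightarrow> bool" where
  "polynomial_le r q \<longleftrightarrow>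
     (\<exists>c. \<forall>y. q y = (\<Sum>\<beta> | (\<Sum>i\<in>UNIV. \<beta> i) \<le> r. c \<beta> * (\<Prod>i\<in>UNIV. (y $ i) ^ \<beta> i)))"

definition poly_forms :: "nat \<Rightarrow> nat \<Rightarrow> (real ^ 'n) set \<Rightarrow> 'n::finite diff_form set" where
  "poly_forms r k T =
     {p. (\<forall>y\<in>T. alternating k (p y)) \<and>
         (\<forall>v. \<exists>q. polynomial_le r q \<and> (\<forall>y\<in>T. p y v = q y))}"

text \<open>Pullback to a convex set \<open>f\<close>: restriction to points of \<open>f\<close> and vectors tangent to \<open>f\<close>
  (extended by \<open>0\<close> so that equality of functions is equality of pullbacks).\<close>

definition tangent_space :: "(real ^ 'n::finite) set \<Rightarrow> (real ^ 'n) set" where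
  "tangent_space f = span {a - b | a b. a \<in> f \<and> b \<in> f}"

definition trace_form :: "nat \<Rightarrow> (real ^ 'n) set \<Rightarrow> 'n::finite diff_form \<Rightarrow> 'n diff_form" where
  "trace_form k f p =
     (\<lambda>y v. if y \<in> f \<and> (\<forall>i\<in>{1..k}. v i \<in> tangent_space f) then p y v else 0)"


section \<open>Forms modulo equality almost everywhere\<close>

quotient_type (overloaded) 'n ae_form = "'n::finite diff_form" /
  "\<lambda>\<omega> \<eta>. AE y in lebesgue. \<omega> y = \<eta> y"
proof (rule equivpI)
  show "reflp (\<lambda>\<omega> \<eta> :: 'n diff_form. AE y in lebesgue. \<omega> y = \<eta> y)"
    by (simp add: reflp_def)
  show "symp (\<lambda>\<omega> \<eta> :: 'n diff_form. AE y in lebesgue. \<omega> y = \<eta> y)"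
    by (auto simp: symp_def elim: eventually_mono)
  show "transp (\<lambda>\<omega> \<eta> :: 'n diff_form. AE y in lebesgue. \<omega> y = \<eta> y)"
    unfolding transp_def by (intro allI impI, erule (1) eventually_elim2) simp
qed

instantiation ae_form :: (finite) real_vector
begin

lift_definition zero_ae_form :: "'a ae_form" is "\<lambda>y v. 0" .

lift_definition plus_ae_form :: "'a ae_form \<Rightarrow> 'a ae_form \<Rightarrow> 'a ae_form"
  is "\<lambda>\<omega> \<eta> y v. \<omega> y v + \<eta> y v"
  by (erule (1) eventually_elim2) simp

lift_definition minus_ae_form :: "'a ae_form \<Rightarrow> 'a ae_form \<Rightarrow> 'a ae_form"
  is "\<lambda>\<omega> \<eta> y v. \<omega> y v - \<eta> y v"
  by (erule (1) eventually_elim2) simp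

lift_definition uminus_ae_form :: "'a ae_form \<Rightarrow> 'a ae_form"
  is "\<lambda>\<omega> y v. - \<omega> y v"
  by (erule eventually_mono) simp

lift_definition scaleR_ae_form :: "real \<Rightarrow> 'a ae_form \<Rightarrow> 'a ae_form"
  is "\<lambda>c \<omega> y v. c * \<omega> y v"
  by (erule eventually_mono) simp

instance
  by standard (transfer; simp add: algebra_simps)+

end

text \<open>A form on \<open>\<Omega>\<close> is identified with its extension by \<open>0\<close> to the whole space.\<close>

definition L2_forms :: "nat \<Rightarrow> (real ^ 'n) set \<Rightarrow> 'n::finite ae_form set" where
  "L2_forms k \<Omega> =
     {abs_ae_form \<omega> | \<omega>.
        (\<forall>y. alternating k (\<omega> y)) \<and> (\<forall>y v. y \<notin> \<Omega> \<longrightarrow> \<omega> y v = 0) \<and>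
        (\<forall>v. (\<lambda>y. \<omega> y v) \<in> borel_measurable lebesgue \<and>
             integrable lebesgue (\<lambda>y. (\<omega> y v)\<^sup>2))}"

text \<open>\<open>p\<close> represents the restriction of the class \<open>\<omega>\<close> to \<open>T\<close>.\<close>

lift_definition restricts_to :: "'n::finite ae_form \<Rightarrow> (real ^ 'n) set \<Rightarrow> 'n diff_form \<Rightarrow> bool"
  is "\<lambda>\<omega> T p. AE y in lebesgue. y \<in> T \<longrightarrow> \<omega> y = p y"
  by (intro ext, rule eventually_cong, assumption) simp

text \<open>The polynomial form representing \<open>\<omega>\<close> on an \<open>n\<close>-simplex \<open>T\<close> is unique on \<open>T\<close>, so the
  existential quantifier below merely names these restrictions.\<close>

definition poly_form_space ::
    "nat \<Rightarrow> nat \<Rightarrow> (real ^ 'n) set set \<Rightarrow> (real ^ 'n) set \<Rightarrow> 'n::finite ae_form set" where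
  "poly_form_space r k \<T> \<Omega> =
     {\<omega> \<in> L2_forms k \<Omega>.
        \<exists>p. (\<forall>T\<in>\<T>. p T \<in> poly_forms r k T \<and> restricts_to \<omega> T (p T)) \<and>
            (\<forall>f\<in>all_faces \<T>. int k \<le> aff_dim f \<and> aff_dim f \<le> int CARD('n) - 1 \<longrightarrow>
               (\<forall>T\<in>\<T>. \<forall>T'\<in>\<T>. f \<subseteq> T \<and> f \<subseteq> T' \<longrightarrow>
                  trace_form k f (p T) = trace_form k f (p T')))}"


section \<open>The forms spanning the space\<close>

definition barycentric ::
    "(nat \<Rightarrow> real ^ 'n) \<Rightarrow> nat \<Rightarrow> (real ^ 'n) set \<Rightarrow> nat \<Rightarrow> real ^ 'n::finite \<Rightarrow> real" where
  "barycentric x N T i =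
     (THE l. (\<exists>a b. l = (\<lambda>y. a \<bullet> y + b)) \<and>
             (\<forall>j\<in>vertex_indices x N T. l (x j) = (if j = i then 1 else 0)))"

definition d_barycentric ::
    "(nat \<Rightarrow> real ^ 'n) \<Rightarrow> nat \<Rightarrow> (real ^ 'n) set \<Rightarrow> nat \<Rightarrow>
     real ^ 'n \<Rightarrow> real ^ 'n::finite \<Rightarrow> real" where
  "d_barycentric x N T i y = frechet_derivative (barycentric x N T i) (at y)"

definition psi ::
    "(nat \<Rightarrow> real ^ 'n) \<Rightarrow> nat \<Rightarrow> (nat \<Rightarrow> nat) \<Rightarrow> (real ^ 'n) set \<Rightarrow> (real ^ 'n) set \<Rightarrow> nat \<Rightarrow>
     real ^ 'n \<Rightarrow> real ^ 'n::finite \<Rightarrow> real" where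
  "psi x N \<alpha> f T i y v =
     d_barycentric x N T i y v -
       real (\<alpha> i) / real (\<Sum>j\<in>vertex_indices x N f. \<alpha> j) *
       (\<Sum>j\<in>vertex_indices x N f. d_barycentric x N T j y v)"

definition psi_wedge ::
    "(nat \<Rightarrow> real ^ 'n) \<Rightarrow> nat \<Rightarrow> nat \<Rightarrow> (nat \<Rightarrow> nat) \<Rightarrow> (nat \<Rightarrow> nat) \<Rightarrow>
     (real ^ 'n) set \<Rightarrow> (real ^ 'n) set \<Rightarrow> 'n::finite diff_form" where
  "psi_wedge x N k \<alpha> \<sigma> f T y = wedge k (\<lambda>m. psi x N \<alpha> f T (\<sigma> m) y)"

definition local_form ::
    "(nat \<Rightarrow> real ^ 'n) \<Rightarrow> nat \<Rightarrow> nat \<Rightarrow> (nat \<Rightarrow> nat) \<Rightarrow> (nat \<Rightarrow> nat) \<Rightarrow>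
     (real ^ 'n) set \<Rightarrow> (real ^ 'n) set \<Rightarrow> 'n::finite diff_form" where
  "local_form x N k \<alpha> \<sigma> f T y v =
     (\<Prod>i\<in>vertex_indices x N f. barycentric x N T i y ^ \<alpha> i) * psi_wedge x N k \<alpha> \<sigma> f T y v"

text \<open>The interiors of the simplices are disjoint and cover the domain up to a null set, so at most
  one summand is nonzero at each point.\<close>

definition piecewise_form ::
    "(real ^ 'n) set set \<Rightarrow> (nat \<Rightarrow> real ^ 'n) \<Rightarrow> nat \<Rightarrow> nat \<Rightarrow>
     (real ^ 'n) set \<times> (nat \<Rightarrow> nat) \<times> (nat \<Rightarrow> nat) \<Rightarrow> 'n::finite ae_form" where
  "piecewise_form \<T> x N k = (\<lambda>(f, \<alpha>, \<sigma>). abs_ae_form (\<lambda>y v.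
     \<Sum>T | T \<in> \<T> \<and> f \<subseteq> T. if y \<in> interior T then local_form x N k \<alpha> \<sigma> f T y v else 0))"

definition index_set ::
    "(real ^ 'n) set set \<Rightarrow> (nat \<Rightarrow> real ^ 'n) \<Rightarrow> nat \<Rightarrow> nat \<Rightarrow> nat \<Rightarrow>
     ((real ^ 'n::finite) set \<times> (nat \<Rightarrow> nat) \<times> (nat \<Rightarrow> nat)) set" where
  "index_set \<T> x N r k =
     {(f, \<alpha>, \<sigma>). f \<in> all_faces \<T> \<and> aff_dim f \<ge> int k \<and>
        \<alpha> \<in> vertex_indices x N f \<rightarrow>\<^sub>E UNIV \<and> (\<Sum>i\<in>vertex_indices x N f. \<alpha> i) = r \<and>
        \<sigma> \<in> {1..k} \<rightarrow>\<^sub>E vertex_indices x N f \<and> strict_mono_on {1..k} \<sigma> \<and>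
        {i \<in> vertex_indices x N f. \<alpha> i > 0} \<union> \<sigma> ` {1..k} = vertex_indices x N f}"

definition basis_index_set ::
    "(real ^ 'n) set set \<Rightarrow> (nat \<Rightarrow> real ^ 'n) \<Rightarrow> nat \<Rightarrow> nat \<Rightarrow> nat \<Rightarrow>
     ((real ^ 'n::finite) set \<times> (nat \<Rightarrow> nat) \<times> (nat \<Rightarrow> nat)) set" where
  "basis_index_set \<T> x N r k =
     {(f, \<alpha>, \<sigma>) \<in> index_set \<T> x N r k.
        \<forall>i\<in>vertex_indices x N f. i < Min (vertex_indices x N f - \<sigma> ` {1..k}) \<longrightarrow> \<alpha> i = 0}"

end

(* On an n-simplex T, a polynomial form of degree r is a unique sum of terms lambda^alpha w_alpha
   with |alpha| = r and w_alpha a constant alternating form.  Fix alpha with support S.  The vertex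
   set of f is the union of S and the range of sigma, so for i in S the forms psi_i differ from
   phi_i = dlambda_i - (alpha_i / r) * (sum of dlambda_j over S) only by combinations of the
   dlambda_j, j not in S, which occur in the wedge product anyway.  Hence psi_sigma is the wedge
   product of the dlambda_j (j not in S) and the phi_i (i in S) indexed by sigma.  The sum of the
   phi_i over S vanishes; leaving out the index i0 = min S gives a basis of the dual space, and the
   condition on alpha and sigma says exactly that sigma avoids i0.

   The dual basis consists of x_i - x_i0 for i in S and x_j - (sum of (alpha_i / r) x_i over S) for
   j not in S.  Those occurring for sigma are tangent to f, and the coefficient of lambda^alpha can
   be read off on f.  So the coefficient of (f, alpha, sigma) depends only on the trace on f: the
   coefficients found on different simplices agree, and the expansions glue. *)
theory Submission
  imports Defs
begin

section \<open>Alternating forms\<close>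

text \<open>The weights alpha_i / r in the dual vectors are forced. Let p be the sum of (alpha_i /
  r) x_i over S. For j not in S, dlambda_i with i in S takes the value -alpha_i / r on x_j - p, and
  these values add up to -1 over S, so the correction term in phi_i cancels them exactly.

  The proof works with psi_i itself. Its sum runs over all vertices of f, so the matrix of psi_sigma
  on the dual vectors need not be the identity: stray entries remain in the columns of the vertices
  of f outside S. The rows of these same vertices are free of stray entries, since their alpha_i is
  0, and so no nonzero Leibniz term uses a stray entry.

  The obstacle to gluing is that neighbouring simplices share only tangential traces, while w_alpha
  takes arbitrary vectors. Its values on the dual vectors of sigma are a part that both simplices
  see, so the coefficients are produced by evaluation and not by an abstract dimension count. A
  trace condition is available only below dimension n, which is enough: an n-dimensional face lies
  in a single simplex.\<close>

lemma alternatingD_cong: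
  "alternating k w \<Longrightarrow> (\<And>i. i \<in> {1..k} \<Longrightarrow> v i = v' i) \<Longrightarrow> w v = w v'"
  unfolding alternating_def by blast

lemma alternatingD_linear:
  "alternating k w \<Longrightarrow> i \<in> {1..k} \<Longrightarrow> linear (\<lambda>y. w (v(i := y)))"
  unfolding alternating_def by blast

lemma alternatingD_repeat:
  "alternating k w \<Longrightarrow> i \<in> {1..k} \<Longrightarrow> j \<in> {1..k} \<Longrightarrow> i \<noteq> j \<Longrightarrow> v i = v j \<Longrightarrow> w v = 0"
  unfolding alternating_def by blast

lemma alternatingI:
  assumes "\<And>v v'. (\<And>i. i \<in> {1..k} \<Longrightarrow> v i = v' i) \<Longrightarrow> w v = w v'"
    and "\<And>v i. i \<in> {1..k} \<Longrightarrow> linear (\<lambda>y. w (v(i := y)))"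
    and "\<And>v i j. i \<in> {1..k} \<Longrightarrow> j \<in> {1..k} \<Longrightarrow> i \<noteq> j \<Longrightarrow> v i = v j \<Longrightarrow> w v = 0"
  shows "alternating k w"
  unfolding alternating_def using assms by blast

lemma alternating_add:
  assumes w: "alternating k w" and w': "alternating k w'"
  shows "alternating k (\<lambda>v. w v + w' v)"
proof (rule alternatingI)
  fix v v' :: "nat \<Rightarrow> real ^ 'a" assume "\<And>i. i \<in> {1..k} \<Longrightarrow> v i = v' i"
  then show "w v + w' v = w v' + w' v'"
    using alternatingD_cong[OF w, of v v'] alternatingD_cong[OF w', of v v'] by simp
next
  show "linear (\<lambda>y. w (v(i := y)) + w' (v(i := y)))" if "i \<in> {1..k}" for v i
    by (intro linear_compose_add alternatingD_linear[OF _ that] assms)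
next
  show "w v + w' v = 0" if "i \<in> {1..k}" "j \<in> {1..k}" "i \<noteq> j" "v i = v j" for v i j
    using alternatingD_repeat[OF w that] alternatingD_repeat[OF w' that] by simp
qed

lemma alternating_scale:
  assumes w: "alternating k w"
  shows "alternating k (\<lambda>v. c * w v)"
proof (rule alternatingI)
  fix v v' :: "nat \<Rightarrow> real ^ 'a" assume "\<And>i. i \<in> {1..k} \<Longrightarrow> v i = v' i"
  then show "c * w v = c * w v'"
    using alternatingD_cong[OF w, of v v'] by simp
next
  show "linear (\<lambda>y. c * w (v(i := y)))" if "i \<in> {1..k}" for v i
    using linear_compose_scale_right[OF alternatingD_linear[OF w that]] by simp
next
  show "c * w v = 0" if "i \<in> {1..k}" "j \<in> {1..k}" "i \<noteq> j" "v i = v j" for v i j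
    using alternatingD_repeat[OF w that] by simp
qed

lemma alternating_zero: "alternating k (\<lambda>v. 0)"
  by (auto simp: alternating_def intro: linear_zero)

lemma alternating_diff:
  assumes "alternating k w" "alternating k w'"
  shows "alternating k (\<lambda>v. w v - w' v)"
  using alternating_add[OF assms(1) alternating_scale[OF assms(2), of "-1"]] by simp

lemma alternating_sum:
  assumes "\<And>a. a \<in> A \<Longrightarrow> alternating k (w a)"
  shows "alternating k (\<lambda>v. \<Sum>a\<in>A. w a v)"
  using assms
  by (induction A rule: infinite_finite_induct) (auto intro: alternating_zero alternating_add)

text \<open>Polarization: fixing all arguments but two gives a bilinear map \<open>g\<close> that
  vanishes on the diagonal, and expanding it at the sum of the two vectors leaves only the mixed
  terms.\<close>

lemma alternating_swap:
  assumes w: "alternating k w" and ij: "i \<in> {1..k}" "j \<in> {1..k}" "i \<noteq> j"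
  shows "w (v \<circ> Transposition.transpose i j) = - w v"
proof -
  have li: "linear (\<lambda>y. w (u(i := y)))" and lj: "linear (\<lambda>y. w (u(j := y)))" for u
    using ij by (auto intro: alternatingD_linear[OF w])
  define g where "g a b = w (v(i := a, j := b))" for a b
  have g2: "g a (b + c) = g a b + g a c" for a b c
    unfolding g_def using linear_add[OF lj[of "v(i := a)"]] by simp
  have g1: "g (a + c) b = g a b + g c b" for a b c
    unfolding g_def using linear_add[OF li[of "v(j := b)"]] ij by (simp add: fun_upd_twist)
  have g0: "g a a = 0" for a
    unfolding g_def using ij by (intro alternatingD_repeat[OF w ij]) auto
  have "g (v i + v j) (v i + v j) = g (v i) (v j) + g (v j) (v i)"
    by (simp add: g1 g2 g0[of "v i"] g0[of "v j"])
  then have "g (v j) (v i) = - g (v i) (v j)"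
    using g0[of "v i + v j"] by simp
  moreover have "g (v i) (v j) = w v"
    unfolding g_def by simp
  moreover have "v(i := v j, j := v i) = v \<circ> Transposition.transpose i j"
    using ij by (auto simp: Transposition.transpose_def fun_eq_iff)
  ultimately show ?thesis
    unfolding g_def by simp
qed

text \<open>Speaking only of vanishing keeps signs out of the induction over transpositions. The
  claim is generalized over \<open>v\<close>, since the transposition is absorbed into the vectors
  before the induction hypothesis is applied.\<close>

lemma alternating_permute_zero:
  assumes w: "alternating k w" and p: "p permutes {1..k}" and "w v = 0"
  shows "w (v \<circ> p) = 0"
proof -
  have "\<forall>v. w v = 0 \<longrightarrow> w (v \<circ> p) = 0"
    using p finite_atLeastAtMost
  proof (induction rule: permutes_induct)
    case (swap a b p)
    show ?case
    proof (intro allI impI)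
      fix v assume "w v = 0"
      then have "w (v \<circ> Transposition.transpose a b) = 0"
        using alternating_swap[OF w swap(1-3)] by simp
      then show "w (v \<circ> (Transposition.transpose a b \<circ> p)) = 0"
        using swap.IH unfolding o_assoc by blast
    qed
  qed simp
  then show ?thesis using assms by blast
qed

text \<open>Increasing maps stand for \<open>k\<close>-element subsets of \<open>M\<close>.\<close>

definition increasing_maps :: "nat \<Rightarrow> nat set \<Rightarrow> (nat \<Rightarrow> nat) set" where
  "increasing_maps k M = {\<sigma> \<in> {1..k} \<rightarrow>\<^sub>E M. strict_mono_on {1..k} \<sigma>}"

lemma finite_increasing_maps: "finite M \<Longrightarrow> finite (increasing_maps k M)"
  unfolding increasing_maps_def by (intro finite_Collect_conjI disjI1) (simp add: finite_PiE)

lemma increasing_maps_mem: "\<sigma> \<in> increasing_maps k M \<Longrightarrow> i \<in> {1..k} \<Longrightarrow> \<sigma> i \<in> M"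
  unfolding increasing_maps_def by (blast dest: PiE_mem)

lemma increasing_maps_inj: "\<sigma> \<in> increasing_maps k M \<Longrightarrow> inj_on \<sigma> {1..k}"
  unfolding increasing_maps_def by (auto dest: strict_mono_on_imp_inj_on)

text \<open>Sorting the image of \<open>g\<close> gives \<open>\<sigma>\<close>, and
  \<open>p\<close> records the place of each value in the sorted order.\<close>

lemma injective_eq_increasing_permuted:
  assumes g: "inj_on g {1..k}" "g ` {1..k} \<subseteq> M"
  obtains \<sigma> p where "\<sigma> \<in> increasing_maps k M" "p permutes {1..k}" "\<And>i. i \<in> {1..k} \<Longrightarrow> g i = \<sigma> (p i)"
proof -
  let ?A = "g ` {1..k}"
  have card: "card ?A = k"
    using card_image[OF g(1)] by simp
  let ?l = "sorted_list_of_set ?A"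
  have len: "length ?l = k" using card by simp
  \<comment> \<open>List positions start at 0 while the arguments of a covector start at 1, hence
    \<open>i - 1\<close>.\<close>
  define \<sigma> where "\<sigma> = (\<lambda>i\<in>{1..k}. ?l ! (i - 1))"
  have \<sigma>mem: "\<sigma> i \<in> ?A" if "i \<in> {1..k}" for i
  proof -
    have "i - 1 < length ?l" using that len by auto
    then have "?l ! (i - 1) \<in> set ?l" by (rule nth_mem)
    then show ?thesis using that by (simp add: \<sigma>_def)
  qed
  have mono: "strict_mono_on {1..k} \<sigma>"
  proof (rule strict_mono_onI)
    fix a b assume "a \<in> {1..k}" "b \<in> {1..k}" "a < b"
    moreover have "sorted_wrt (<) ?l" by simp
    ultimately show "\<sigma> a < \<sigma> b"
      using sorted_wrt_nth_less[of "(<)" ?l "a - 1" "b - 1"] len by (auto simp: \<sigma>_def)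
  qed
  have \<sigma>: "\<sigma> \<in> increasing_maps k M"
    unfolding increasing_maps_def using \<sigma>mem g(2) mono
    by (auto simp: \<sigma>_def PiE_iff extensional_def simp del: sorted_list_of_set.set_sorted_key_list_of_set)
  have inj: "inj_on \<sigma> {1..k}" using increasing_maps_inj[OF \<sigma>] .
  have "\<sigma> ` {1..k} = ?A"
    by (rule card_subset_eq) (use \<sigma>mem card card_image[OF inj] in auto)
  then have bij: "bij_betw \<sigma> {1..k} ?A" using inj by (simp add: bij_betw_def)
  define p where "p i = (if i \<in> {1..k} then inv_into {1..k} \<sigma> (g i) else i)" for i
  have "bij_betw (inv_into {1..k} \<sigma> \<circ> g) {1..k} {1..k}"
    by (rule bij_betw_trans[OF _ bij_betw_inv_into[OF bij]]) (use g(1) in \<open>simp add: bij_betw_def\<close>)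
  moreover have "bij_betw (inv_into {1..k} \<sigma> \<circ> g) {1..k} {1..k} = bij_betw p {1..k} {1..k}"
    by (rule bij_betw_cong) (auto simp: p_def)
  ultimately have "bij_betw p {1..k} {1..k}"
    by blast
  then have "p permutes {1..k}"
    by (rule bij_imp_permutes) (simp add: p_def del: atLeastAtMost_iff)
  moreover have "g i = \<sigma> (p i)" if "i \<in> {1..k}" for i
    using bij_betw_inv_into_right[OF bij, of "g i"] that unfolding p_def by auto
  ultimately show thesis using that \<sigma> by blast
qed

text \<open>By multilinearity it is enough to insert vectors of the spanning family. A repeated
  index then gives 0, and distinct indices can be sorted into an increasing map.\<close>

lemma alternating_eq_zero:
  assumes w: "alternating k w" and span: "span (u ` M) = UNIV"
    and zero: "\<And>\<sigma>. \<sigma> \<in> increasing_maps k M \<Longrightarrow> w (u \<circ> \<sigma>) = 0"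
  shows "w v = 0"
proof -
  have basis: "w v = 0" if "\<forall>i\<in>{1..k}. v i \<in> u ` M" for v
  proof -
    have "\<forall>i\<in>{1..k}. \<exists>m. m \<in> M \<and> v i = u m" using that by blast
    from bchoice[OF this] obtain g where g: "\<And>i. i \<in> {1..k} \<Longrightarrow> g i \<in> M \<and> v i = u (g i)"
      by blast
    show ?thesis
    proof (cases "inj_on g {1..k}")
      case True
      then obtain \<sigma> p where \<sigma>: "\<sigma> \<in> increasing_maps k M" and p: "p permutes {1..k}"
        and gp: "\<And>i. i \<in> {1..k} \<Longrightarrow> g i = \<sigma> (p i)"
        using injective_eq_increasing_permuted[of g k M] g by blast
      have "w v = w ((u \<circ> \<sigma>) \<circ> p)"
        by (rule alternatingD_cong[OF w]) (simp add: g gp del: atLeastAtMost_iff)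
      then show ?thesis
        using alternating_permute_zero[OF w p zero[OF \<sigma>]] by simp
    next
      case False
      then obtain i j where "i \<in> {1..k}" "j \<in> {1..k}" "i \<noteq> j" "g i = g j"
        by (auto simp: inj_on_def)
      then show ?thesis
        using g by (intro alternatingD_repeat[OF w, of i j]) auto
    qed
  qed
  \<comment> \<open>Induction on the number \<open>j\<close> of leading arguments that are
    arbitrary; the later ones are still taken from the spanning family.\<close>
  have "\<forall>v. (\<forall>i\<in>{1..k}. j < i \<longrightarrow> v i \<in> u ` M) \<longrightarrow> w v = 0" if "j \<le> k" for j
    using that
  proof (induction j)
    case 0
    then show ?case using basis by auto
  next
    case (Suc j)
    show ?case
    proof (intro allI impI)
      fix v :: "nat \<Rightarrow> real ^ 'a" assume v: "\<forall>i\<in>{1..k}. Suc j < i \<longrightarrow> v i \<in> u ` M"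
      have lin: "linear (\<lambda>y. w (v(Suc j := y)))"
        using Suc.prems by (intro alternatingD_linear[OF w]) auto
      have "w (v(Suc j := y)) = 0" if "y \<in> u ` M" for y
      proof -
        have "\<forall>i\<in>{1..k}. j < i \<longrightarrow> (v(Suc j := y)) i \<in> u ` M"
          using that v by (auto simp del: atLeastAtMost_iff dest: Suc_lessI)
        then show ?thesis using Suc by auto
      qed
      then have "w (v(Suc j := v (Suc j))) = 0"
        by (rule linear_eq_0_on_span[OF lin]) (auto simp: span)
      then show "w v = 0" by simp
    qed
  qed
  from this[of k] show ?thesis by auto
qed

section \<open>Wedge products of linear functionals\<close>

lemma alternating_wedge:
  assumes lin: "\<And>i. i \<in> {1..k} \<Longrightarrow> linear (a i)"
  shows "alternating k (wedge k a)"
  unfolding alternating_def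
proof (intro conjI allI ballI impI)
  fix v v' :: "nat \<Rightarrow> real ^ 'a"
  assume eq: "\<forall>i\<in>{1..k}. v i = v' i"
  show "wedge k a v = wedge k a v'"
    unfolding wedge_def
    by (intro sum.cong prod.cong arg_cong2[where f="(*)"] refl)
       (use eq permutes_in_image in fastforce)
next
  fix v :: "nat \<Rightarrow> real ^ 'a" and i assume i: "i \<in> {1..k}"
  show "linear (\<lambda>y. wedge k a (v(i := y)))"
    unfolding wedge_def
  proof (intro linear_compose_sum ballI)
    fix p assume "p \<in> {p. p permutes {1..k}}"
    then have p: "p permutes {1..k}" by simp
    \<comment> \<open>In the Leibniz term of \<open>p\<close> the argument \<open>v i\<close> enters
      exactly one factor, the one with number \<open>j\<close>; the term is therefore linear in
      it.\<close>
    define j where "j = inv p i"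
    have j: "j \<in> {1..k}" "p j = i"
      using permutes_inverses(1)[OF p] i permutes_in_image[OF permutes_inv[OF p], of i]
      unfolding j_def by simp_all
    have ne: "p m \<noteq> i" if "m \<noteq> j" for m
      using j that permutes_inj[OF p] by (auto simp: inj_def)
    have "(\<Prod>m\<in>{1..k}. a m ((v(i := y)) (p m))) =
        a j y * (\<Prod>m\<in>{1..k} - {j}. a m (v (p m)))" for y
      using j ne by (subst prod.remove[of _ j]) (auto intro!: prod.cong)
    then have eq: "of_int (sign p) * (\<Prod>m\<in>{1..k}. a m ((v(i := y)) (p m))) =
       (of_int (sign p) * (\<Prod>m\<in>{1..k} - {j}. a m (v (p m)))) *\<^sub>R a j y" for y
      by simp
    show "linear (\<lambda>y. of_int (sign p) * (\<Prod>m\<in>{1..k}. a m ((v(i := y)) (p m))))"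
      unfolding eq by (intro linear_compose_scale_right lin j)
  qed
next
  fix v :: "nat \<Rightarrow> real ^ 'a" and i j
  assume i: "i \<in> {1..k}" and j: "j \<in> {1..k}" and ij: "i \<noteq> j \<and> v i = v j"
  let ?t = "Transposition.transpose i j"
  have t: "?t permutes {1..k}" using i j by (rule permutes_swap_id)
  have vt: "v (?t m) = v m" for m
    using ij by (auto simp: Transposition.transpose_def)
  \<comment> \<open>Composing each permutation with the transposition flips its sign and leaves the
    product unchanged, because \<open>v i = v j\<close>. Hence the wedge equals its own
    negative.\<close>
  have "wedge k a v =
      (\<Sum>p | p permutes {1..k}. of_int (sign (?t \<circ> p)) * (\<Prod>m\<in>{1..k}. a m (v ((?t \<circ> p) m))))"
    unfolding wedge_def
    by (rule sum.reindex_bij_witness[of _ "\<lambda>p. ?t \<circ> p" "\<lambda>p. ?t \<circ> p"])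
       (simp_all add: o_assoc permutes_compose[OF _ t, simplified])
  also have "\<dots> = (\<Sum>p | p permutes {1..k}. - (of_int (sign p) * (\<Prod>m\<in>{1..k}. a m (v (p m)))))"
  proof (rule sum.cong[OF refl])
    fix p assume "p \<in> {p. p permutes {1..k}}"
    then have "permutation p" using permutation_permutes finite_atLeastAtMost by blast
    then have "sign (?t \<circ> p) = - sign p"
      using ij by (simp add: sign_compose permutation_swap_id sign_swap_id)
    then show "of_int (sign (?t \<circ> p)) * (\<Prod>m\<in>{1..k}. a m (v ((?t \<circ> p) m))) =
        - (of_int (sign p) * (\<Prod>m\<in>{1..k}. a m (v (p m))))"
      by (simp add: vt)
  qed
  also have "\<dots> = - wedge k a v"
    unfolding wedge_def by (simp add: sum_negf)
  finally show "wedge k a v = 0" by simp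
qed

text \<open>The hypothesis says that the matrix \<open>a \<sigma> u \<tau>\<close> is the identity up to entries which no nonzero
  term of the Leibniz expansion can contain.\<close>

lemma wedge_increasing_delta:
  assumes \<sigma>: "\<sigma> \<in> increasing_maps k M" and \<tau>: "\<tau> \<in> increasing_maps k M"
    and diag: "\<And>i. i \<in> {1..k} \<Longrightarrow> a i (u (\<sigma> i)) = 1"
    and off: "\<And>i j. i \<in> {1..k} \<Longrightarrow> j \<in> {1..k} \<Longrightarrow> a i (u (\<tau> j)) \<noteq> 0 \<Longrightarrow>
      \<tau> j = \<sigma> i \<or> \<tau> j \<in> \<sigma> ` K"
    and K: "K \<subseteq> {1..k}"
    and offK: "\<And>i j. i \<in> K \<Longrightarrow> j \<in> {1..k} \<Longrightarrow> a i (u (\<tau> j)) \<noteq> 0 \<Longrightarrow> \<tau> j = \<sigma> i"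
  shows "wedge k a (u \<circ> \<tau>) = (if \<tau> = \<sigma> then 1 else 0)"
proof -
  have only: "p = id \<and> \<tau> = \<sigma>"
    if p: "p permutes {1..k}" and nz: "(\<Prod>i\<in>{1..k}. a i ((u \<circ> \<tau>) (p i))) \<noteq> 0" for p
  proof -
    have pin: "p i \<in> {1..k}" if "i \<in> {1..k}" for i
      using p that by (simp add: permutes_in_image del: atLeastAtMost_iff)
    have ne: "a i (u (\<tau> (p i))) \<noteq> 0" if "i \<in> {1..k}" for i
      using nz that by (auto simp del: atLeastAtMost_iff)
    \<comment> \<open>A stray entry in row \<open>i\<close> has column index
      \<open>\<sigma> i'\<close> with \<open>i'\<close> in \<open>K\<close>. Row \<open>i'\<close>
      admits no other column, so \<open>p\<close> would take the same value at \<open>i\<close> and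
      \<open>i'\<close>.\<close>
    have eq: "\<tau> (p i) = \<sigma> i" if i: "i \<in> {1..k}" for i
    proof (rule ccontr)
      assume neq: "\<tau> (p i) \<noteq> \<sigma> i"
      then obtain i' where i': "i' \<in> K" "\<tau> (p i) = \<sigma> i'"
        using off[OF i pin[OF i] ne[OF i]] by auto
      then have ik: "i' \<in> {1..k}" using K by auto
      have "\<tau> (p i') = \<sigma> i'" using offK[OF i'(1) pin[OF ik] ne[OF ik]] .
      then have "p i = p i'"
        using increasing_maps_inj[OF \<tau>] pin[OF i] pin[OF ik] i' by (metis inj_onD)
      then show False using permutes_inj[OF p] neq i' by (auto dest: injD)
    qed
    \<comment> \<open>Both \<open>\<sigma>\<close> and \<open>\<tau>\<close> are increasing, so
      \<open>p\<close> is increasing as well, and an increasing permutation is the identity.\<close>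
    have mono: "p i < p j" if "i \<in> {1..k}" "j \<in> {1..k}" "i < j" for i j
    proof -
      have "\<tau> (p i) < \<tau> (p j)"
        using eq that \<sigma> by (auto simp: increasing_maps_def strict_mono_on_def simp del: atLeastAtMost_iff)
      then show ?thesis
        using \<tau> pin that strict_mono_on_less[of "{1..k}" \<tau> "p i" "p j"]
        by (auto simp: increasing_maps_def simp del: atLeastAtMost_iff)
    qed
    have "p i = i" if "i \<in> {1..k}" for i
    proof -
      \<comment> \<open>This bound together with equal sums forces equality everywhere.\<close>
      have "\<forall>i\<in>{1..k}. i \<le> p i"
      proof
        fix i assume "i \<in> {1..k}"
        then show "i \<le> p i"
        proof (induction i)
          case (Suc i)
          show ?case
          proof (cases "i = 0")
            case True
            then show ?thesis using pin[OF Suc.prems] by auto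
          next
            case False
            then have "i \<in> {1..k}" using Suc.prems by auto
            then show ?thesis
              using Suc.IH mono[of i "Suc i"] Suc.prems by simp
          qed
        qed simp
      qed
      moreover have "(\<Sum>i\<in>{1..k}. p i) = \<Sum>{1..k}"
        using sum.permute[OF p, of id] by simp
      ultimately show ?thesis
        using sum_mono_inv[of "\<lambda>i. i" "{1..k}" p] that by (auto simp del: atLeastAtMost_iff)
    qed
    then have pid: "p = id"
      using p unfolding permutes_def by (metis eq_id_iff)
    moreover have "\<tau> = \<sigma>"
      using \<sigma> \<tau> eq pid unfolding increasing_maps_def by (auto intro: PiE_ext simp del: atLeastAtMost_iff)
    ultimately show ?thesis by simp
  qed
  have "wedge k a (u \<circ> \<tau>) =
      (\<Sum>p\<in>{id}. of_int (sign p) * (\<Prod>i\<in>{1..k}. a i ((u \<circ> \<tau>) (p i))))"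
    unfolding wedge_def using only
    by (intro sum.mono_neutral_right) (auto simp: finite_permutations permutes_id)
  also have "\<dots> = (\<Prod>i\<in>{1..k}. a i (u (\<tau> i)))"
    by simp
  also have "\<dots> = (if \<tau> = \<sigma> then 1 else 0)"
  proof (cases "\<tau> = \<sigma>")
    case True
    then show ?thesis using diag by (simp add: prod.neutral)
  next
    case False
    then have "(\<Prod>i\<in>{1..k}. a i ((u \<circ> \<tau>) (id i))) = 0"
      using only[OF permutes_id] by blast
    then show ?thesis using False by simp
  qed
  finally show ?thesis .
qed

section \<open>Homogeneous polynomials\<close>

text \<open>Extension by zero makes an exponent on a face literally an exponent on every simplex
  containing that face, so coefficients found on different simplices can be compared under the same
  name.\<close>

definition exponents :: "'i set \<Rightarrow> nat \<Rightarrow> ('i \<Rightarrow> nat) set" where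
  "exponents I r = {\<alpha>. (\<forall>i. i \<notin> I \<longrightarrow> \<alpha> i = 0) \<and> sum \<alpha> I = r}"

lemma finite_bounded_exponents:
  assumes "finite I"
  shows "finite {\<alpha> :: 'i \<Rightarrow> nat. (\<forall>i. i \<notin> I \<longrightarrow> \<alpha> i = 0) \<and> sum \<alpha> I \<le> r}"
proof -
  have "{\<alpha> :: 'i \<Rightarrow> nat. (\<forall>i. i \<notin> I \<longrightarrow> \<alpha> i = 0) \<and> sum \<alpha> I \<le> r}
      \<subseteq> {\<alpha>. \<forall>i. (i \<in> I \<longrightarrow> \<alpha> i \<in> {..r}) \<and> (i \<notin> I \<longrightarrow> \<alpha> i = 0)}"
    using member_le_sum[of _ I] assms by (auto intro: order_trans)
  then show ?thesis
    by (rule finite_subset) (use finite_set_of_finite_funs[OF assms, of "{..r}" 0] in simp)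
qed

lemma finite_exponents: "finite I \<Longrightarrow> finite (exponents I r)"
  by (rule finite_subset[OF _ finite_bounded_exponents[of I r]]) (auto simp: exponents_def)

text \<open>The coordinate functions \<open>X\<close> are a parameter so that Cartesian and
  barycentric monomials share the same closure rules.\<close>

definition monomial_combinations ::
    "('i \<Rightarrow> 'p \<Rightarrow> real) \<Rightarrow> 'i set \<Rightarrow> ('i \<Rightarrow> nat) set \<Rightarrow> ('p \<Rightarrow> real) set" where
  "monomial_combinations X I A = {q. \<exists>c. \<forall>y. q y = (\<Sum>\<alpha>\<in>A. c \<alpha> * (\<Prod>i\<in>I. X i y ^ \<alpha> i))}"

lemma monomial_combinationsI:
  "(\<And>y. q y = (\<Sum>\<alpha>\<in>A. c \<alpha> * (\<Prod>i\<in>I. X i y ^ \<alpha> i))) \<Longrightarrow> q \<in> monomial_combinations X I A"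
  unfolding monomial_combinations_def by blast

lemma monomial_combinations_add:
  assumes "p \<in> monomial_combinations X I A" "q \<in> monomial_combinations X I A"
  shows "(\<lambda>y. p y + q y) \<in> monomial_combinations X I A"
proof -
  obtain c d where "\<forall>y. p y = (\<Sum>\<alpha>\<in>A. c \<alpha> * (\<Prod>i\<in>I. X i y ^ \<alpha> i))"
    "\<forall>y. q y = (\<Sum>\<alpha>\<in>A. d \<alpha> * (\<Prod>i\<in>I. X i y ^ \<alpha> i))"
    using assms unfolding monomial_combinations_def by blast
  then show ?thesis
    by (intro monomial_combinationsI[where c = "\<lambda>\<alpha>. c \<alpha> + d \<alpha>"])
       (simp add: sum.distrib distrib_right)
qed

lemma monomial_combinations_scale:
  assumes "q \<in> monomial_combinations X I A"
  shows "(\<lambda>y. a * q y) \<in> monomial_combinations X I A"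
proof -
  obtain c where "\<forall>y. q y = (\<Sum>\<alpha>\<in>A. c \<alpha> * (\<Prod>i\<in>I. X i y ^ \<alpha> i))"
    using assms unfolding monomial_combinations_def by blast
  then show ?thesis
    by (intro monomial_combinationsI[where c = "\<lambda>\<alpha>. a * c \<alpha>"])
       (simp add: sum_distrib_left mult.assoc)
qed

lemma monomial_combinations_sum:
  assumes "\<And>b. b \<in> B \<Longrightarrow> g b \<in> monomial_combinations X I A"
  shows "(\<lambda>y. \<Sum>b\<in>B. c b * g b y) \<in> monomial_combinations X I A"
  using assms
proof (induction B rule: infinite_finite_induct)
  case (insert b B)
  then show ?case
    using monomial_combinations_add[OF monomial_combinations_scale[of "g b" X I A "c b"], of "\<lambda>y. \<Sum>b\<in>B. c b * g b y"]
    by simp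
qed (auto intro!: monomial_combinationsI[where c = "\<lambda>_. 0"])

lemma monomial_in_combinations:
  assumes "finite A" "\<beta> \<in> A"
  shows "(\<lambda>y. \<Prod>i\<in>I. X i y ^ \<beta> i) \<in> monomial_combinations X I A"
  using assms
  by (intro monomial_combinationsI[where c = "\<lambda>\<alpha>. if \<alpha> = \<beta> then 1 else 0"])
     (simp add: if_distrib[of "\<lambda>c. c * _"] cong: if_cong)

lemma monomial_combinations_mult:
  assumes "finite I" "j \<in> I" "finite B" and q: "q \<in> monomial_combinations X I A"
    and sub: "\<And>\<alpha>. \<alpha> \<in> A \<Longrightarrow> \<alpha>(j := Suc (\<alpha> j)) \<in> B"
  shows "(\<lambda>y. X j y * q y) \<in> monomial_combinations X I B"
proof -
  obtain c where c: "\<forall>y. q y = (\<Sum>\<alpha>\<in>A. c \<alpha> * (\<Prod>i\<in>I. X i y ^ \<alpha> i))"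
    using q unfolding monomial_combinations_def by blast
  have "X j y * (\<Prod>i\<in>I. X i y ^ \<alpha> i) = (\<Prod>i\<in>I. X i y ^ (\<alpha>(j := Suc (\<alpha> j))) i)" for y \<alpha>
    using assms(1,2) by (simp add: prod.remove[of I j] mult.assoc cong: prod.cong_simp)
  then have "X j y * q y =
      (\<Sum>\<alpha>\<in>A. c \<alpha> * (\<Prod>i\<in>I. X i y ^ (\<alpha>(j := Suc (\<alpha> j))) i))" for y
    by (simp only: c[rule_format] sum_distrib_left mult.left_commute)
  then show ?thesis
    using monomial_combinations_sum[of A "\<lambda>\<alpha> y. \<Prod>i\<in>I. X i y ^ (\<alpha>(j := Suc (\<alpha> j))) i", OF
        monomial_in_combinations[OF \<open>finite B\<close> sub]] by presburger
qed

text \<open>Multiplying by one factor at a time lets \<open>P\<close> keep track of the degree. It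
  serves both for passing from Cartesian to barycentric coordinates and for the way back.\<close>

lemma prod_powers_induct:
  assumes "finite I" "P 0 (\<lambda>y. 1)"
    and step: "\<And>r q i. i \<in> I \<Longrightarrow> P r q \<Longrightarrow> P (Suc r) (\<lambda>y. L i y * q y)"
  shows "P (\<Sum>i\<in>I. \<alpha> i) (\<lambda>y. \<Prod>i\<in>I. L i y ^ \<alpha> i :: real)"
proof -
  have "P (\<Sum>i\<in>K. \<alpha> i) (\<lambda>y. \<Prod>i\<in>K. L i y ^ \<alpha> i)" if "K \<subseteq> I" "finite K" for K
    using that(2,1)
  proof (induction K rule: finite_induct)
    case (insert j K)
    have "P (m + (\<Sum>i\<in>K. \<alpha> i)) (\<lambda>y. L j y ^ m * (\<Prod>i\<in>K. L i y ^ \<alpha> i))" for m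
    proof (induction m)
      case (Suc m)
      then show ?case using step[OF _ Suc, of j] insert.prems by (simp add: mult.assoc)
    qed (use insert in simp)
    from this[of "\<alpha> j"] show ?case using insert.hyps by simp
  qed (use assms in simp)
  from this[OF order_refl \<open>finite I\<close>] show ?thesis .
qed

section \<open>Polynomials of bounded degree in Cartesian coordinates\<close>

lemma polynomial_le_iff:
  "polynomial_le r q \<longleftrightarrow>
    q \<in> monomial_combinations (\<lambda>i y. y $ i) UNIV {\<beta>. (\<Sum>i\<in>UNIV. \<beta> i) \<le> r}"
  unfolding polynomial_le_def monomial_combinations_def by simp

lemma finite_exponents_le: "finite {\<beta> :: 'n::finite \<Rightarrow> nat. (\<Sum>i\<in>UNIV. \<beta> i) \<le> r}"
  using finite_bounded_exponents[of "UNIV :: 'n set" r] by simp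

lemma polynomial_le_const: "polynomial_le r (\<lambda>y. c)"
proof -
  have "(\<lambda>y :: real ^ 'n. \<Prod>i\<in>UNIV. y $ i ^ 0) \<in>
      monomial_combinations (\<lambda>i y. y $ i) UNIV {\<beta>. (\<Sum>i\<in>UNIV. \<beta> i) \<le> r}"
    by (rule monomial_in_combinations[OF finite_exponents_le]) simp
  from monomial_combinations_scale[OF this, of c] show ?thesis
    unfolding polynomial_le_iff by simp
qed

lemma polynomial_le_scale: "polynomial_le r q \<Longrightarrow> polynomial_le r (\<lambda>y. c * q y)"
  unfolding polynomial_le_iff by (rule monomial_combinations_scale)

lemma polynomial_le_affine_mult:
  assumes q: "polynomial_le r q"
  shows "polynomial_le (Suc r) (\<lambda>y. (a \<bullet> y + b) * q y)"
proof -
  obtain c where "\<forall>y. q y = (\<Sum>\<beta> | (\<Sum>i\<in>UNIV. \<beta> i) \<le> r. c \<beta> * (\<Prod>i\<in>UNIV. (y $ i) ^ \<beta> i))"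
    using q unfolding polynomial_le_def by blast
  \<comment> \<open>The constant \<open>b\<close> does not raise the degree, so \<open>q\<close> is
    reread in degree \<open>Suc r\<close>, with coefficient 0 at the new monomials.\<close>
  then have "polynomial_le (Suc r) q"
    unfolding polynomial_le_def
    by (intro exI[of _ "\<lambda>\<beta>. if (\<Sum>i\<in>UNIV. \<beta> i) \<le> r then c \<beta> else 0"] allI)
       (auto simp: if_distrib[of "\<lambda>c. c * _"] sum.If_cases finite_exponents_le
         intro!: sum.cong cong: if_cong)
  moreover have "polynomial_le (Suc r) (\<lambda>y. y $ i * q y)" for i
    using q unfolding polynomial_le_iff
    by (rule monomial_combinations_mult[OF _ _ finite_exponents_le, rotated 2])
       (auto simp: sum.remove[of UNIV i] cong: sum.cong_simp)
  ultimately have "polynomial_le (Suc r) (\<lambda>y. (\<Sum>i\<in>UNIV. a $ i * (y $ i * q y)) + b * q y)"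
    unfolding polynomial_le_iff
    by (intro monomial_combinations_add monomial_combinations_scale monomial_combinations_sum) auto
  moreover have "(\<Sum>i\<in>UNIV. a $ i * (y $ i * q y)) + b * q y = (a \<bullet> y + b) * q y" for y
    by (simp add: inner_vec_def sum_distrib_right distrib_right mult.assoc)
  ultimately show ?thesis by simp
qed

text \<open>Induction over the variables: for fixed values of the others the sum is a polynomial in
  one variable with infinitely many roots, and its coefficient at \<open>\<alpha> j\<close> is a sum
  over a slice of \<open>A\<close>. Positive values are what interior points of a simplex
  supply.\<close>

lemma monomials_independent:
  assumes "finite I" "finite A"
    and "\<And>\<alpha> \<beta>. \<alpha> \<in> A \<Longrightarrow> \<beta> \<in> A \<Longrightarrow> (\<And>i. i \<in> I \<Longrightarrow> \<alpha> i = \<beta> i) \<Longrightarrow> \<alpha> = \<beta>"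
    and "\<And>t. (\<And>i. i \<in> I \<Longrightarrow> 0 < t i) \<Longrightarrow> (\<Sum>\<alpha>\<in>A. c \<alpha> * (\<Prod>i\<in>I. t i ^ \<alpha> i)) = (0 :: real)"
    and "\<alpha> \<in> A"
  shows "c \<alpha> = 0"
  using assms
proof (induction I arbitrary: A rule: finite_induct)
  case empty
  have "A = {\<alpha>}" using empty(2,4) by blast
  then show ?case using empty(3) by simp
next
  case (insert j I)
  \<comment> \<open>Exponents in this slice agree at \<open>j\<close>, so the remaining variables
    still tell them apart.\<close>
  let ?A = "{\<beta> \<in> A. \<beta> j = \<alpha> j}"
  show ?case
  proof (rule insert.IH[of ?A])
    show "finite ?A" using insert by simp
    show "\<alpha> \<in> ?A" using insert by simp
    show "\<beta> = \<gamma>" if "\<beta> \<in> ?A" "\<gamma> \<in> ?A" "\<And>i. i \<in> I \<Longrightarrow> \<beta> i = \<gamma> i" for \<beta> \<gamma>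
    proof (rule insert.prems(2))
      show "\<beta> i = \<gamma> i" if "i \<in> insert j I" for i
        using that \<open>\<beta> \<in> ?A\<close> \<open>\<gamma> \<in> ?A\<close> \<open>\<And>i. i \<in> I \<Longrightarrow> \<beta> i = \<gamma> i\<close> by auto
    qed (use that in auto)
    fix t :: "'a \<Rightarrow> real" assume t: "\<And>i. i \<in> I \<Longrightarrow> 0 < t i"
    define P where "P = (\<Sum>\<beta>\<in>A. monom (c \<beta> * (\<Prod>i\<in>I. t i ^ \<beta> i)) (\<beta> j))"
    have "poly P s = 0" if "0 < s" for s
    proof -
      have "(\<Sum>\<beta>\<in>A. c \<beta> * (\<Prod>i\<in>insert j I. (t(j := s)) i ^ \<beta> i)) = 0"
        using t that by (intro insert.prems(3)) auto
      moreover have "(\<Prod>i\<in>insert j I. (t(j := s)) i ^ \<beta> i) = s ^ \<beta> j * (\<Prod>i\<in>I. t i ^ \<beta> i)" for \<beta>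
      proof -
        have "(\<Prod>i\<in>I. (t(j := s)) i ^ \<beta> i) = (\<Prod>i\<in>I. t i ^ \<beta> i)"
          using insert.hyps by (intro prod.cong) auto
        then show ?thesis using insert.hyps by simp
      qed
      ultimately show ?thesis
        by (simp add: P_def poly_sum poly_monom ac_simps)
    qed
    then have "{0<..} \<subseteq> {s. poly P s = 0}" by auto
    then have "infinite {s. poly P s = 0}"
      using infinite_Ioi finite_subset by blast
    then have "P = 0" using poly_roots_finite by blast
    then have "0 = coeff P (\<alpha> j)" by simp
    also have "\<dots> = (\<Sum>\<beta>\<in>A. if \<beta> j = \<alpha> j then c \<beta> * (\<Prod>i\<in>I. t i ^ \<beta> i) else 0)"
      by (simp add: P_def coeff_sum)
    also have "\<dots> = (\<Sum>\<beta>\<in>?A. c \<beta> * (\<Prod>i\<in>I. t i ^ \<beta> i))"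
      using \<open>finite A\<close> by (simp add: sum.inter_filter)
    finally show "(\<Sum>\<beta>\<in>?A. c \<beta> * (\<Prod>i\<in>I. t i ^ \<beta> i)) = 0" by simp
  qed
qed

text \<open>By homogeneity, multiplying by \<open>s ^ r\<close> carries the vanishing from the
  points whose coordinates sum to 1 to the whole positive orthant.\<close>

lemma homogeneous_zero_on_simplex:
  assumes "finite I" "I \<noteq> {}"
    and zero: "\<And>t. (\<And>i. i \<in> I \<Longrightarrow> 0 < t i) \<Longrightarrow> sum t I = 1 \<Longrightarrow>
      (\<Sum>\<alpha>\<in>exponents I r. c \<alpha> * (\<Prod>i\<in>I. t i ^ \<alpha> i)) = (0 :: real)"
    and "\<alpha> \<in> exponents I r"
  shows "c \<alpha> = 0"
proof (rule monomials_independent[OF \<open>finite I\<close> finite_exponents[OF \<open>finite I\<close>] _ _ \<open>\<alpha> \<in> _\<close>])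
  show "\<alpha> = \<beta>" if "\<alpha> \<in> exponents I r" "\<beta> \<in> exponents I r" "\<And>i. i \<in> I \<Longrightarrow> \<alpha> i = \<beta> i" for \<alpha> \<beta>
    using that by (fastforce simp: exponents_def)
  fix t :: "'a \<Rightarrow> real" assume t: "\<And>i. i \<in> I \<Longrightarrow> 0 < t i"
  define s where "s = sum t I"
  have s: "0 < s" unfolding s_def using assms(1,2) t by (intro sum_pos) auto
  have "0 = s ^ r * (\<Sum>\<alpha>\<in>exponents I r. c \<alpha> * (\<Prod>i\<in>I. (t i / s) ^ \<alpha> i))"
    using s t by (subst zero) (auto simp: sum_divide_distrib[symmetric] s_def)
  also have "\<dots> = (\<Sum>\<alpha>\<in>exponents I r. c \<alpha> * (\<Prod>i\<in>I. t i ^ \<alpha> i))"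
    unfolding sum_distrib_left
  proof (rule sum.cong[OF refl])
    fix \<alpha> assume "\<alpha> \<in> exponents I r"
    then have "s ^ r = (\<Prod>i\<in>I. s ^ \<alpha> i)"
      using power_sum[of s \<alpha> I] by (simp add: exponents_def)
    then have "s ^ r * (\<Prod>i\<in>I. (t i / s) ^ \<alpha> i) = (\<Prod>i\<in>I. t i ^ \<alpha> i)"
      using s by (simp add: prod.distrib[symmetric] power_divide)
    then show "s ^ r * (c \<alpha> * (\<Prod>i\<in>I. (t i / s) ^ \<alpha> i)) = c \<alpha> * (\<Prod>i\<in>I. t i ^ \<alpha> i)"
      by (metis mult.left_commute)
  qed
  finally show "(\<Sum>\<alpha>\<in>exponents I r. c \<alpha> * (\<Prod>i\<in>I. t i ^ \<alpha> i)) = 0" by simp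
qed

section \<open>Barycentric coordinates\<close>

text \<open>The numbering may cover more than the vertices of \<open>T\<close>: a single one is
  shared by all simplices of a triangulation, so that indices, exponents and dual vectors keep their
  meaning from one simplex to the next.\<close>

locale vertex_simplex =
  fixes x :: "nat \<Rightarrow> real ^ 'n::finite" and N :: nat and T :: "(real ^ 'n) set"
  assumes simplex: "int CARD('n) simplex T"
    and inj: "inj_on x {0..N}"
    and vertices: "{v. v extreme_point_of T} \<subseteq> x ` {0..N}"
begin

abbreviation "I \<equiv> vertex_indices x N T"
abbreviation "lam \<equiv> barycentric x N T"

lemma finite_I: "finite I"
  unfolding vertex_indices_def by simp

lemma I_le: "I \<subseteq> {0..N}"
  unfolding vertex_indices_def by auto

lemma inj_I: "inj_on x I"
  using inj I_le inj_on_subset by blast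

lemma image_I: "x ` I = {v. v extreme_point_of T}"
  using vertices unfolding vertex_indices_def by auto

lemma independent_I: "\<not> affine_dependent (x ` I)" and hull_I: "T = convex hull (x ` I)"
  and card_I: "card I = CARD('n) + 1"
proof -
  obtain C where C: "\<not> affine_dependent C" "int (card C) = int CARD('n) + 1" "T = convex hull C"
    using simplex unfolding simplex_def by blast
  then have "x ` I = C"
    unfolding image_I by (auto simp: extreme_point_of_convex_hull_affine_independent)
  then show "\<not> affine_dependent (x ` I)" "T = convex hull (x ` I)" "card I = CARD('n) + 1"
    using C card_image[OF inj_I] by auto
qed

lemma affine_hull_I: "affine hull (x ` I) = UNIV"
  using aff_dim_affine_independent[OF independent_I] card_I card_image[OF inj_I]
  by (simp flip: aff_dim_eq_full)

text \<open>The points where two affine functions agree form an affine set, and the affine hull of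
  the vertices is the whole space.\<close>

lemma affine_eqI:
  assumes "\<And>j. j \<in> I \<Longrightarrow> a \<bullet> x j + b = a' \<bullet> x j + b'"
  shows "a \<bullet> y + b = a' \<bullet> y + (b' :: real)"
proof -
  have "x ` I \<subseteq> {y. (a - a') \<bullet> y = b' - b}"
    using assms by (auto simp: inner_diff_left algebra_simps)
  then have "affine hull (x ` I) \<subseteq> {y. (a - a') \<bullet> y = b' - b}"
    by (rule hull_minimal) (rule affine_hyperplane)
  then show ?thesis
    unfolding affine_hull_I by (auto simp: inner_diff_left algebra_simps)
qed

text \<open>The edge vectors from \<open>x i\<close> are independent, so some linear functional
  equals -1 on all of them; the additive constant then makes the value 1 at
  \<open>x i\<close>.\<close>

lemma barycentric_exists:
  assumes i: "i \<in> I"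
  shows "\<exists>a b. \<forall>j\<in>I. a \<bullet> x j + b = (if j = i then 1 else 0 :: real)"
proof -
  let ?B = "(\<lambda>v. - x i + v) ` (x ` I - {x i})"
  have "independent ?B"
    using independent_I affine_dependent_iff_dependent2[of "x i" "x ` I"] i by blast
  from linear_independent_extend[OF this, of "\<lambda>_. - 1 :: real"] obtain g :: "real ^ 'n \<Rightarrow> real"
    where g: "linear g" and gB: "\<forall>v\<in>?B. g v = - 1" by blast
  define a where "a = adjoint g 1"
  have a: "a \<bullet> v = g v" for v
    using adjoint_works[OF g, of v 1] by (simp add: a_def inner_commute)
  have "a \<bullet> x j + (1 - a \<bullet> x i) = (if j = i then 1 else 0)" if "j \<in> I" for j
  proof (cases "j = i")
    case False
    then have "x j \<noteq> x i" using inj_onD[OF inj_I] that i by blast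
    then have "- x i + x j \<in> ?B" using that by blast
    from gB[rule_format, OF this] have "a \<bullet> (- x i + x j) = - 1" unfolding a .
    then have "- (a \<bullet> x i) + a \<bullet> x j = - 1" by (simp only: inner_add_right inner_minus_right)
    then show ?thesis using False by simp
  qed simp
  then show ?thesis by blast
qed

lemma barycentric_affine_vertex:
  assumes i: "i \<in> I"
  shows "(\<exists>a b. lam i = (\<lambda>y. a \<bullet> y + b)) \<and> (\<forall>j\<in>I. lam i (x j) = (if j = i then 1 else 0))"
proof -
  obtain a b where ab: "\<forall>j\<in>I. a \<bullet> x j + b = (if j = i then 1 else 0 :: real)"
    using barycentric_exists[OF i] by blast
  show ?thesis
    unfolding barycentric_def
  proof (rule theI[of _ "\<lambda>y. a \<bullet> y + b"])
    fix l assume l: "(\<exists>a b. l = (\<lambda>y. a \<bullet> y + b)) \<and> (\<forall>j\<in>I. l (x j) = (if j = i then 1 else 0))"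
    then obtain a' b' where "l = (\<lambda>y. a' \<bullet> y + b')" by blast
    have "a' \<bullet> y + b' = a \<bullet> y + b" for y
    proof (rule affine_eqI)
      fix j assume j: "j \<in> I"
      have "l (x j) = (if j = i then 1 else 0)" using l j by blast
      moreover have "l (x j) = a' \<bullet> x j + b'" by (simp add: \<open>l = _\<close>)
      ultimately show "a' \<bullet> x j + b' = a \<bullet> x j + b" using ab[rule_format, OF j] by simp
    qed
    then show "l = (\<lambda>y. a \<bullet> y + b)"
      using \<open>l = _\<close> by blast
  qed (use ab in auto)
qed

lemma barycentric_affineE:
  assumes "i \<in> I"
  obtains a b where "\<And>y. lam i y = a \<bullet> y + b"
  using barycentric_affine_vertex[OF assms] by metis

lemma barycentric_vertex: "i \<in> I \<Longrightarrow> j \<in> I \<Longrightarrow> lam i (x j) = (if j = i then 1 else 0)"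
  using barycentric_affine_vertex by blast

lemma continuous_barycentric:
  assumes "i \<in> I"
  shows "continuous_on A (lam i)"
proof -
  obtain a b where "\<And>y. lam i y = a \<bullet> y + b" using barycentric_affineE[OF assms] by blast
  then have "lam i = (\<lambda>y. a \<bullet> y + b)" by blast
  then show ?thesis by (auto intro!: continuous_intros)
qed

text \<open>Both sides are affine and agree at the vertices. Constant vertex values give the
  partition of unity, and the vertex values of a Cartesian coordinate give that coordinate.\<close>

lemma sum_vertex_values_barycentric:
  assumes c: "\<And>j. j \<in> I \<Longrightarrow> c j = a \<bullet> x j + b"
  shows "(\<Sum>i\<in>I. c i * lam i y) = a \<bullet> y + b"
proof -
  have "\<forall>i\<in>I. \<exists>p. \<forall>y. lam i y = fst p \<bullet> y + snd p"
    using barycentric_affineE by (metis fst_conv snd_conv)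
  from bchoice[OF this] obtain p where "\<forall>i\<in>I. \<forall>y. lam i y = fst (p i) \<bullet> y + snd (p i)" ..
  then obtain A B where AB: "\<And>i y. i \<in> I \<Longrightarrow> lam i y = A i \<bullet> y + B i"
    using that[of "\<lambda>i. fst (p i)" "\<lambda>i. snd (p i)"] by blast
  have eq: "(\<Sum>i\<in>I. c i * lam i y) = (\<Sum>i\<in>I. c i *\<^sub>R A i) \<bullet> y + (\<Sum>i\<in>I. c i * B i)" for y
    by (simp add: AB inner_sum_left distrib_left sum.distrib)
  have "(\<Sum>i\<in>I. c i *\<^sub>R A i) \<bullet> x j + (\<Sum>i\<in>I. c i * B i) = a \<bullet> x j + b" if "j \<in> I" for j
    unfolding eq[symmetric] using that c finite_I
    by (simp add: barycentric_vertex if_distrib[of "\<lambda>s. _ * s"] cong: if_cong)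
  from affine_eqI[OF this] show ?thesis unfolding eq .
qed

lemma sum_barycentric: "(\<Sum>i\<in>I. lam i y) = 1"
  using sum_vertex_values_barycentric[of "\<lambda>_. 1" 0 1] by simp

lemma component_barycentric: "(\<Sum>i\<in>I. x i $ m * lam i y) = y $ m"
  using sum_vertex_values_barycentric[of "\<lambda>i. x i $ m" "axis m 1" 0 y]
  by (simp add: inner_axis')

lemma barycentric_combination: "(\<Sum>i\<in>I. lam i y *\<^sub>R x i) = y"
  unfolding vec_eq_iff using component_barycentric by (simp add: mult.commute)

lemma barycentric_of_combination:
  assumes "sum t I = 1" "j \<in> I"
  shows "lam j (\<Sum>i\<in>I. t i *\<^sub>R x i) = t j"
proof -
  obtain a b where ab: "\<And>y. lam j y = a \<bullet> y + b" using barycentric_affineE[OF assms(2)] by blast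
  have "lam j (\<Sum>i\<in>I. t i *\<^sub>R x i) = (\<Sum>i\<in>I. t i * (a \<bullet> x i)) + (\<Sum>i\<in>I. t i) * b"
    using assms(1) by (simp add: ab inner_sum_right)
  also have "\<dots> = (\<Sum>i\<in>I. t i * lam j (x i))"
    by (simp add: ab distrib_left sum.distrib sum_distrib_right)
  also have "\<dots> = t j"
    using assms(2) finite_I by (simp add: barycentric_vertex if_distrib[of "\<lambda>s. _ * s"] cong: if_cong)
  finally show ?thesis .
qed

text \<open>\<open>lam i v - lam i 0\<close> is the linear part of \<open>lam i\<close>, that is,
  the differential of \<open>lam i\<close> applied to \<open>v\<close>; on a difference of points
  the constants cancel.\<close>

lemma barycentric_diff:
  assumes "i \<in> I"
  shows "lam i (p - q) - lam i 0 = lam i p - lam i q"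
proof -
  obtain a b where "\<And>y. lam i y = a \<bullet> y + b" using barycentric_affineE[OF assms] by blast
  then show ?thesis by (simp add: inner_diff_right)
qed

lemma linear_barycentric:
  assumes "i \<in> I"
  shows "linear (\<lambda>v. lam i v - lam i 0)"
proof -
  obtain a b where ab: "\<And>y. lam i y = a \<bullet> y + b" using barycentric_affineE[OF assms] by blast
  show ?thesis by (rule linearI) (simp_all add: ab inner_add_right)
qed

lemma d_barycentric_eq:
  assumes "i \<in> I"
  shows "d_barycentric x N T i y = (\<lambda>v. lam i v - lam i 0)"
proof -
  obtain a b where "\<And>y. lam i y = a \<bullet> y + b" using barycentric_affineE[OF assms] by blast
  then have ab: "lam i = (\<lambda>y. a \<bullet> y + b)" by blast
  have "(lam i has_derivative (\<lambda>v. a \<bullet> v)) (at y)"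
    unfolding ab by (auto intro!: derivative_eq_intros)
  from frechet_derivative_at[OF this] have "d_barycentric x N T i y = (\<lambda>v. a \<bullet> v)"
    unfolding d_barycentric_def by (rule sym)
  then show ?thesis by (simp only:) (simp add: ab)
qed

text \<open>One criterion for the simplex and its faces: \<open>K = I\<close> describes
  \<open>T\<close>, and a proper subset adds the vanishing of the remaining coordinates.\<close>

lemma convex_hull_mem:
  assumes "K \<subseteq> I"
  shows "y \<in> convex hull (x ` K) \<longleftrightarrow> (\<forall>i\<in>I. 0 \<le> lam i y) \<and> (\<forall>i\<in>I - K. lam i y = 0)"
proof
  have fin: "finite K" using assms finite_I finite_subset by blast
  have injK: "inj_on x K" using assms inj_I inj_on_subset by blast
  assume "y \<in> convex hull (x ` K)"
  then obtain u where u: "\<forall>v\<in>x ` K. 0 \<le> u v" "sum u (x ` K) = 1" "(\<Sum>v\<in>x ` K. u v *\<^sub>R v) = y"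
    using convex_hull_finite[of "x ` K"] fin by auto
  define t where "t i = (if i \<in> K then u (x i) else 0)" for i
  have "sum t I = sum t K" "(\<Sum>i\<in>I. t i *\<^sub>R x i) = (\<Sum>i\<in>K. t i *\<^sub>R x i)"
    using assms finite_I by (intro sum.mono_neutral_right; auto simp: t_def)+
  then have "sum t I = 1" "(\<Sum>i\<in>I. t i *\<^sub>R x i) = y"
    using u(2,3) injK by (auto simp: sum.reindex t_def)
  then have "lam i y = t i" if "i \<in> I" for i
    using barycentric_of_combination[of t i] that by simp
  then show "(\<forall>i\<in>I. 0 \<le> lam i y) \<and> (\<forall>i\<in>I - K. lam i y = 0)"
    using u(1) by (auto simp: t_def)
next
  assume y: "(\<forall>i\<in>I. 0 \<le> lam i y) \<and> (\<forall>i\<in>I - K. lam i y = 0)"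
  have "(\<Sum>i\<in>K. lam i y) = (\<Sum>i\<in>I. lam i y)"
    using assms finite_I y by (intro sum.mono_neutral_left) auto
  then have 1: "(\<Sum>i\<in>K. lam i y) = 1" by (simp add: sum_barycentric)
  have "(\<Sum>i\<in>K. lam i y *\<^sub>R x i) = (\<Sum>i\<in>I. lam i y *\<^sub>R x i)"
    using assms finite_I y by (intro sum.mono_neutral_left) auto
  then have 2: "(\<Sum>i\<in>K. lam i y *\<^sub>R x i) = y" by (simp add: barycentric_combination)
  have "(\<Sum>i\<in>K. lam i y *\<^sub>R x i) \<in> convex hull (x ` K)"
    using 1 y assms finite_subset[OF assms finite_I]
    by (intro convex_sum) (auto intro: hull_inc)
  then show "y \<in> convex hull (x ` K)" by (simp add: 2)
qed

lemma mem_iff_barycentric: "y \<in> T \<longleftrightarrow> (\<forall>i\<in>I. 0 \<le> lam i y)"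
  using convex_hull_mem[of I] hull_I by simp

lemma interior_barycentric:
  assumes "\<And>i. i \<in> I \<Longrightarrow> 0 < lam i y"
  shows "y \<in> interior T"
proof (rule interiorI)
  show "open (\<Inter>i\<in>I. {y. 0 < lam i y})"
    using finite_I by (intro open_INT ballI open_Collect_less continuous_on_const continuous_barycentric) auto
  show "(\<Inter>i\<in>I. {y. 0 < lam i y}) \<subseteq> T"
    unfolding subset_iff mem_iff_barycentric by (auto intro: less_imp_le)
qed (use assms in auto)

lemma convex_T: "convex T" and compact_T: "compact T"
  using simplex by (auto intro: convex_simplex compact_simplex)

text \<open>Affine independence keeps every listed vertex extreme. Faces can therefore be handled
  through their sets of vertex indices.\<close>

lemma vertex_indices_hull:
  assumes "K \<subseteq> I"
  shows "vertex_indices x N (convex hull (x ` K)) = K"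
proof -
  have "\<not> affine_dependent (x ` K)"
    using affine_independent_subset[OF independent_I] assms by blast
  then have "vertex_indices x N (convex hull (x ` K)) = {i \<in> {0..N}. x i \<in> x ` K}"
    by (simp add: vertex_indices_def extreme_point_of_convex_hull_affine_independent)
  also have "\<dots> = K"
    using inj_on_image_mem_iff[OF inj, of _ K] assms I_le by blast
  finally show ?thesis .
qed

lemma hull_in_faces:
  assumes "K \<subseteq> I" "K \<noteq> {}"
  shows "convex hull (x ` K) \<in> faces T"
proof -
  have "convex hull (x ` K) face_of T"
    using assms(1) face_of_convex_hull_affine_independent[OF independent_I]
    unfolding hull_I[symmetric] by blast
  then show ?thesis using assms(2) by (simp add: faces_def)
qed

lemma faces_hull:
  assumes "f \<in> faces T"
  shows "vertex_indices x N f \<subseteq> I" "f = convex hull (x ` vertex_indices x N f)"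
    "vertex_indices x N f \<noteq> {}"
proof -
  obtain C where C: "C \<subseteq> x ` I" "f = convex hull C"
    using assms face_of_convex_hull_affine_independent[OF independent_I]
    unfolding faces_def hull_I[symmetric] by blast
  then obtain K where K: "K \<subseteq> I" "C = x ` K" by (meson subset_imageE)
  then have "vertex_indices x N f = K" using C vertex_indices_hull by simp
  then show "vertex_indices x N f \<subseteq> I" "f = convex hull (x ` vertex_indices x N f)"
    using K C by auto
  then show "vertex_indices x N f \<noteq> {}"
    using assms unfolding faces_def by auto
qed

lemma aff_dim_face:
  assumes "f \<in> faces T"
  shows "aff_dim f + 1 = int (card (vertex_indices x N f))"
proof -
  let ?K = "vertex_indices x N f"
  have "\<not> affine_dependent (x ` ?K)"
    by (rule affine_independent_subset[OF independent_I]) (use faces_hull[OF assms] in auto)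
  from aff_dim_affine_independent[OF this] have "int (card (x ` ?K)) = aff_dim (x ` ?K) + 1"
    by simp
  moreover have "aff_dim f = aff_dim (x ` ?K)"
    by (subst faces_hull(2)[OF assms]) (rule aff_dim_convex_hull)
  moreover have "card (x ` ?K) = card ?K"
    by (rule card_image[OF inj_on_subset[OF inj_I faces_hull(1)[OF assms]]])
  ultimately show ?thesis by simp
qed

lemma face_subset_iff:
  assumes "f \<in> faces T" "g \<in> faces T"
  shows "f \<subseteq> g \<longleftrightarrow> vertex_indices x N f \<subseteq> vertex_indices x N g"
proof
  assume "f \<subseteq> g"
  then have "f face_of g"
    using assms face_of_face[of g T f] unfolding faces_def by blast
  then show "vertex_indices x N f \<subseteq> vertex_indices x N g"
    unfolding vertex_indices_def using extreme_point_of_face by blast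
next
  assume "vertex_indices x N f \<subseteq> vertex_indices x N g"
  then show "f \<subseteq> g"
    using faces_hull(2)[OF assms(1)] faces_hull(2)[OF assms(2)] by (metis hull_mono image_mono)
qed

lemma barycentric_zero_on_face:
  assumes "f \<in> faces T" "i \<in> I" "i \<notin> vertex_indices x N f" "y \<in> f"
  shows "lam i y = 0"
  using assms convex_hull_mem[OF faces_hull(1)[OF assms(1)], of y] faces_hull(2)[OF assms(1)] by auto

lemma barycentric_zero_on_tangent:
  assumes "f \<in> faces T" "i \<in> I" "i \<notin> vertex_indices x N f" "v \<in> tangent_space f"
  shows "lam i v - lam i 0 = 0"
proof (rule linear_eq_0_on_span[OF linear_barycentric[OF \<open>i \<in> I\<close>]])
  show "v \<in> span {a - b |a b. a \<in> f \<and> b \<in> f}"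
    using assms(4) unfolding tangent_space_def .
  fix u assume "u \<in> {a - b |a b. a \<in> f \<and> b \<in> f}"
  then obtain a b where "u = a - b" "a \<in> f" "b \<in> f" by blast
  then show "lam i u - lam i 0 = 0"
    using barycentric_zero_on_face[OF assms(1-3)] barycentric_diff[OF \<open>i \<in> I\<close>, of a b] by simp
qed

end

text \<open>Both coordinates are affine and take the same values at the vertices of
  \<open>f\<close>. In directions transversal to \<open>f\<close> they may differ, which is why the
  differentials are compared on tangent vectors only.\<close>

lemma barycentric_eq_on_face:
  assumes "vertex_simplex x N T" "vertex_simplex x N T'" "f \<in> faces T" "f \<in> faces T'"
    and i: "i \<in> vertex_indices x N f"
  shows "y \<in> f \<Longrightarrow> barycentric x N T i y = barycentric x N T' i y"
    and "v \<in> tangent_space f \<Longrightarrow>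
      barycentric x N T i v - barycentric x N T i 0 = barycentric x N T' i v - barycentric x N T' i 0"
proof -
  interpret S: vertex_simplex x N T by fact
  interpret S': vertex_simplex x N T' by fact
  note sub = S.faces_hull(1)[OF assms(3)] S'.faces_hull(1)[OF assms(4)]
  have eq: "S.lam i y = S'.lam i y" if "y \<in> f" for y
  proof -
    have "i \<in> S.I" "i \<in> S'.I" using sub i by auto
    then obtain a b a' b' where ab: "\<And>y. S.lam i y = a \<bullet> y + b" "\<And>y. S'.lam i y = a' \<bullet> y + b'"
      using S.barycentric_affineE S'.barycentric_affineE by metis
    have "x ` vertex_indices x N f \<subseteq> {y. (a - a') \<bullet> y = b' - b}"
    proof clarify
      fix j assume "j \<in> vertex_indices x N f"
      then have "S.lam i (x j) = S'.lam i (x j)"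
        using S.barycentric_vertex[of i j] S'.barycentric_vertex[of i j] sub i by (simp add: subset_iff)
      then show "(a - a') \<bullet> x j = b' - b" by (simp add: ab inner_diff_left)
    qed
    then have "convex hull (x ` vertex_indices x N f) \<subseteq> {y. (a - a') \<bullet> y = b' - b}"
      by (rule hull_minimal) (rule convex_hyperplane)
    then have "f \<subseteq> {y. (a - a') \<bullet> y = b' - b}" using S.faces_hull(2)[OF assms(3)] by simp
    then show ?thesis using that by (auto simp: ab inner_diff_left algebra_simps)
  qed
  then show "y \<in> f \<Longrightarrow> S.lam i y = S'.lam i y" .
  have "i \<in> S.I" "i \<in> S'.I" using sub i by auto
  note lin = S.linear_barycentric[OF this(1)] S'.linear_barycentric[OF this(2)]
    and diff = S.barycentric_diff[OF this(1)] S'.barycentric_diff[OF this(2)]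
  assume v: "v \<in> tangent_space f"
  show "S.lam i v - S.lam i 0 = S'.lam i v - S'.lam i 0"
  proof (rule linear_eq_on_span[OF lin])
    show "v \<in> span {a - b |a b. a \<in> f \<and> b \<in> f}"
      using v unfolding tangent_space_def .
    fix u assume "u \<in> {a - b |a b. a \<in> f \<and> b \<in> f}"
    then obtain a b where "u = a - b" "a \<in> f" "b \<in> f" by blast
    then show "S.lam i u - S.lam i 0 = S'.lam i u - S'.lam i 0"
      by (simp only: diff eq)
  qed
qed

section \<open>Dual vectors\<close>

definition base :: "(nat \<Rightarrow> nat) \<Rightarrow> nat" where
  "base \<alpha> = Min {i. 0 < \<alpha> i}"

text \<open>For an exponent \<open>\<alpha>\<close> of degree \<open>r\<close> with support \<open>S\<close>, the vectors with index \<open>m \<noteq> base \<alpha>\<close> are dual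
  to the functionals \<open>d\<lambda>\<^sub>m\<close> for \<open>m \<notin> S\<close> and \<open>d\<lambda>\<^sub>m - (\<alpha> m / r) (\<Sum>j\<in>S. d\<lambda>\<^sub>j)\<close> for \<open>m \<in> S\<close>.\<close>

definition dual_vector ::
    "(nat \<Rightarrow> real ^ 'n) \<Rightarrow> nat \<Rightarrow> (nat \<Rightarrow> nat) \<Rightarrow> nat \<Rightarrow> real ^ 'n::finite" where
  "dual_vector x r \<alpha> m =
     x m - (if 0 < \<alpha> m then x (base \<alpha>) else \<Sum>i | 0 < \<alpha> i. (real (\<alpha> i) / real r) *\<^sub>R x i)"

text \<open>The vertex set of the face belonging to a pair; the covering condition in
  \<open>index_set\<close> leaves no other choice.\<close>

definition pair_vertices :: "nat \<Rightarrow> (nat \<Rightarrow> nat) \<Rightarrow> (nat \<Rightarrow> nat) \<Rightarrow> nat set" where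
  "pair_vertices k \<alpha> \<sigma> = {i. 0 < \<alpha> i} \<union> \<sigma> ` {1..k}"

text \<open>The basis indices of one simplex with the face eliminated: \<open>\<alpha>\<close>
  ranges over exponents on all vertices of the simplex, and the face is recovered from support and
  range.\<close>

definition pairs :: "nat set \<Rightarrow> nat \<Rightarrow> nat \<Rightarrow> ((nat \<Rightarrow> nat) \<times> (nat \<Rightarrow> nat)) set" where
  "pairs I r k = (SIGMA \<alpha>:exponents I r. increasing_maps k (I - {base \<alpha>}))"

text \<open>The exponent is restricted because \<open>index_set\<close> uses extensional functions,
  undefined off the face, whereas \<open>exponents\<close> uses functions that are 0 there.\<close>

definition pair_index ::
    "(nat \<Rightarrow> real ^ 'n) \<Rightarrow> nat \<Rightarrow> (nat \<Rightarrow> nat) \<times> (nat \<Rightarrow> nat) \<Rightarrow>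
     (real ^ 'n::finite) set \<times> (nat \<Rightarrow> nat) \<times> (nat \<Rightarrow> nat)" where
  "pair_index x k = (\<lambda>(\<alpha>, \<sigma>).
     (convex hull (x ` pair_vertices k \<alpha> \<sigma>), restrict \<alpha> (pair_vertices k \<alpha> \<sigma>), \<sigma>))"

definition index_form ::
    "(nat \<Rightarrow> real ^ 'n) \<Rightarrow> nat \<Rightarrow> nat \<Rightarrow> (real ^ 'n) set \<Rightarrow>
     (real ^ 'n) set \<times> (nat \<Rightarrow> nat) \<times> (nat \<Rightarrow> nat) \<Rightarrow> 'n::finite diff_form" where
  "index_form x N k T = (\<lambda>(f, \<alpha>, \<sigma>). local_form x N k \<alpha> \<sigma> f T)"

lemma finite_pairs: "finite I \<Longrightarrow> finite (pairs I r k)"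
  unfolding pairs_def by (intro finite_SigmaI finite_exponents finite_increasing_maps) auto

lemma exponents_support:
  assumes "finite I" "\<alpha> \<in> exponents I r" "r \<ge> 1"
  shows "{i. 0 < \<alpha> i} \<subseteq> I" "base \<alpha> \<in> I" "0 < \<alpha> (base \<alpha>)" "\<And>i. 0 < \<alpha> i \<Longrightarrow> base \<alpha> \<le> i"
    "finite {i. 0 < \<alpha> i}"
proof -
  show sub: "{i. 0 < \<alpha> i} \<subseteq> I"
    using assms(2) unfolding exponents_def by force
  show fin: "finite {i. 0 < \<alpha> i}" using finite_subset[OF sub assms(1)] .
  have "sum \<alpha> I \<noteq> 0" using assms unfolding exponents_def by auto
  then have "{i. 0 < \<alpha> i} \<noteq> {}" by (auto simp: sum_eq_0_iff[OF assms(1)])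
  then have "base \<alpha> \<in> {i. 0 < \<alpha> i}" unfolding base_def using Min_in fin by blast
  then show "base \<alpha> \<in> I" "0 < \<alpha> (base \<alpha>)" using sub by auto
  show "base \<alpha> \<le> i" if "0 < \<alpha> i" for i
    unfolding base_def using fin that by (intro Min_le) auto
qed

context vertex_simplex
begin

lemma psi_eq:
  assumes "F \<subseteq> I" "i \<in> F" "sum \<alpha> F = r"
  shows "psi x N (restrict \<alpha> F) (convex hull (x ` F)) T i y v =
    (lam i v - lam i 0) - real (\<alpha> i) / real r * (\<Sum>j\<in>F. lam j v - lam j 0)"
proof -
  have "d_barycentric x N T j y v = lam j v - lam j 0" if "j \<in> F" for j
    using d_barycentric_eq[of j y] that assms(1) by auto
  then show ?thesis
    using assms by (simp add: psi_def vertex_indices_hull)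
qed

lemma linear_psi:
  assumes "F \<subseteq> I" "i \<in> F"
  shows "linear (psi x N \<alpha> (convex hull (x ` F)) T i y)"
proof -
  have "linear (d_barycentric x N T j y)" if "j \<in> F" for j
    using d_barycentric_eq[of j y] linear_barycentric[of j] that assms(1) by auto
  then show ?thesis
    using assms unfolding psi_def[abs_def] vertex_indices_hull[OF assms(1)]
    by (intro linear_compose_sub linear_compose_scale_right[where f="\<lambda>v. \<Sum>j\<in>F. d_barycentric x N T j y v",
          unfolded real_scaleR_def] linear_compose_sum) auto
qed

context
  fixes r :: nat and \<alpha> :: "nat \<Rightarrow> nat"
  assumes \<alpha>: "\<alpha> \<in> exponents I r" and r: "r \<ge> 1"
begin

text \<open>The subtracted point has known barycentric coordinates: it is the vertex
  \<open>x (base \<alpha>)\<close>, or the weighted centre with coordinates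
  \<open>\<alpha> j / r\<close>.\<close>

lemma barycentric_dual_vector:
  assumes "j \<in> I" "m \<in> I"
  shows "lam j (dual_vector x r \<alpha> m) - lam j 0 =
    (if j = m then 1 else 0) -
      (if 0 < \<alpha> m then if j = base \<alpha> then 1 else 0 else real (\<alpha> j) / real r)"
proof (cases "0 < \<alpha> m")
  case True
  then show ?thesis
    using assms exponents_support[OF finite_I \<alpha> r]
    by (simp add: dual_vector_def barycentric_diff barycentric_vertex)
next
  case False
  have "(\<Sum>i | 0 < \<alpha> i. (real (\<alpha> i) / real r) *\<^sub>R x i) = (\<Sum>i\<in>I. (real (\<alpha> i) / real r) *\<^sub>R x i)"
    using exponents_support(1)[OF finite_I \<alpha> r] finite_I by (intro sum.mono_neutral_left) auto
  moreover have "(\<Sum>i\<in>I. real (\<alpha> i) / real r) = 1"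
    using \<alpha> r by (simp add: exponents_def flip: sum_divide_distrib of_nat_sum)
  ultimately show ?thesis
    using assms False barycentric_of_combination[of "\<lambda>i. real (\<alpha> i) / real r" j]
    by (simp add: dual_vector_def barycentric_diff barycentric_vertex)
qed

text \<open>All edges from \<open>x (base \<alpha>)\<close> are recovered: those to the support are
  dual vectors themselves, the weighted centre differs from \<open>x (base \<alpha>)\<close> by a
  combination of these, and this difference turns the other dual vectors into the remaining
  edges.\<close>

lemma span_dual_vectors: "span (dual_vector x r \<alpha> ` (I - {base \<alpha>})) = UNIV"
proof -
  let ?S = "span (dual_vector x r \<alpha> ` (I - {base \<alpha>}))"
  note supp = exponents_support[OF finite_I \<alpha> r]
  have dual: "dual_vector x r \<alpha> m \<in> ?S" if "m \<in> I" "m \<noteq> base \<alpha>" for m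
    using that by (auto intro: span_base)
  have pos: "x m - x (base \<alpha>) \<in> ?S" if "0 < \<alpha> m" for m
    using dual[of m] supp(1) that by (cases "m = base \<alpha>") (auto simp: dual_vector_def span_zero)
  let ?t = "\<Sum>i | 0 < \<alpha> i. (real (\<alpha> i) / real r) *\<^sub>R x i"
  have "(\<Sum>i | 0 < \<alpha> i. real (\<alpha> i) / real r) = (\<Sum>i\<in>I. real (\<alpha> i) / real r)"
    using supp(1) finite_I by (intro sum.mono_neutral_left) auto
  also have "\<dots> = 1"
    using \<alpha> r by (simp add: exponents_def flip: sum_divide_distrib of_nat_sum)
  finally have "?t - x (base \<alpha>) =
      (\<Sum>i | 0 < \<alpha> i. (real (\<alpha> i) / real r) *\<^sub>R (x i - x (base \<alpha>)))"
    by (simp add: scaleR_diff_right sum_subtractf flip: scaleR_left.sum)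
  also have "\<dots> \<in> ?S"
    using pos by (intro span_sum span_scale) auto
  finally have t: "?t - x (base \<alpha>) \<in> ?S" .
  have vert: "x m - x (base \<alpha>) \<in> ?S" if m: "m \<in> I" for m
  proof (cases "0 < \<alpha> m")
    case False
    then have "m \<noteq> base \<alpha>" using supp(3) by auto
    from span_add[OF dual[OF m this] t] show ?thesis
      using False by (simp add: dual_vector_def)
  qed (rule pos)
  have "v \<in> ?S" for v
  proof -
    \<comment> \<open>The barycentric coordinates of this translated point sum to 1, so they expand
      \<open>v\<close> in the edges from \<open>x (base \<alpha>)\<close>.\<close>
    let ?y = "x (base \<alpha>) + v"
    have "v = (\<Sum>i\<in>I. lam i ?y *\<^sub>R x i) - (\<Sum>i\<in>I. lam i ?y) *\<^sub>R x (base \<alpha>)"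
      by (simp add: barycentric_combination sum_barycentric)
    also have "\<dots> = (\<Sum>i\<in>I. lam i ?y *\<^sub>R (x i - x (base \<alpha>)))"
      by (simp add: scaleR_diff_right sum_subtractf scaleR_left.sum)
    also have "\<dots> \<in> ?S" using vert by (intro span_sum span_scale)
    finally show ?thesis .
  qed
  then show ?thesis by blast
qed

context
  fixes k :: nat and \<sigma> :: "nat \<Rightarrow> nat"
  assumes \<sigma>: "\<sigma> \<in> increasing_maps k (I - {base \<alpha>})"
begin

lemma pair_vertices_subset: "pair_vertices k \<alpha> \<sigma> \<subseteq> I"
  using exponents_support(1)[OF finite_I \<alpha> r] \<sigma>
  by (auto simp: pair_vertices_def increasing_maps_def)

lemma sum_pair_vertices: "sum \<alpha> (pair_vertices k \<alpha> \<sigma>) = r"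
proof -
  have "sum \<alpha> (pair_vertices k \<alpha> \<sigma>) = sum \<alpha> I"
    using pair_vertices_subset finite_I
    by (intro sum.mono_neutral_left) (auto simp: pair_vertices_def)
  then show ?thesis using \<alpha> by (simp add: exponents_def)
qed

text \<open>The sum in psi runs over \<open>F\<close>; on the dual vector it equals 0 for
  \<open>m\<close> in \<open>F\<close> and -1 otherwise. For \<open>m\<close> outside
  \<open>F\<close> it cancels the contribution of the weighted centre. For \<open>m\<close> in
  \<open>F\<close> but outside the support that contribution survives as the stray entry.\<close>

lemma psi_dual_vector:
  assumes i: "i \<in> pair_vertices k \<alpha> \<sigma>" "i \<noteq> base \<alpha>" and m: "m \<in> I" "m \<noteq> base \<alpha>"
  defines "F \<equiv> pair_vertices k \<alpha> \<sigma>"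
  shows "psi x N (restrict \<alpha> F) (convex hull (x ` F)) T i y (dual_vector x r \<alpha> m) =
    (if m = i then 1 else 0) - (if \<alpha> m = 0 \<and> m \<in> F then real (\<alpha> i) / real r else 0)"
proof -
  note supp = exponents_support[OF finite_I \<alpha> r]
  have F: "F \<subseteq> I" "sum \<alpha> F = r" "finite F"
    using pair_vertices_subset sum_pair_vertices finite_subset[OF _ finite_I] by (auto simp: F_def)
  have "base \<alpha> \<in> F" using supp(3) by (simp add: F_def pair_vertices_def)
  have inF: "m \<in> F" if "0 < \<alpha> m" using that by (simp add: F_def pair_vertices_def)
  have "(\<Sum>j\<in>F. lam j (dual_vector x r \<alpha> m) - lam j 0) =
      (\<Sum>j\<in>F. (if j = m then 1 else 0) -
        (if 0 < \<alpha> m then if j = base \<alpha> then 1 else 0 else real (\<alpha> j) / real r))"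
    using F(1) m(1) by (intro sum.cong refl barycentric_dual_vector) auto
  also have "\<dots> = (if m \<in> F then 1 else 0) - 1"
  proof (cases "0 < \<alpha> m")
    case True
    then show ?thesis using F(3) \<open>base \<alpha> \<in> F\<close> by (simp add: sum_subtractf)
  next
    case False
    have "(\<Sum>j\<in>F. real (\<alpha> j) / real r) = 1"
      using F(2) r by (simp flip: sum_divide_distrib of_nat_sum)
    then show ?thesis using False F(3) by (simp add: sum_subtractf)
  qed
  finally have s: "(\<Sum>j\<in>F. lam j (dual_vector x r \<alpha> m) - lam j 0) = (if m \<in> F then 1 else 0) - 1" .
  have "i \<in> F" "i \<in> I" using i F(1) by (auto simp: F_def)
  then show ?thesis
    unfolding psi_eq[OF F(1) \<open>i \<in> F\<close> F(2)] s barycentric_dual_vector[OF \<open>i \<in> I\<close> m(1)]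
    using inF i(2) by auto
qed

lemma psi_wedge_dual_vectors:
  assumes \<tau>: "\<tau> \<in> increasing_maps k (I - {base \<alpha>})"
  defines "F \<equiv> pair_vertices k \<alpha> \<sigma>"
  shows "psi_wedge x N k (restrict \<alpha> F) \<sigma> (convex hull (x ` F)) T y (dual_vector x r \<alpha> \<circ> \<tau>) =
    (if \<tau> = \<sigma> then 1 else 0)"
proof -
  have \<sigma>F: "\<sigma> i \<in> F" "\<sigma> i \<in> I" "\<sigma> i \<noteq> base \<alpha>" if "i \<in> {1..k}" for i
    using increasing_maps_mem[OF \<sigma> that] that unfolding F_def pair_vertices_def by blast+
  have \<tau>I: "\<tau> i \<in> I" "\<tau> i \<noteq> base \<alpha>" if "i \<in> {1..k}" for i
    using increasing_maps_mem[OF \<tau> that] by blast+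
  \<comment> \<open>The columns of stray entries are vertices in \<open>F\<close> outside the
    support, hence in the image of \<open>?K\<close>. A stray entry carries the factor
    \<open>\<alpha> (\<sigma> i)\<close>, which is 0 in the rows of \<open>?K\<close>.\<close>
  let ?K = "{i \<in> {1..k}. \<alpha> (\<sigma> i) = 0}"
  note psi = psi_dual_vector[folded F_def]
  have K: "m \<in> \<sigma> ` ?K" if "\<alpha> m = 0" "m \<in> F" for m
    using that by (auto simp: F_def pair_vertices_def)
  show ?thesis
    unfolding psi_wedge_def
  proof (rule wedge_increasing_delta[OF \<sigma> \<tau>])
    show "psi x N (restrict \<alpha> F) (convex hull (x ` F)) T (\<sigma> i) y (dual_vector x r \<alpha> (\<sigma> i)) = 1"
      if "i \<in> {1..k}" for i
      using psi[OF \<sigma>F(1,3) \<sigma>F(2,3)] that by simp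
    fix i j assume i: "i \<in> {1..k}" and j: "j \<in> {1..k}"
      and nz: "psi x N (restrict \<alpha> F) (convex hull (x ` F)) T (\<sigma> i) y (dual_vector x r \<alpha> (\<tau> j)) \<noteq> 0"
    show "\<tau> j = \<sigma> i \<or> \<tau> j \<in> \<sigma> ` ?K"
    proof (rule ccontr)
      assume not: "\<not> (\<tau> j = \<sigma> i \<or> \<tau> j \<in> \<sigma> ` ?K)"
      then have "\<not> (\<alpha> (\<tau> j) = 0 \<and> \<tau> j \<in> F)" using K by blast
      then show False
        using psi[OF \<sigma>F(1,3)[OF i] \<tau>I[OF j], of y] nz not by (simp split: if_splits)
    qed
  next
    fix i j assume i: "i \<in> ?K" and j: "j \<in> {1..k}"
      and nz: "psi x N (restrict \<alpha> F) (convex hull (x ` F)) T (\<sigma> i) y (dual_vector x r \<alpha> (\<tau> j)) \<noteq> 0"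
    have i1: "i \<in> {1..k}" and a0: "\<alpha> (\<sigma> i) = 0" using i by auto
    show "\<tau> j = \<sigma> i"
      using psi[OF \<sigma>F(1,3)[OF i1] \<tau>I[OF j], of y] nz by (simp add: a0 split: if_splits)
  qed auto
qed

lemma alternating_psi_wedge:
  defines "F \<equiv> pair_vertices k \<alpha> \<sigma>"
  shows "alternating k (psi_wedge x N k \<beta> \<sigma> (convex hull (x ` F)) T y)"
  unfolding psi_wedge_def F_def
  by (intro alternating_wedge linear_psi[OF pair_vertices_subset]) (simp add: pair_vertices_def)

text \<open>Vertices outside \<open>F\<close> have exponent 0, so the product may run over all of
  \<open>I\<close>: forms with the same \<open>\<alpha>\<close> share one monomial, whatever their
  face.\<close>

lemma index_form_pair:
  defines "F \<equiv> pair_vertices k \<alpha> \<sigma>"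
  shows "index_form x N k T (pair_index x k (\<alpha>, \<sigma>)) y v =
    (\<Prod>i\<in>I. lam i y ^ \<alpha> i) * psi_wedge x N k (restrict \<alpha> F) \<sigma> (convex hull (x ` F)) T y v"
proof -
  have "(\<Prod>i\<in>F. lam i y ^ restrict \<alpha> F i) = (\<Prod>i\<in>F. lam i y ^ \<alpha> i)"
    by simp
  also have "\<dots> = (\<Prod>i\<in>I. lam i y ^ \<alpha> i)"
    using pair_vertices_subset finite_I unfolding F_def
    by (intro prod.mono_neutral_left) (auto simp: pair_vertices_def)
  finally show ?thesis
    using pair_vertices_subset
    by (simp add: index_form_def pair_index_def local_form_def vertex_indices_hull F_def)
qed

end

text \<open>The coefficients are evaluations at dual tuples. Both sides agree on increasing tuples
  of the spanning dual vectors, and such tuples determine an alternating form.\<close>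

lemma alternating_expansion:
  assumes w: "alternating k w"
  defines "F \<equiv> pair_vertices k \<alpha>"
  shows "w v = (\<Sum>\<sigma>\<in>increasing_maps k (I - {base \<alpha>}). w (dual_vector x r \<alpha> \<circ> \<sigma>) *
    psi_wedge x N k (restrict \<alpha> (F \<sigma>)) \<sigma> (convex hull (x ` F \<sigma>)) T y v)"
    (is "_ = ?R v")
proof -
  have "w v - ?R v = 0"
  proof (rule alternating_eq_zero[where w = "\<lambda>v. w v - ?R v", OF _ span_dual_vectors])
    show "alternating k (\<lambda>v. w v - ?R v)"
      unfolding F_def by (intro alternating_diff w alternating_sum alternating_scale alternating_psi_wedge)
    fix \<tau> assume \<tau>: "\<tau> \<in> increasing_maps k (I - {base \<alpha>})"
    have "?R (dual_vector x r \<alpha> \<circ> \<tau>) = (\<Sum>\<sigma>\<in>increasing_maps k (I - {base \<alpha>}).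
        w (dual_vector x r \<alpha> \<circ> \<sigma>) * (if \<tau> = \<sigma> then 1 else 0))"
      unfolding F_def by (intro sum.cong refl arg_cong2[where f = "(*)"] psi_wedge_dual_vectors \<tau>)
    also have "\<dots> = w (dual_vector x r \<alpha> \<circ> \<tau>)"
      using \<tau> finite_increasing_maps[of "I - {base \<alpha>}" k] finite_I
      by (simp add: if_distrib[of "\<lambda>s. _ * s"] cong: if_cong)
    finally show "w (dual_vector x r \<alpha> \<circ> \<tau>) - ?R (dual_vector x r \<alpha> \<circ> \<tau>) = 0" by simp
  qed
  then show ?thesis by (rule eq_iff_diff_eq_0[THEN iffD2])
qed

end


section \<open>Polynomial forms on one simplex\<close>

definition monomial_sum :: "nat \<Rightarrow> ((nat \<Rightarrow> nat) \<Rightarrow> real) \<Rightarrow> real ^ 'n \<Rightarrow> real" where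
  "monomial_sum r c y = (\<Sum>\<alpha>\<in>exponents I r. c \<alpha> * (\<Prod>i\<in>I. lam i y ^ \<alpha> i))"

text \<open>The coordinates off \<open>K\<close> vanish, so a face sees exactly the coefficients
  whose exponent is supported in it.\<close>

lemma monomial_sum_on_face:
  assumes K: "K \<subseteq> I" and t: "sum t K = 1"
  shows "monomial_sum r c (\<Sum>i\<in>K. t i *\<^sub>R x i) =
    (\<Sum>\<alpha>\<in>exponents K r. c \<alpha> * (\<Prod>i\<in>K. t i ^ \<alpha> i))"
proof -
  let ?y = "\<Sum>i\<in>K. t i *\<^sub>R x i"
  define s where "s i = (if i \<in> K then t i else 0)" for i
  have "sum s I = sum s K" "(\<Sum>i\<in>I. s i *\<^sub>R x i) = (\<Sum>i\<in>K. s i *\<^sub>R x i)"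
    using K finite_I by (intro sum.mono_neutral_right; auto simp: s_def)+
  then have "sum s I = 1" "(\<Sum>i\<in>I. s i *\<^sub>R x i) = ?y"
    using t by (simp_all add: s_def)
  then have lam: "lam i ?y = s i" if "i \<in> I" for i
    using barycentric_of_combination[of s i] that by simp
  have "monomial_sum r c ?y = (\<Sum>\<alpha>\<in>exponents I r. c \<alpha> * (\<Prod>i\<in>I. s i ^ \<alpha> i))"
    unfolding monomial_sum_def by (simp add: lam)
  also have "\<dots> = (\<Sum>\<alpha>\<in>exponents K r. c \<alpha> * (\<Prod>i\<in>I. s i ^ \<alpha> i))"
  proof (rule sum.mono_neutral_right[OF finite_exponents[OF finite_I]])
    have "sum \<alpha> I = sum \<alpha> K" if "\<forall>i. i \<notin> K \<longrightarrow> \<alpha> i = 0" for \<alpha> :: "nat \<Rightarrow> nat"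
      using K finite_I that by (intro sum.mono_neutral_right) auto
    note sum_eq = this
    show "exponents K r \<subseteq> exponents I r"
      using K sum_eq by (auto simp: exponents_def)
    show "\<forall>\<alpha>\<in>exponents I r - exponents K r. c \<alpha> * (\<Prod>i\<in>I. s i ^ \<alpha> i) = 0"
    proof
      fix \<alpha> assume \<alpha>: "\<alpha> \<in> exponents I r - exponents K r"
      then obtain i where "i \<notin> K" "\<alpha> i \<noteq> 0"
        using sum_eq[of \<alpha>] unfolding exponents_def by fastforce
      moreover from this \<alpha> have "i \<in> I" unfolding exponents_def by auto
      ultimately have "\<exists>i\<in>I. s i ^ \<alpha> i = 0" by (auto simp: s_def)
      then show "c \<alpha> * (\<Prod>i\<in>I. s i ^ \<alpha> i) = 0"
        using finite_I by (simp add: prod_zero_iff)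
    qed
  qed
  also have "\<dots> = (\<Sum>\<alpha>\<in>exponents K r. c \<alpha> * (\<Prod>i\<in>K. t i ^ \<alpha> i))"
  proof (rule sum.cong[OF refl])
    fix \<alpha> assume "\<alpha> \<in> exponents K r"
    then have "(\<Prod>i\<in>I. s i ^ \<alpha> i) = (\<Prod>i\<in>K. s i ^ \<alpha> i)"
      using K finite_I by (intro prod.mono_neutral_right) (auto simp: exponents_def)
    then show "c \<alpha> * (\<Prod>i\<in>I. s i ^ \<alpha> i) = c \<alpha> * (\<Prod>i\<in>K. t i ^ \<alpha> i)"
      by (simp add: s_def)
  qed
  finally show ?thesis .
qed

lemma I_nonempty: "I \<noteq> {}"
  using card_I by auto

text \<open>Every tuple of positive coordinates with sum 1 belongs to an interior point, so
  vanishing of the difference on the interior is enough to compare coefficients.\<close>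

lemma monomial_sum_unique:
  assumes eq: "\<And>y. y \<in> interior T \<Longrightarrow> monomial_sum r c y = monomial_sum r d y"
    and \<alpha>: "\<alpha> \<in> exponents I r"
  shows "c \<alpha> = d \<alpha>"
proof -
  have "c \<alpha> - d \<alpha> = 0"
  proof (rule homogeneous_zero_on_simplex[OF finite_I I_nonempty _ \<alpha>])
    fix t :: "nat \<Rightarrow> real" assume t: "\<And>i. i \<in> I \<Longrightarrow> 0 < t i" "sum t I = 1"
    have "(\<Sum>i\<in>I. t i *\<^sub>R x i) \<in> interior T"
      by (rule interior_barycentric) (simp add: barycentric_of_combination t)
    from eq[OF this] show "(\<Sum>\<alpha>\<in>exponents I r. (c \<alpha> - d \<alpha>) * (\<Prod>i\<in>I. t i ^ \<alpha> i)) = 0"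
      unfolding monomial_sum_on_face[OF order_refl t(2)]
      by (simp add: left_diff_distrib sum_subtractf)
  qed
  then show ?thesis by simp
qed

lemma monomial_sum_add: "monomial_sum r (\<lambda>\<alpha>. c \<alpha> + d \<alpha>) y = monomial_sum r c y + monomial_sum r d y"
  by (simp add: monomial_sum_def distrib_right sum.distrib)

lemma monomial_sum_scale: "monomial_sum r (\<lambda>\<alpha>. a * c \<alpha>) y = a * monomial_sum r c y"
  by (simp add: monomial_sum_def sum_distrib_left mult.assoc)

text \<open>Homogenization: each Cartesian coordinate is linear homogeneous in the barycentric ones,
  and multiplying by their sum, which is 1, raises a lower degree to \<open>r\<close>.\<close>

lemma polynomial_le_monomial_sum:
  assumes q: "polynomial_le r q"
  shows "\<exists>c. \<forall>y. q y = monomial_sum r c y"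
proof -
  let ?P = "\<lambda>s q. q \<in> monomial_combinations lam I (exponents I s)"
  have step: "?P (Suc s) (\<lambda>y. lam i y * q y)" if "i \<in> I" "?P s q" for i s q
    using finite_I that
    by (intro monomial_combinations_mult[where A = "exponents I s"] finite_exponents)
       (auto simp: exponents_def sum.remove[OF finite_I that(1)] cong: sum.cong_simp)
  \<comment> \<open>Used with two choices of \<open>c\<close>: constant 1 to raise the degree, and
    vertex coordinates to multiply by a Cartesian coordinate.\<close>
  have comb: "?P (Suc s) (\<lambda>y. (\<Sum>i\<in>I. c i * lam i y) * q y)" if "?P s q" for c s q
  proof -
    have "(\<lambda>y. \<Sum>i\<in>I. c i * (lam i y * q y)) \<in> monomial_combinations lam I (exponents I (Suc s))"
      using step[OF _ that] by (rule monomial_combinations_sum)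
    then show ?thesis by (simp add: sum_distrib_right mult.assoc)
  qed
  have one: "?P 0 (\<lambda>y. 1)"
  proof -
    have "(\<lambda>_. 0) \<in> exponents I 0" by (simp add: exponents_def)
    from monomial_in_combinations[OF finite_exponents[OF finite_I] this, of lam I] show ?thesis by simp
  qed
  have raise: "?P (s + d) q" if "?P s q" for s d q
  proof (induction d)
    case (Suc d)
    from comb[OF Suc, of "\<lambda>_. 1"] show ?case by (simp add: sum_barycentric)
  qed (use that in simp)
  have mono: "?P r (\<lambda>y. \<Prod>m\<in>UNIV. y $ m ^ \<beta> m)" if "(\<Sum>m\<in>UNIV. \<beta> m) \<le> r" for \<beta> :: "'n \<Rightarrow> nat"
  proof -
    have "?P (\<Sum>m\<in>UNIV. \<beta> m) (\<lambda>y. \<Prod>m\<in>UNIV. y $ m ^ \<beta> m)"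
    proof (rule prod_powers_induct[where P = ?P])
      show "?P (Suc s) (\<lambda>y. y $ m * q y)" if "?P s q" for s q m
        using comb[OF that, of "\<lambda>i. x i $ m"] by (simp add: component_barycentric)
    qed (use one in auto)
    from raise[OF this, of "r - (\<Sum>m\<in>UNIV. \<beta> m)"] that show ?thesis by simp
  qed
  obtain c where c: "\<forall>y. q y = (\<Sum>\<beta> | (\<Sum>m\<in>UNIV. \<beta> m) \<le> r. c \<beta> * (\<Prod>m\<in>UNIV. y $ m ^ \<beta> m))"
    using q unfolding polynomial_le_def by blast
  have "?P r (\<lambda>y. \<Sum>\<beta> | (\<Sum>m\<in>UNIV. \<beta> m) \<le> r. c \<beta> * (\<Prod>m\<in>UNIV. y $ m ^ \<beta> m))"
    by (rule monomial_combinations_sum) (use mono in auto)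
  then show ?thesis
    using c unfolding monomial_combinations_def monomial_sum_def by auto
qed

text \<open>The coefficients are first chosen separately for each \<open>v\<close>, with no relation
  between them. Uniqueness then transfers every identity satisfied by \<open>p\<close> in the
  vectors to each single coefficient.\<close>

lemma poly_forms_coefficients:
  assumes p: "p \<in> poly_forms r k T"
  obtains C where "\<And>\<alpha>. \<alpha> \<in> exponents I r \<Longrightarrow> alternating k (C \<alpha>)"
    "\<And>y v. y \<in> T \<Longrightarrow> p y v = monomial_sum r (\<lambda>\<alpha>. C \<alpha> v) y"
proof -
  have "\<exists>c. \<forall>y\<in>T. p y v = monomial_sum r c y" for v
  proof -
    obtain q where "polynomial_le r q" "\<forall>y\<in>T. p y v = q y"
      using p unfolding poly_forms_def by blast
    then show ?thesis using polynomial_le_monomial_sum[of r q] by auto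
  qed
  then have "\<forall>v. \<exists>c. \<forall>y\<in>T. p y v = monomial_sum r c y" by blast
  from choice[OF this] obtain D where D: "\<And>v y. y \<in> T \<Longrightarrow> p y v = monomial_sum r (D v) y" by blast
  have alt: "alternating k (p y)" if "y \<in> T" for y
    using p that unfolding poly_forms_def by blast
  have uniq: "D v \<alpha> = d \<alpha>"
    if "\<And>y. y \<in> T \<Longrightarrow> p y v = monomial_sum r d y" "\<alpha> \<in> exponents I r" for v d \<alpha>
  proof (rule monomial_sum_unique[OF _ that(2)])
    fix y assume "y \<in> interior T"
    then have "y \<in> T" using interior_subset by blast
    then show "monomial_sum r (D v) y = monomial_sum r d y" using D that(1) by metis
  qed
  have "alternating k (\<lambda>v. D v \<alpha>)" if \<alpha>: "\<alpha> \<in> exponents I r" for \<alpha>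
  proof (rule alternatingI)
    fix v v' :: "nat \<Rightarrow> real ^ 'n" assume "\<And>i. i \<in> {1..k} \<Longrightarrow> v i = v' i"
    then have "p y v = p y v'" if "y \<in> T" for y
      using alternatingD_cong[OF alt[OF that], of v v'] by simp
    then show "D v \<alpha> = D v' \<alpha>" using D by (intro uniq \<alpha>) simp
  next
    fix v :: "nat \<Rightarrow> real ^ 'n" and i assume i: "i \<in> {1..k}"
    note lin = alternatingD_linear[OF alt i]
    show "linear (\<lambda>z. D (v(i := z)) \<alpha>)"
    proof (rule linearI)
      show "D (v(i := a + b)) \<alpha> = D (v(i := a)) \<alpha> + D (v(i := b)) \<alpha>" for a b
        using uniq[OF _ \<alpha>, of _ "\<lambda>\<alpha>. D (v(i := a)) \<alpha> + D (v(i := b)) \<alpha>"]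
        by (simp add: monomial_sum_add linear_add[OF lin] flip: D)
      show "D (v(i := a *\<^sub>R b)) \<alpha> = a *\<^sub>R D (v(i := b)) \<alpha>" for a b
        using uniq[OF _ \<alpha>, of _ "\<lambda>\<alpha>. a * D (v(i := b)) \<alpha>"]
        by (simp add: monomial_sum_scale linear_scale[OF lin] flip: D)
    qed
  next
    fix v :: "nat \<Rightarrow> real ^ 'n" and i j
    assume "i \<in> {1..k}" "j \<in> {1..k}" "i \<noteq> j" "v i = v j"
    then have "p y v = 0" if "y \<in> T" for y
      using alternatingD_repeat[OF alt[OF that]] by blast
    then show "D v \<alpha> = 0"
      by (intro uniq[OF _ \<alpha>, of _ "\<lambda>_. 0"]) (simp add: monomial_sum_def)
  qed
  then show thesis using that[of "\<lambda>\<alpha> v. D v \<alpha>"] D by blast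
qed

lemma sum_index_form_pairs:
  assumes r: "r \<ge> 1"
  shows "(\<Sum>z\<in>pairs I r k. c z * index_form x N k T (pair_index x k z) y v) =
    monomial_sum r (\<lambda>\<alpha>. \<Sum>\<sigma>\<in>increasing_maps k (I - {base \<alpha>}). c (\<alpha>, \<sigma>) *
      psi_wedge x N k (restrict \<alpha> (pair_vertices k \<alpha> \<sigma>)) \<sigma> (convex hull (x ` pair_vertices k \<alpha> \<sigma>)) T y v) y"
proof -
  have "(\<Sum>z\<in>pairs I r k. c z * index_form x N k T (pair_index x k z) y v) =
     (\<Sum>\<alpha>\<in>exponents I r. \<Sum>\<sigma>\<in>increasing_maps k (I - {base \<alpha>}).
        c (\<alpha>, \<sigma>) * index_form x N k T (pair_index x k (\<alpha>, \<sigma>)) y v)"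
    unfolding pairs_def using finite_I
    by (subst sum.Sigma) (auto simp: finite_exponents finite_increasing_maps intro!: sum.cong)
  also have "\<dots> = (\<Sum>\<alpha>\<in>exponents I r. \<Sum>\<sigma>\<in>increasing_maps k (I - {base \<alpha>}).
        c (\<alpha>, \<sigma>) * ((\<Prod>i\<in>I. lam i y ^ \<alpha> i) *
      psi_wedge x N k (restrict \<alpha> (pair_vertices k \<alpha> \<sigma>)) \<sigma> (convex hull (x ` pair_vertices k \<alpha> \<sigma>)) T y v))"
    by (intro sum.cong refl arg_cong2[where f = "(*)"] index_form_pair[OF _ r])
  finally show ?thesis
    by (simp add: monomial_sum_def sum_distrib_left sum_distrib_right ac_simps)
qed

text \<open>The coefficients are explicit values of \<open>C\<close> on dual vectors; this is what
  makes them comparable across simplices.\<close>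

lemma index_forms_span:
  assumes r: "r \<ge> 1" and y: "y \<in> T"
    and alt: "\<And>\<alpha>. \<alpha> \<in> exponents I r \<Longrightarrow> alternating k (C \<alpha>)"
    and C: "\<And>y v. y \<in> T \<Longrightarrow> p y v = monomial_sum r (\<lambda>\<alpha>. C \<alpha> v) y"
  shows "p y v = (\<Sum>z\<in>pairs I r k. C (fst z) (dual_vector x r (fst z) \<circ> snd z) *
    index_form x N k T (pair_index x k z) y v)"
  unfolding C[OF y] sum_index_form_pairs[OF r] monomial_sum_def fst_conv snd_conv
  by (intro sum.cong refl arg_cong2[where f = "(*)"] alternating_expansion alt r)

lemma psi_wedge_const:
  assumes "F \<subseteq> I" "\<sigma> \<in> {1..k} \<rightarrow> F"
  shows "psi_wedge x N k \<beta> \<sigma> (convex hull (x ` F)) T y = psi_wedge x N k \<beta> \<sigma> (convex hull (x ` F)) T z"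
proof -
  have "psi x N \<beta> (convex hull (x ` F)) T i y = psi x N \<beta> (convex hull (x ` F)) T i z" if "i \<in> F" for i
  proof -
    have "d_barycentric x N T j y = d_barycentric x N T j z" if "j \<in> F" for j
      using d_barycentric_eq[of j] that assms(1) by auto
    then show ?thesis
      using assms(1) that by (simp add: psi_def[abs_def] vertex_indices_hull cong: sum.cong_simp)
  qed
  then show ?thesis
    using assms(2) unfolding psi_wedge_def wedge_def fun_eq_iff
    by (intro allI sum.cong refl arg_cong2[where f = "(*)"] prod.cong) (auto simp: Pi_iff)
qed

lemma index_forms_independent:
  assumes r: "r \<ge> 1"
    and zero: "\<And>y v. y \<in> interior T \<Longrightarrow>
      (\<Sum>z\<in>pairs I r k. c z * index_form x N k T (pair_index x k z) y v) = 0"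
    and z: "(\<alpha>, \<tau>) \<in> pairs I r k"
  shows "c (\<alpha>, \<tau>) = 0"
proof -
  have \<alpha>: "\<alpha> \<in> exponents I r" and \<tau>: "\<tau> \<in> increasing_maps k (I - {base \<alpha>})"
    using z by (auto simp: pairs_def)
  let ?W = "\<lambda>\<alpha> \<sigma>. psi_wedge x N k (restrict \<alpha> (pair_vertices k \<alpha> \<sigma>)) \<sigma>
      (convex hull (x ` pair_vertices k \<alpha> \<sigma>)) T"
  let ?c = "\<lambda>y v \<alpha>. \<Sum>\<sigma>\<in>increasing_maps k (I - {base \<alpha>}). c (\<alpha>, \<sigma>) * ?W \<alpha> \<sigma> y v"
  define v where "v = dual_vector x r \<alpha> \<circ> \<tau>"
  \<comment> \<open>The wedge does not depend on the point. Freezing it at 0 gives coefficients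
    independent of \<open>y\<close>, as uniqueness requires.\<close>
  have "monomial_sum r (?c 0 v) y = monomial_sum r (\<lambda>_. 0) y" if "y \<in> interior T" for y
  proof -
    have W: "?W \<beta> \<sigma> 0 v = ?W \<beta> \<sigma> y v"
      if "\<beta> \<in> exponents I r" "\<sigma> \<in> increasing_maps k (I - {base \<beta>})" for \<beta> \<sigma>
      by (rule fun_cong[OF psi_wedge_const[OF pair_vertices_subset[OF that(1) r that(2)]]])
         (auto simp: pair_vertices_def)
    have "monomial_sum r (?c 0 v) y = monomial_sum r (?c y v) y"
      unfolding monomial_sum_def by (intro sum.cong refl arg_cong2[where f = "(*)"] W)
    also have "\<dots> = 0" using zero[OF that, of v] unfolding sum_index_form_pairs[OF r] .
    finally show ?thesis by (simp add: monomial_sum_def)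
  qed
  from monomial_sum_unique[OF this \<alpha>] have "?c 0 v \<alpha> = 0" .
  moreover have "?c 0 v \<alpha> = (\<Sum>\<sigma>\<in>increasing_maps k (I - {base \<alpha>}).
      c (\<alpha>, \<sigma>) * (if \<tau> = \<sigma> then 1 else 0))"
    unfolding v_def
    by (intro sum.cong refl arg_cong2[where f = "(*)"] psi_wedge_dual_vectors \<alpha> r \<tau>)
  moreover have "\<dots> = c (\<alpha>, \<tau>)"
    using \<tau> finite_increasing_maps[of "I - {base \<alpha>}" k] finite_I
    by (simp add: if_distrib[of "\<lambda>s. _ * s"] cong: if_cong)
  ultimately show ?thesis by simp
qed

end

section \<open>Indices on one simplex\<close>

text \<open>The global index sets, taken for the one-element family \<open>{T}\<close>, serve as the
  local ones.\<close>

lemma all_faces_singleton: "all_faces {T} = faces T"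
  by (simp add: all_faces_def)

context vertex_simplex
begin

lemma pair_index_in_basis_index_set:
  assumes r: "r \<ge> 1" and z: "(\<alpha>, \<sigma>) \<in> pairs I r k"
  shows "pair_index x k (\<alpha>, \<sigma>) \<in> basis_index_set {T} x N r k"
proof -
  have \<alpha>: "\<alpha> \<in> exponents I r" and \<sigma>: "\<sigma> \<in> increasing_maps k (I - {base \<alpha>})"
    using z by (auto simp: pairs_def)
  define F where "F = pair_vertices k \<alpha> \<sigma>"
  note supp = exponents_support[OF finite_I \<alpha> r]
  have F: "F \<subseteq> I" "sum \<alpha> F = r" "finite F"
    using pair_vertices_subset[OF \<alpha> r \<sigma>] sum_pair_vertices[OF \<alpha> r \<sigma>] finite_subset[OF _ finite_I]
    by (auto simp: F_def)
  have base: "base \<alpha> \<in> F - \<sigma> ` {1..k}"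
    using supp(3) increasing_maps_mem[OF \<sigma>] by (fastforce simp: F_def pair_vertices_def)
  then have "F \<noteq> {}" by blast
  note face = hull_in_faces[OF F(1) this]
  note vi = vertex_indices_hull[OF F(1)]
  have \<sigma>F: "\<sigma> ` {1..k} \<subseteq> F" by (simp add: F_def pair_vertices_def)
  \<comment> \<open>Besides the \<open>k\<close> values of \<open>\<sigma>\<close>, the face has the
    vertex \<open>base \<alpha>\<close>, which \<open>\<sigma>\<close> avoids.\<close>
  have "k + 1 \<le> card F"
  proof -
    have "card (insert (base \<alpha>) (\<sigma> ` {1..k})) = k + 1"
      using base card_image[OF increasing_maps_inj[OF \<sigma>]] by simp
    moreover have "insert (base \<alpha>) (\<sigma> ` {1..k}) \<subseteq> F" using base \<sigma>F by blast
    ultimately show ?thesis using card_mono[OF F(3)] by metis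
  qed
  then have dim: "int k \<le> aff_dim (convex hull (x ` F))"
    using aff_dim_face[OF face] by (simp add: vi)
  \<comment> \<open>Since \<open>base \<alpha>\<close> lies in the set, the minimum is at most
    \<open>base \<alpha>\<close>, and below that index \<open>\<alpha>\<close> vanishes.\<close>
  have Min: "\<alpha> i = 0" if "i < Min (F - \<sigma> ` {1..k})" for i
  proof -
    have "i < base \<alpha>" using that base F(3) by (meson Min_le finite_Diff less_le_trans)
    then show ?thesis using supp(4)[of i] by force
  qed
  have \<sigma>': "\<sigma> \<in> {1..k} \<rightarrow>\<^sub>E F" "strict_mono_on {1..k} \<sigma>"
    using \<sigma> \<sigma>F unfolding increasing_maps_def by (auto simp: PiE_iff)
  have cover: "{i \<in> F. 0 < restrict \<alpha> F i} \<union> \<sigma> ` {1..k} = F"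
    by (auto simp: F_def pair_vertices_def)
  have "(convex hull (x ` F), restrict \<alpha> F, \<sigma>) \<in> basis_index_set {T} x N r k"
    using face dim \<sigma>' cover F(2) Min
    by (simp add: basis_index_set_def index_set_def all_faces_singleton vi)
  then show ?thesis by (simp add: pair_index_def F_def)
qed

text \<open>The least vertex missed by \<open>\<sigma>\<close> is \<open>base \<beta>\<close>: the
  covering condition makes its exponent positive, and the basis condition makes all smaller
  exponents vanish.\<close>

lemma basis_index_set_in_pair_index:
  assumes r: "r \<ge> 1" and b: "(f, \<alpha>, \<sigma>) \<in> basis_index_set {T} x N r k"
  defines "\<beta> \<equiv> \<lambda>i. if i \<in> vertex_indices x N f then \<alpha> i else 0"
  shows "(\<beta>, \<sigma>) \<in> pairs I r k" "pair_index x k (\<beta>, \<sigma>) = (f, \<alpha>, \<sigma>)"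
proof -
  define K where "K = vertex_indices x N f"
  have f: "f \<in> faces T" and dim: "int k \<le> aff_dim f" and \<alpha>: "\<alpha> \<in> K \<rightarrow>\<^sub>E UNIV" "sum \<alpha> K = r"
    and \<sigma>: "\<sigma> \<in> {1..k} \<rightarrow>\<^sub>E K" "strict_mono_on {1..k} \<sigma>"
    and cover: "{i \<in> K. 0 < \<alpha> i} \<union> \<sigma> ` {1..k} = K"
    and Min: "\<And>i. i \<in> K \<Longrightarrow> i < Min (K - \<sigma> ` {1..k}) \<Longrightarrow> \<alpha> i = 0"
    using b by (auto simp: basis_index_set_def index_set_def all_faces_singleton K_def
        simp del: atLeastAtMost_iff)
  have K: "K \<subseteq> I" "f = convex hull (x ` K)"
    using faces_hull[OF f] by (simp_all add: K_def)
  have finK: "finite K" using K(1) finite_I finite_subset by blast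
  have supp: "{i. 0 < \<beta> i} = {i \<in> K. 0 < \<alpha> i}" by (auto simp: \<beta>_def K_def)
  have verts: "pair_vertices k \<beta> \<sigma> = K" unfolding pair_vertices_def supp by (rule cover)
  have "restrict \<beta> K = \<alpha>"
    using \<alpha>(1) by (auto simp: \<beta>_def K_def PiE_def extensional_def)
  then show "pair_index x k (\<beta>, \<sigma>) = (f, \<alpha>, \<sigma>)"
    by (simp add: pair_index_def verts K(2)[symmetric])
  have "sum \<beta> I = sum \<beta> K"
    using K(1) finite_I by (intro sum.mono_neutral_right) (auto simp: \<beta>_def K_def)
  also have "\<dots> = r" using \<alpha>(2) by (simp add: \<beta>_def K_def)
  finally have \<beta>: "\<beta> \<in> exponents I r"
    using K(1) by (auto simp: exponents_def \<beta>_def K_def)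
  note suppb = exponents_support[OF finite_I \<beta> r]
  let ?m = "Min (K - \<sigma> ` {1..k})"
  have inj: "inj_on \<sigma> {1..k}" using \<sigma>(2) strict_mono_on_imp_inj_on by blast
  \<comment> \<open>A face of dimension at least \<open>k\<close> has more than \<open>k\<close>
    vertices, so the minimum is taken over a nonempty set.\<close>
  have "card (\<sigma> ` {1..k}) < card K"
    using dim aff_dim_face[OF f] card_image[OF inj] by (simp add: K_def)
  then have "\<not> K \<subseteq> \<sigma> ` {1..k}" using card_mono[of "\<sigma> ` {1..k}" K] by force
  then have m: "?m \<in> K - \<sigma> ` {1..k}" using finK by (intro Min_in) auto
  then have "0 < \<alpha> ?m" using cover by blast
  then have "base \<beta> \<le> ?m" using m by (intro suppb(4)) (simp add: \<beta>_def K_def)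
  moreover have "base \<beta> \<in> K" "0 < \<alpha> (base \<beta>)" using suppb(3) by (auto simp: \<beta>_def K_def split: if_splits)
  ultimately have "base \<beta> = ?m" using Min[of "base \<beta>"] by force
  then have "base \<beta> \<notin> \<sigma> ` {1..k}" using m by simp
  then have "\<sigma> i \<in> I - {base \<beta>}" if "i \<in> {1..k}" for i
    using PiE_mem[OF \<sigma>(1) that] K(1) imageI[OF that, of \<sigma>] by (metis DiffI singletonD subsetD)
  then have "\<sigma> \<in> increasing_maps k (I - {base \<beta>})"
    using \<sigma> unfolding increasing_maps_def PiE_iff by blast
  then show "(\<beta>, \<sigma>) \<in> pairs I r k" using \<beta> by (simp add: pairs_def)
qed

text \<open>The support lies in the face, so restricting \<open>\<alpha>\<close> to it loses
  nothing; this yields injectivity of \<open>pair_index\<close>.\<close>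

lemma pair_index_exponent:
  assumes "r \<ge> 1" "(\<alpha>, \<sigma>) \<in> pairs I r k"
  shows "(\<lambda>i. if i \<in> vertex_indices x N (fst (pair_index x k (\<alpha>, \<sigma>)))
      then fst (snd (pair_index x k (\<alpha>, \<sigma>))) i else 0) = \<alpha>"
  using assms pair_vertices_subset[of \<alpha> r \<sigma> k]
  by (auto simp: pairs_def pair_index_def vertex_indices_hull pair_vertices_def)

lemma bij_pair_index:
  assumes r: "r \<ge> 1"
  shows "bij_betw (pair_index x k) (pairs I r k) (basis_index_set {T} x N r k)"
  unfolding bij_betw_def
proof (intro conjI set_eqI iffI)
  show "inj_on (pair_index x k) (pairs I r k)"
  proof (rule inj_onI)
    fix z z' assume z: "z \<in> pairs I r k" "z' \<in> pairs I r k" "pair_index x k z = pair_index x k z'"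
    have "snd z = snd z'" using z(3) by (simp add: pair_index_def split_beta)
    moreover have "fst z = fst z'"
      using pair_index_exponent[OF r, of "fst z" "snd z" k] pair_index_exponent[OF r, of "fst z'" "snd z'" k] z
      unfolding prod.collapse by metis
    ultimately show "z = z'" by (rule prod_eqI[rotated])
  qed
next
  show "b \<in> basis_index_set {T} x N r k" if "b \<in> pair_index x k ` pairs I r k" for b
    using that pair_index_in_basis_index_set[OF r] by auto
next
  show "b \<in> pair_index x k ` pairs I r k" if "b \<in> basis_index_set {T} x N r k" for b
  proof -
    obtain f \<alpha> \<sigma> where b: "b = (f, \<alpha>, \<sigma>)" by (cases b)
    note B = basis_index_set_in_pair_index[OF r that[unfolded b]]
    from imageI[OF B(1), of "pair_index x k"] show ?thesis unfolding B(2) b .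
  qed
qed

text \<open>Both points of the difference lie in the face: the subtracted one is a vertex, or a
  convex combination of vertices in the support.\<close>

lemma dual_vector_tangent:
  assumes K: "K \<subseteq> I" and \<alpha>: "\<alpha> \<in> exponents K r" and r: "r \<ge> 1" and m: "m \<in> K"
  shows "dual_vector x r \<alpha> m \<in> tangent_space (convex hull (x ` K))"
proof -
  have finK: "finite K" using K finite_I finite_subset by blast
  note supp = exponents_support[OF finK \<alpha> r]
  have vert: "x i \<in> convex hull (x ` K)" if "i \<in> K" for i using that by (simp add: hull_inc)
  have "(\<Sum>i | 0 < \<alpha> i. real (\<alpha> i) / real r) = (\<Sum>i\<in>K. real (\<alpha> i) / real r)"
    using supp(1) finK by (intro sum.mono_neutral_left) auto
  also have "\<dots> = 1"
    using \<alpha> r by (simp add: exponents_def flip: sum_divide_distrib of_nat_sum)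
  finally have "(\<Sum>i | 0 < \<alpha> i. (real (\<alpha> i) / real r) *\<^sub>R x i) \<in> convex hull (x ` K)"
    using supp(1,5) vert by (intro convex_sum) auto
  then have "\<exists>a b. dual_vector x r \<alpha> m = a - b \<and> a \<in> convex hull (x ` K) \<and> b \<in> convex hull (x ` K)"
    unfolding dual_vector_def using vert[OF m] vert[OF supp(2)] by auto
  then show ?thesis
    unfolding tangent_space_def by (intro span_base) blast
qed

lemma index_form_in_poly_forms:
  assumes "(f, \<alpha>, \<sigma>) \<in> index_set {T} x N r k"
  shows "index_form x N k T (f, \<alpha>, \<sigma>) \<in> poly_forms r k T"
proof -
  define K where "K = vertex_indices x N f"
  have f: "f \<in> faces T" and sum: "sum \<alpha> K = r" and \<sigma>: "\<sigma> \<in> {1..k} \<rightarrow> K"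
    using assms by (auto simp: index_set_def all_faces_singleton K_def PiE_def
        simp del: atLeastAtMost_iff)
  have K: "K \<subseteq> I" "f = convex hull (x ` K)"
    using faces_hull[OF f] by (simp_all add: K_def)
  have finK: "finite K" using K(1) finite_I finite_subset by blast
  have eq: "index_form x N k T (f, \<alpha>, \<sigma>) y v =
      psi_wedge x N k \<alpha> \<sigma> f T 0 v * (\<Prod>i\<in>K. lam i y ^ \<alpha> i)" for y v
    using psi_wedge_const[OF K(1) \<sigma>, of \<alpha> y 0]
    by (simp add: index_form_def local_form_def K(2)[symmetric] K_def[symmetric] mult.commute)
  have "alternating k (psi_wedge x N k \<alpha> \<sigma> f T 0)"
    unfolding psi_wedge_def K(2) by (intro alternating_wedge linear_psi[OF K(1)]) (use \<sigma> in auto)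
  then have "alternating k (index_form x N k T (f, \<alpha>, \<sigma>) y)" for y
    using alternating_scale[of k "psi_wedge x N k \<alpha> \<sigma> f T 0" "\<Prod>i\<in>K. lam i y ^ \<alpha> i"]
    by (simp only: eq[abs_def] mult.commute)
  moreover have "polynomial_le (sum \<alpha> K) (\<lambda>y. \<Prod>i\<in>K. lam i y ^ \<alpha> i)"
  proof (rule prod_powers_induct[where P = polynomial_le])
    show "polynomial_le (Suc s) (\<lambda>y. lam i y * q y)" if "i \<in> K" "polynomial_le s q" for s q i
    proof -
      obtain a b where "\<And>y. lam i y = a \<bullet> y + b"
        using barycentric_affineE[of i] K(1) \<open>i \<in> K\<close> by blast
      then show ?thesis using polynomial_le_affine_mult[OF that(2), of a b] by simp
    qed
  qed (use finK polynomial_le_const in auto)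
  then have "polynomial_le r (\<lambda>y. index_form x N k T (f, \<alpha>, \<sigma>) y v)" for v
    unfolding sum eq by (rule polynomial_le_scale)
  ultimately show ?thesis unfolding poly_forms_def by blast
qed

text \<open>Take a vertex \<open>i\<close> of \<open>f\<close> outside \<open>g\<close>. If
  \<open>\<alpha> i\<close> is positive, the factor \<open>lam i\<close> vanishes on
  \<open>g\<close>. Otherwise \<open>i\<close> is in the range of \<open>\<sigma>\<close>, and its
  psi reduces to the differential of \<open>lam i\<close>, which vanishes on vectors tangent to
  \<open>g\<close>.\<close>

lemma index_form_vanishes:
  assumes b: "(f, \<alpha>, \<sigma>) \<in> index_set {T} x N r k" and g: "g \<in> faces T" "\<not> f \<subseteq> g"
    and y: "y \<in> g" and v: "\<And>i. i \<in> {1..k} \<Longrightarrow> v i \<in> tangent_space g"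
  shows "index_form x N k T (f, \<alpha>, \<sigma>) y v = 0"
proof -
  define K where "K = vertex_indices x N f"
  have f: "f \<in> faces T" and \<sigma>: "\<sigma> \<in> {1..k} \<rightarrow> K"
    and cover: "{i \<in> K. 0 < \<alpha> i} \<union> \<sigma> ` {1..k} = K"
    using b by (auto simp: index_set_def all_faces_singleton K_def PiE_def
        simp del: atLeastAtMost_iff)
  have K: "K \<subseteq> I" "f = convex hull (x ` K)"
    using faces_hull[OF f] by (simp_all add: K_def)
  have finK: "finite K" using K(1) finite_I finite_subset by blast
  obtain i where i: "i \<in> K" "i \<notin> vertex_indices x N g"
    using face_subset_iff[OF f g(1)] g(2) by (auto simp: K_def)
  then have iI: "i \<in> I" using K(1) by blast
  show ?thesis
  proof (cases "0 < \<alpha> i")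
    case True
    then have "\<exists>i\<in>K. lam i y ^ \<alpha> i = 0"
      using barycentric_zero_on_face[OF g(1) iI i(2) y] i(1) by auto
    then show ?thesis
      using finK by (simp add: index_form_def local_form_def K_def[symmetric] prod_zero_iff)
  next
    case False
    have "i \<in> {i \<in> K. 0 < \<alpha> i} \<union> \<sigma> ` {1..k}" unfolding cover by (rule i(1))
    then obtain m where m: "m \<in> {1..k}" "\<sigma> m = i" using False by blast
    have zero: "psi x N \<alpha> f T (\<sigma> m) y u = 0" if "u \<in> tangent_space g" for u
      using barycentric_zero_on_tangent[OF g(1) iI i(2) that] False
      by (simp add: psi_def m(2) d_barycentric_eq[OF iI])
    have "wedge k (\<lambda>m. psi x N \<alpha> f T (\<sigma> m) y) v = 0"
      unfolding wedge_def
    proof (rule sum.neutral, clarify)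
      fix p assume "p permutes {1..k}"
      then have "p m \<in> {1..k}" using permutes_in_image[of p "{1..k}" m] m(1) by simp
      from zero[OF v[OF this]] have "psi x N \<alpha> f T (\<sigma> m) y (v (p m)) = 0" .
      then have "(\<Prod>i\<in>{1..k}. psi x N \<alpha> f T (\<sigma> i) y (v (p i))) = 0"
        using m(1) by (intro prod_zero) auto
      then show "real_of_int (sign p) * (\<Prod>i\<in>{1..k}. psi x N \<alpha> f T (\<sigma> i) y (v (p i))) = 0"
        by simp
    qed
    then show ?thesis by (simp add: index_form_def local_form_def psi_wedge_def)
  qed
qed

end

text \<open>Only coordinates of vertices of \<open>f\<close>, all of them in \<open>g\<close>,
  occur, and their values on \<open>g\<close> and differentials along \<open>g\<close> do not depend
  on the simplex.\<close>

lemma index_form_eq_on_face: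
  assumes S: "vertex_simplex x N T" and S': "vertex_simplex x N T'"
    and b: "(f, \<alpha>, \<sigma>) \<in> index_set {T} x N r k"
    and g: "g \<in> faces T" "g \<in> faces T'" "f \<subseteq> g"
    and y: "y \<in> g" and v: "\<And>i. i \<in> {1..k} \<Longrightarrow> v i \<in> tangent_space g"
  shows "index_form x N k T (f, \<alpha>, \<sigma>) y v = index_form x N k T' (f, \<alpha>, \<sigma>) y v"
proof -
  interpret S: vertex_simplex x N T by fact
  interpret S': vertex_simplex x N T' by fact
  define K where "K = vertex_indices x N f"
  have f: "f \<in> faces T" and \<sigma>: "\<sigma> \<in> {1..k} \<rightarrow> K"
    using b by (auto simp: index_set_def all_faces_singleton K_def PiE_def
        simp del: atLeastAtMost_iff)
  have Kg: "K \<subseteq> vertex_indices x N g"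
    using S.face_subset_iff[OF f g(1)] g(3) by (simp add: K_def)
  note eq = barycentric_eq_on_face[OF S S' g(1,2)]
  have lam: "S.lam i y = S'.lam i y" if "i \<in> K" for i
    using eq(1)[OF _ y] that Kg by blast
  have d: "d_barycentric x N T i y u = d_barycentric x N T' i y u"
    if "i \<in> K" "u \<in> tangent_space g" for i u
  proof -
    have i: "i \<in> vertex_indices x N g" using that Kg by blast
    then have "i \<in> S.I" "i \<in> S'.I" using S.faces_hull(1)[OF g(1)] S'.faces_hull(1)[OF g(2)] by auto
    then show ?thesis
      using eq(2)[OF i that(2)] by (simp only: S.d_barycentric_eq S'.d_barycentric_eq)
  qed
  have psi: "psi x N \<alpha> f T i y u = psi x N \<alpha> f T' i y u" if "i \<in> K" "u \<in> tangent_space g" for i u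
    unfolding psi_def K_def[symmetric] using d that by (simp cong: sum.cong_simp)
  have "psi x N \<alpha> f T (\<sigma> i) y (v (p i)) = psi x N \<alpha> f T' (\<sigma> i) y (v (p i))"
    if "p permutes {1..k}" "i \<in> {1..k}" for p i
    using psi[of "\<sigma> i" "v (p i)"] \<sigma> v that permutes_in_image[OF that(1)] by blast
  then have "psi_wedge x N k \<alpha> \<sigma> f T y v = psi_wedge x N k \<alpha> \<sigma> f T' y v"
    unfolding psi_wedge_def wedge_def
    by (intro sum.cong refl arg_cong2[where f = "(*)"] prod.cong) auto
  then show ?thesis
    using lam by (simp add: index_form_def local_form_def K_def[symmetric])
qed

section \<open>Gluing forms on a triangulation\<close>

lemma polynomial_le_continuous: "polynomial_le r q \<Longrightarrow> continuous_on UNIV q"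
proof -
  assume "polynomial_le r q"
  then obtain c where "\<forall>y. q y = (\<Sum>\<beta> | (\<Sum>i\<in>UNIV. \<beta> i) \<le> r. c \<beta> * (\<Prod>i\<in>UNIV. (y $ i) ^ \<beta> i))"
    unfolding polynomial_le_def by blast
  then have "q = (\<lambda>y. \<Sum>\<beta> | (\<Sum>i\<in>UNIV. \<beta> i) \<le> r. c \<beta> * (\<Prod>i\<in>UNIV. (y $ i) ^ \<beta> i))"
    by blast
  then show ?thesis by (auto intro!: continuous_intros)
qed

lemma AE_not_negligible: "negligible S \<Longrightarrow> AE y in lebesgue. y \<notin> S"
  by (simp add: AE_not_in negligible_iff_null_sets)

text \<open>A nonempty open set is not null. This leads back from classes of forms to pointwise
  identities of their polynomial pieces.\<close>

lemma AE_zero_imp_zero_on_open: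
  assumes "open U" and cont: "continuous_on U (q :: real ^ 'n \<Rightarrow> real)"
    and AE: "AE y in lebesgue. y \<in> U \<longrightarrow> q y = 0" and y: "y \<in> U"
  shows "q y = 0"
proof (rule ccontr)
  assume "q y \<noteq> 0"
  let ?W = "U \<inter> q -` (- {0})"
  have "open ?W"
    using continuous_open_preimage[OF cont \<open>open U\<close>, of "- {0}"] by auto
  moreover have "y \<in> ?W" using y \<open>q y \<noteq> 0\<close> by auto
  ultimately have "\<not> negligible ?W" using open_not_negligible by blast
  moreover have "?W \<in> null_sets lebesgue"
  proof -
    have "AE y in lebesgue. y \<notin> ?W" using AE by (auto elim: eventually_mono)
    moreover have "?W \<in> sets lebesgue" using \<open>open ?W\<close> by simp
    ultimately show ?thesis by (simp add: AE_iff_null_sets)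
  qed
  ultimately show False by (simp add: negligible_iff_null_sets)
qed

lemma poly_forms_add:
  assumes "p \<in> poly_forms r k T" "q \<in> poly_forms r k T"
  shows "(\<lambda>y v. p y v + q y v) \<in> poly_forms r k T"
proof -
  have "\<exists>h. polynomial_le r h \<and> (\<forall>y\<in>T. p y v + q y v = h y)" for v
  proof -
    obtain f g where "polynomial_le r f" "\<forall>y\<in>T. p y v = f y" "polynomial_le r g" "\<forall>y\<in>T. q y v = g y"
      using assms unfolding poly_forms_def by blast
    then show ?thesis
      using monomial_combinations_add[of f _ _ _ g] unfolding polynomial_le_iff
      by (intro exI[of _ "\<lambda>y. f y + g y"]) auto
  qed
  then show ?thesis using assms unfolding poly_forms_def by (auto intro: alternating_add)
qed

lemma poly_forms_scale:
  assumes "p \<in> poly_forms r k T"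
  shows "(\<lambda>y v. c * p y v) \<in> poly_forms r k T"
proof -
  have "\<exists>h. polynomial_le r h \<and> (\<forall>y\<in>T. c * p y v = h y)" for v
  proof -
    obtain f where "polynomial_le r f" "\<forall>y\<in>T. p y v = f y"
      using assms unfolding poly_forms_def by blast
    then show ?thesis
      using polynomial_le_scale[of r f c] by (intro exI[of _ "\<lambda>y. c * f y"]) auto
  qed
  then show ?thesis using assms unfolding poly_forms_def by (auto intro: alternating_scale)
qed

lemma poly_forms_zero: "(\<lambda>y v. 0) \<in> poly_forms r k T"
  unfolding poly_forms_def using polynomial_le_const[of r 0] by (auto intro: alternating_zero)

lemma trace_form_eq_iff:
  "trace_form k f p = trace_form k f q \<longleftrightarrow>
    (\<forall>y\<in>f. \<forall>v. (\<forall>i\<in>{1..k}. v i \<in> tangent_space f) \<longrightarrow> p y v = q y v)"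
  unfolding trace_form_def fun_eq_iff by (auto simp del: atLeastAtMost_iff)

lemma sum_scaleR_abs_ae_form:
  "(\<Sum>b\<in>B. c b *\<^sub>R abs_ae_form (g b)) = abs_ae_form (\<lambda>y v. \<Sum>b\<in>B. c b * g b y v)"
  by (induction B rule: infinite_finite_induct)
     (simp_all add: zero_ae_form.abs_eq plus_ae_form.abs_eq scaleR_ae_form.abs_eq)

text \<open>The sum in \<open>piecewise_form\<close>, for an arbitrary family of local forms;
  interiors are used because there the simplex is unique.\<close>

definition glue :: "(real ^ 'n) set set \<Rightarrow> ((real ^ 'n) set \<Rightarrow> 'n::finite diff_form) \<Rightarrow> 'n diff_form" where
  "glue \<T> p = (\<lambda>y v. \<Sum>T\<in>\<T>. if y \<in> interior T then p T y v else 0)"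

text \<open>The conditions of \<open>poly_form_space\<close> that concern the local representatives
  alone; square integrability follows from them.\<close>

definition compatible ::
    "nat \<Rightarrow> nat \<Rightarrow> (real ^ 'n) set set \<Rightarrow> ((real ^ 'n) set \<Rightarrow> 'n::finite diff_form) \<Rightarrow> bool" where
  "compatible r k \<T> p \<longleftrightarrow> (\<forall>T\<in>\<T>. p T \<in> poly_forms r k T) \<and>
     (\<forall>f\<in>all_faces \<T>. int k \<le> aff_dim f \<and> aff_dim f \<le> int CARD('n) - 1 \<longrightarrow>
       (\<forall>T\<in>\<T>. \<forall>T'\<in>\<T>. f \<subseteq> T \<and> f \<subseteq> T' \<longrightarrow> trace_form k f (p T) = trace_form k f (p T')))"

lemma glue_add: "glue \<T> (\<lambda>T y v. p T y v + q T y v) = (\<lambda>y v. glue \<T> p y v + glue \<T> q y v)"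
  unfolding glue_def sum.distrib[symmetric] by (intro ext sum.cong) auto

lemma glue_scale: "glue \<T> (\<lambda>T y v. c * p T y v) = (\<lambda>y v. c * glue \<T> p y v)"
  unfolding glue_def sum_distrib_left by (intro ext sum.cong) auto

lemma compatibleI:
  fixes p :: "(real ^ 'n) set \<Rightarrow> 'n::finite diff_form"
  assumes "\<And>T. T \<in> \<T> \<Longrightarrow> p T \<in> poly_forms r k T"
    and "\<And>f T T' y v. f \<in> all_faces \<T> \<Longrightarrow> int k \<le> aff_dim f \<Longrightarrow> aff_dim f \<le> int CARD('n) - 1 \<Longrightarrow>
      T \<in> \<T> \<Longrightarrow> T' \<in> \<T> \<Longrightarrow> f \<subseteq> T \<Longrightarrow> f \<subseteq> T' \<Longrightarrow> y \<in> f \<Longrightarrow>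
      \<forall>i\<in>{1..k}. v i \<in> tangent_space f \<Longrightarrow> p T y v = p T' y v"
  shows "compatible r k \<T> p"
  unfolding compatible_def trace_form_eq_iff using assms by blast

lemma compatible_poly_forms: "compatible r k \<T> p \<Longrightarrow> T \<in> \<T> \<Longrightarrow> p T \<in> poly_forms r k T"
  unfolding compatible_def by blast

lemma compatible_trace:
  fixes p :: "(real ^ 'n) set \<Rightarrow> 'n::finite diff_form"
  assumes "compatible r k \<T> p" "f \<in> all_faces \<T>" "int k \<le> aff_dim f" "aff_dim f \<le> int CARD('n) - 1"
    "T \<in> \<T>" "T' \<in> \<T>" "f \<subseteq> T" "f \<subseteq> T'" "y \<in> f" "\<forall>i\<in>{1..k}. v i \<in> tangent_space f"
  shows "p T y v = p T' y v"
  using assms unfolding compatible_def trace_form_eq_iff by blast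

lemma compatible_add:
  assumes p: "compatible r k \<T> p" and q: "compatible r k \<T> q"
  shows "compatible r k \<T> (\<lambda>T y v. p T y v + q T y v)"
  by (intro compatibleI poly_forms_add compatible_poly_forms[OF p] compatible_poly_forms[OF q]
      arg_cong2[where f = "(+)"] compatible_trace[OF p] compatible_trace[OF q])

lemma compatible_scale:
  assumes p: "compatible r k \<T> p"
  shows "compatible r k \<T> (\<lambda>T y v. c * p T y v)"
  by (intro compatibleI poly_forms_scale compatible_poly_forms[OF p]
      arg_cong2[where f = "(*)"] refl compatible_trace[OF p])

lemma compatible_zero: "compatible r k \<T> (\<lambda>T y v. 0)"
  by (intro compatibleI poly_forms_zero refl)

section \<open>The glued forms as a model of the space of piecewise polynomial forms\<close>

locale numbered_triangulation =
  fixes \<Omega> :: "(real ^ 'n::finite) set" and \<T> :: "(real ^ 'n) set set"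
    and x :: "nat \<Rightarrow> real ^ 'n" and N :: nat
  assumes domain: "bounded_polyhedral_domain \<Omega>"
    and triangulation_of: "triangulation_of \<T> \<Omega>"
    and numbering: "vertex_numbering x N \<T>"
begin

lemma finite_T: "finite \<T>" and Union_T: "\<Union>\<T> = closure \<Omega>"
  and face_Int: "\<And>T T'. T \<in> \<T> \<Longrightarrow> T' \<in> \<T> \<Longrightarrow> (T \<inter> T') face_of T"
  using triangulation_of unfolding triangulation_of_def triangulation_def by auto

lemma vertex_simplex_T:
  assumes "T \<in> \<T>"
  shows "vertex_simplex x N T"
proof
  show "int CARD('n) simplex T"
    using triangulation_of assms unfolding triangulation_of_def by blast
  show "inj_on x {0..N}" "{v. v extreme_point_of T} \<subseteq> x ` {0..N}"
    using numbering assms unfolding vertex_numbering_def bij_betw_def by auto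
qed

text \<open>A face of another simplex \<open>T'\<close> that lies in \<open>T\<close> is a face of
  the intersection, which is itself a face of \<open>T\<close>. So containment in \<open>T\<close>
  already means being a face of \<open>T\<close>.\<close>

lemma face_in_faces:
  assumes "f \<in> all_faces \<T>" "T \<in> \<T>" "f \<subseteq> T"
  shows "f \<in> faces T"
proof -
  obtain T' where T': "T' \<in> \<T>" "f face_of T'" "f \<noteq> {}"
    using assms(1) by (auto simp: all_faces_def faces_def)
  have "f \<subseteq> T \<inter> T'" using assms(3) face_of_imp_subset[OF T'(2)] by blast
  then have "f face_of (T \<inter> T')" by (rule face_of_subset[OF T'(2)]) blast
  from face_of_trans[OF this face_Int[OF assms(2) T'(1)]] show ?thesis
    using T'(3) by (simp add: faces_def)
qed

text \<open>A face that meets the interior is the whole simplex; this applies to the intersection as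
  a face of either one.\<close>

lemma interior_unique:
  assumes "T \<in> \<T>" "T' \<in> \<T>" "y \<in> interior T" "y \<in> interior T'"
  shows "T = T'"
proof -
  have "y \<in> T \<inter> T'" using assms(3,4) interior_subset by blast
  then have "T \<inter> T' = T" "T' \<inter> T = T'"
    using face_of_disjoint_interior[OF face_Int[OF assms(1,2)]]
      face_of_disjoint_interior[OF face_Int[OF assms(2,1)]] assms(3,4) by blast+
  then show ?thesis by blast
qed

text \<open>The simplices cover the closure while forms live on \<open>\<Omega>\<close>; the
  frontier between them is null because it is a finite union of polytopes of lower dimension. The
  frontier of a simplex is null by convexity.\<close>

lemma AE_cases:
  "AE y in lebesgue. (y \<in> closure \<Omega> \<longrightarrow> y \<in> \<Omega>) \<and> (\<forall>T\<in>\<T>. y \<in> T \<longrightarrow> y \<in> interior T)"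
proof -
  obtain P where P: "finite P" "\<And>F. F \<in> P \<Longrightarrow> polytope F \<and> aff_dim F < int CARD('n)"
    "frontier \<Omega> = \<Union>P" and "open \<Omega>"
    using domain unfolding bounded_polyhedral_domain_def by blast
  have "negligible F" if "F \<in> P" for F
    using P(2)[OF that] low_dim_interior[of F]
    by (simp add: negligible_convex_interior polytope_imp_convex)
  then have "negligible (frontier \<Omega>)" using P(1,3) by (simp add: negligible_Union)
  moreover have "negligible (\<Union>T\<in>\<T>. frontier T)"
    using finite_T vertex_simplex.convex_T[OF vertex_simplex_T]
    by (intro negligible_Union) (auto intro: negligible_convex_frontier)
  ultimately have "AE y in lebesgue. y \<notin> frontier \<Omega> \<union> (\<Union>T\<in>\<T>. frontier T)"
    by (intro AE_not_negligible negligible_Un)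
  then show ?thesis
  proof (rule eventually_mono)
    fix y assume y: "y \<notin> frontier \<Omega> \<union> (\<Union>T\<in>\<T>. frontier T)"
    have "y \<in> \<Omega>" if "y \<in> closure \<Omega>"
      using that y \<open>open \<Omega>\<close> by (simp add: frontier_def interior_open)
    moreover have "y \<in> interior T" if "T \<in> \<T>" "y \<in> T" for T
      using that y closure_subset[of T] by (auto simp: frontier_def)
    ultimately show "(y \<in> closure \<Omega> \<longrightarrow> y \<in> \<Omega>) \<and> (\<forall>T\<in>\<T>. y \<in> T \<longrightarrow> y \<in> interior T)" by blast
  qed
qed

lemma glue_interior:
  assumes "T \<in> \<T>" "y \<in> interior T"
  shows "glue \<T> p y = p T y"
proof
  fix v
  have "glue \<T> p y v = (\<Sum>T'\<in>{T}. if y \<in> interior T' then p T' y v else 0)"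
    unfolding glue_def
  proof (rule sum.mono_neutral_right[OF finite_T])
    show "\<forall>T'\<in>\<T> - {T}. (if y \<in> interior T' then p T' y v else 0) = 0"
      using interior_unique[OF assms(1) _ assms(2)] by auto
  qed (use assms in simp)
  then show "glue \<T> p y v = p T y v" using assms(2) by simp
qed

lemma glue_outside:
  assumes "\<And>T. T \<in> \<T> \<Longrightarrow> y \<notin> interior T"
  shows "glue \<T> p y = (\<lambda>v. 0)"
  unfolding glue_def using assms by (intro ext sum.neutral) auto

lemma AE_glue_eq:
  assumes "\<And>T y v. T \<in> \<T> \<Longrightarrow> y \<in> interior T \<Longrightarrow> p T y v = q y v"
    and "\<And>y v. y \<notin> closure \<Omega> \<Longrightarrow> q y v = 0"
  shows "AE y in lebesgue. glue \<T> p y = q y"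
  using AE_cases
proof (rule eventually_mono)
  fix y assume y: "(y \<in> closure \<Omega> \<longrightarrow> y \<in> \<Omega>) \<and> (\<forall>T\<in>\<T>. y \<in> T \<longrightarrow> y \<in> interior T)"
  show "glue \<T> p y = q y"
  proof (cases "y \<in> closure \<Omega>")
    case True
    then obtain T where "T \<in> \<T>" "y \<in> T" using Union_T by blast
    then show ?thesis using glue_interior[of T y p] assms(1)[of T y] y by (simp add: fun_eq_iff)
  next
    case False
    then have "y \<notin> interior T" if "T \<in> \<T>" for T
      using that Union_T interior_subset[of T] by blast
    then show ?thesis using assms(2)[OF False] glue_outside by (simp add: fun_eq_iff)
  qed
qed

lemma glue_L2:
  assumes p: "\<And>T. T \<in> \<T> \<Longrightarrow> p T \<in> poly_forms r k T"
  shows "abs_ae_form (glue \<T> p) \<in> L2_forms k \<Omega>"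
proof -
  \<comment> \<open>Membership in \<open>L2_forms\<close> asks for a representative vanishing
    everywhere off \<open>\<Omega>\<close>. The glued form may be nonzero on slits that cross the
    interior of a simplex, so it is cut off there.\<close>
  define w where "w y v = (if y \<in> \<Omega> then glue \<T> p y v else 0)" for y v
  have "AE y in lebesgue. glue \<T> p y = w y"
    using AE_cases
  proof (rule eventually_mono)
    fix y assume y: "(y \<in> closure \<Omega> \<longrightarrow> y \<in> \<Omega>) \<and> (\<forall>T\<in>\<T>. y \<in> T \<longrightarrow> y \<in> interior T)"
    have "y \<notin> interior T" if "y \<notin> \<Omega>" "T \<in> \<T>" for T
      using that y Union_T interior_subset[of T] by blast
    then show "glue \<T> p y = w y" using glue_outside[of y p] by (auto simp: w_def fun_eq_iff)
  qed
  then have "abs_ae_form (glue \<T> p) = abs_ae_form w" by (simp add: ae_form.abs_eq_iff)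
  moreover have "alternating k (w y)" for y
  proof (cases "y \<in> \<Omega> \<and> (\<exists>T\<in>\<T>. y \<in> interior T)")
    case True
    then obtain T where T: "T \<in> \<T>" "y \<in> interior T" "y \<in> \<Omega>" by blast
    then have "w y = p T y" using glue_interior[OF T(1,2), of p] by (simp add: w_def fun_eq_iff)
    then show ?thesis
      using p[OF T(1)] T(2) interior_subset[of T] unfolding poly_forms_def by auto
  next
    case False
    then have "w y = (\<lambda>v. 0)" using glue_outside[of y p] by (auto simp: w_def fun_eq_iff)
    then show ?thesis by (simp add: alternating_zero)
  qed
  moreover have "w y v = 0" if "y \<notin> \<Omega>" for y v using that by (simp add: w_def)
  moreover have meas: "(\<lambda>y. w y v) \<in> borel_measurable lebesgue"
    and int: "integrable lebesgue (\<lambda>y. (w y v)\<^sup>2)" for v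
  proof -
    have "\<forall>T\<in>\<T>. \<exists>q. polynomial_le r q \<and> (\<forall>y\<in>T. p T y v = q y)"
      using p unfolding poly_forms_def by blast
    from bchoice[OF this] obtain q where q: "\<And>T. T \<in> \<T> \<Longrightarrow> polynomial_le r (q T)"
      "\<And>T y. T \<in> \<T> \<Longrightarrow> y \<in> T \<Longrightarrow> p T y v = q T y" by blast
    have "glue \<T> p y v = (\<Sum>T\<in>\<T>. indicator (interior T) y * q T y)" for y
      unfolding glue_def using q(2) interior_subset
      by (intro sum.cong) (auto simp: subset_iff indicator_def)
    then have w: "w y v = indicator \<Omega> y * (\<Sum>T\<in>\<T>. indicator (interior T) y * q T y)" for y
      by (simp only: w_def indicator_def) simp
    have meas_q: "q T \<in> borel_measurable lebesgue" if "T \<in> \<T>" for T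
      using borel_measurable_continuous_onI[OF polynomial_le_continuous[OF q(1)[OF that]]]
      by (simp add: measurable_completion)
    have "open \<Omega>" "bounded \<Omega>" using domain unfolding bounded_polyhedral_domain_def by auto
    then have meas_Om: "\<Omega> \<in> sets lebesgue" by simp
    show meas: "(\<lambda>y. w y v) \<in> borel_measurable lebesgue"
      unfolding w using meas_q meas_Om
      by (intro borel_measurable_times borel_measurable_sum borel_measurable_indicator) auto
    have "\<exists>B. \<forall>y\<in>T. \<bar>q T y\<bar> \<le> B" if "T \<in> \<T>" for T
    proof -
      have "compact (q T ` T)"
        using polynomial_le_continuous[OF q(1)[OF that]] vertex_simplex.compact_T[OF vertex_simplex_T[OF that]]
        by (intro compact_continuous_image) (auto intro: continuous_on_subset)
      then show ?thesis using compact_imp_bounded bounded_iff by (metis image_eqI real_norm_def)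
    qed
    then obtain B where B: "\<And>T y. T \<in> \<T> \<Longrightarrow> y \<in> T \<Longrightarrow> \<bar>q T y\<bar> \<le> B T" by metis
    have "\<bar>w y v\<bar> \<le> (\<Sum>T\<in>\<T>. \<bar>B T\<bar>)" for y
    proof -
      have "\<bar>indicator (interior T) y * q T y\<bar> \<le> \<bar>B T\<bar>" if "T \<in> \<T>" for T
        using B[OF that, of y] interior_subset[of T] by (auto simp: indicator_def)
      then have "\<bar>\<Sum>T\<in>\<T>. indicator (interior T) y * q T y\<bar> \<le> (\<Sum>T\<in>\<T>. \<bar>B T\<bar>)"
        by (intro order_trans[OF sum_abs] sum_mono)
      moreover have "0 \<le> (\<Sum>T\<in>\<T>. \<bar>B T\<bar>)" by (intro sum_nonneg) auto
      ultimately show ?thesis by (simp add: w indicator_def)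
    qed
    then have "(w y v)\<^sup>2 \<le> (\<Sum>T\<in>\<T>. \<bar>B T\<bar>)\<^sup>2" for y
      using power_mono[of "\<bar>w y v\<bar>" _ 2] by simp
    then have "AE y\<in>\<Omega> in lebesgue. norm ((w y v)\<^sup>2) \<le> (\<Sum>T\<in>\<T>. \<bar>B T\<bar>)\<^sup>2" by simp
    moreover have "emeasure lebesgue \<Omega> < \<infinity>"
      using fmeasurableD2[OF bounded_set_imp_lmeasurable[OF \<open>bounded \<Omega>\<close> meas_Om]]
      by (simp only: infinity_ennreal_def less_top)
    ultimately show "integrable lebesgue (\<lambda>y. (w y v)\<^sup>2)"
      using meas meas_Om
      by (intro integrableI_bounded_set[where A = \<Omega>]) (auto simp: w_def)
  qed
  ultimately show ?thesis unfolding L2_forms_def by blast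
qed

text \<open>The simplices cover \<open>\<Omega>\<close> up to a null set, so a class is determined
  by its polynomial restrictions. From here on, compatible families of local forms replace classes
  and restrictions almost everywhere.\<close>

lemma poly_form_space_eq: "poly_form_space r k \<T> \<Omega> = {abs_ae_form (glue \<T> p) | p. compatible r k \<T> p}"
proof (intro set_eqI iffI)
  fix \<omega> assume "\<omega> \<in> poly_form_space r k \<T> \<Omega>"
  then obtain p where L2: "\<omega> \<in> L2_forms k \<Omega>"
    and p: "\<forall>T\<in>\<T>. p T \<in> poly_forms r k T \<and> restricts_to \<omega> T (p T)"
    and tr: "\<forall>f\<in>all_faces \<T>. int k \<le> aff_dim f \<and> aff_dim f \<le> int CARD('n) - 1 \<longrightarrow>
       (\<forall>T\<in>\<T>. \<forall>T'\<in>\<T>. f \<subseteq> T \<and> f \<subseteq> T' \<longrightarrow> trace_form k f (p T) = trace_form k f (p T'))"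
    unfolding poly_form_space_def mem_Collect_eq by (elim conjE exE) (rule that)
  have comp: "compatible r k \<T> p"
    unfolding compatible_def using p by (intro conjI tr) simp
  have restr: "restricts_to \<omega> T (p T)" if "T \<in> \<T>" for T
    using p that by simp
  obtain w where w: "\<omega> = abs_ae_form w" "\<And>y v. y \<notin> \<Omega> \<Longrightarrow> w y v = 0"
    using L2 unfolding L2_forms_def by blast
  have "AE y in lebesgue. y \<in> T \<longrightarrow> w y = p T y" if "T \<in> \<T>" for T
    using restr[OF that] unfolding w(1) restricts_to.abs_eq .
  then have "AE y in lebesgue. \<forall>T\<in>\<T>. y \<in> T \<longrightarrow> w y = p T y"
    using finite_T by (simp add: AE_ball_countable countable_finite)
  then have "AE y in lebesgue. w y = glue \<T> p y"
    using AE_cases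
  proof (rule eventually_elim2)
    fix y assume y: "\<forall>T\<in>\<T>. y \<in> T \<longrightarrow> w y = p T y"
      "(y \<in> closure \<Omega> \<longrightarrow> y \<in> \<Omega>) \<and> (\<forall>T\<in>\<T>. y \<in> T \<longrightarrow> y \<in> interior T)"
    show "w y = glue \<T> p y"
    proof (cases "\<exists>T\<in>\<T>. y \<in> interior T")
      case True
      then obtain T where T: "T \<in> \<T>" "y \<in> interior T" by blast
      then show ?thesis using y(1) interior_subset[of T] glue_interior[OF T, of p] by auto
    next
      case False
      then have "y \<notin> closure \<Omega>" using y(2) Union_T by blast
      then have "y \<notin> \<Omega>" using closure_subset by blast
      then show ?thesis using w(2) False glue_outside[of y p] by auto
    qed
  qed
  then have "\<omega> = abs_ae_form (glue \<T> p)" by (simp add: w(1) ae_form.abs_eq_iff)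
  then show "\<omega> \<in> {abs_ae_form (glue \<T> p) | p. compatible r k \<T> p}" using comp by blast
next
  fix \<omega> assume "\<omega> \<in> {abs_ae_form (glue \<T> p) | p. compatible r k \<T> p}"
  then obtain p where \<omega>: "\<omega> = abs_ae_form (glue \<T> p)" and comp: "compatible r k \<T> p" by blast
  have "restricts_to \<omega> T (p T)" if "T \<in> \<T>" for T
    unfolding \<omega> restricts_to.abs_eq using AE_cases
    by (rule eventually_mono) (use that glue_interior[of T _ p] in auto)
  then have "\<forall>T\<in>\<T>. p T \<in> poly_forms r k T \<and> restricts_to \<omega> T (p T)"
    using compatible_poly_forms[OF comp] by simp
  moreover have "\<omega> \<in> L2_forms k \<Omega>"
    unfolding \<omega> by (rule glue_L2[OF compatible_poly_forms[OF comp]])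
  moreover note comp[unfolded compatible_def, THEN conjunct2]
  ultimately show "\<omega> \<in> poly_form_space r k \<T> \<Omega>"
    unfolding poly_form_space_def mem_Collect_eq by (intro conjI exI[of _ p])
qed

lemma subspace_poly_form_space: "subspace (poly_form_space r k \<T> \<Omega>)"
  unfolding poly_form_space_eq
proof (rule subspaceI)
  have "glue \<T> (\<lambda>T y v. 0) = (\<lambda>y v. 0)" by (simp add: glue_def)
  then have "0 = abs_ae_form (glue \<T> (\<lambda>T y v. 0))" by (simp add: zero_ae_form.abs_eq)
  then show "0 \<in> {abs_ae_form (glue \<T> p) | p. compatible r k \<T> p}"
    using compatible_zero by blast
next
  fix \<omega> \<eta> assume "\<omega> \<in> {abs_ae_form (glue \<T> p) | p. compatible r k \<T> p}"
    "\<eta> \<in> {abs_ae_form (glue \<T> p) | p. compatible r k \<T> p}"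
  then obtain p q where *: "\<omega> = abs_ae_form (glue \<T> p)" "compatible r k \<T> p"
    "\<eta> = abs_ae_form (glue \<T> q)" "compatible r k \<T> q" by blast
  then have "\<omega> + \<eta> = abs_ae_form (glue \<T> (\<lambda>T y v. p T y v + q T y v))"
    by (simp add: plus_ae_form.abs_eq glue_add)
  then show "\<omega> + \<eta> \<in> {abs_ae_form (glue \<T> p) | p. compatible r k \<T> p}"
    using compatible_add[OF *(2,4)] by blast
next
  fix c \<omega> assume "\<omega> \<in> {abs_ae_form (glue \<T> p) | p. compatible r k \<T> p}"
  then obtain p where *: "\<omega> = abs_ae_form (glue \<T> p)" "compatible r k \<T> p" by blast
  then have "c *\<^sub>R \<omega> = abs_ae_form (glue \<T> (\<lambda>T y v. c * p T y v))"
    by (simp add: scaleR_ae_form.abs_eq glue_scale)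
  then show "c *\<^sub>R \<omega> \<in> {abs_ae_form (glue \<T> p) | p. compatible r k \<T> p}"
    using compatible_scale[OF *(2)] by blast
qed

end

section \<open>The global basis\<close>

lemma poly_forms_continuous:
  assumes "p \<in> poly_forms r k T"
  shows "continuous_on T (\<lambda>y. p y v)"
proof -
  obtain q where "polynomial_le r q" "\<forall>y\<in>T. p y v = q y"
    using assms unfolding poly_forms_def by blast
  then show ?thesis
    using continuous_on_subset[OF polynomial_le_continuous, of r q T]
    by (subst continuous_on_cong[OF refl, of _ _ q]) auto
qed

text \<open>Independence of the indexed family also gives injectivity: a coincidence
  \<open>g a = g b\<close> is a relation with coefficients 1 and -1.\<close>

lemma independent_family:
  fixes g :: "'a \<Rightarrow> 'b::real_vector"
  assumes "finite B" and zero: "\<And>c. (\<Sum>b\<in>B. c b *\<^sub>R g b) = 0 \<Longrightarrow> \<forall>b\<in>B. c b = 0"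
  shows "inj_on g B" "independent (g ` B)"
proof -
  show inj: "inj_on g B"
  proof (rule inj_onI, rule ccontr)
    fix a b assume ab: "a \<in> B" "b \<in> B" "g a = g b" "a \<noteq> b"
    let ?c = "\<lambda>i. (if i = a then 1 else 0) - (if i = b then 1 else 0 :: real)"
    have "(\<Sum>i\<in>B. ?c i *\<^sub>R g i) = g a - g b"
      using \<open>finite B\<close> ab(1,2)
      by (simp add: scaleR_diff_left sum_subtractf if_distrib[of "\<lambda>s. s *\<^sub>R _"] cong: if_cong)
    then have "?c a = 0" using zero[of ?c] ab by auto
    then show False using ab(4) by simp
  qed
  show "independent (g ` B)"
  proof (rule independent_if_scalars_zero)
    fix f v assume f: "(\<Sum>v\<in>g ` B. f v *\<^sub>R v) = 0" and "v \<in> g ` B"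
    then show "f v = 0"
      using zero[of "\<lambda>b. f (g b)"] by (auto simp: sum.reindex[OF inj])
  qed (use \<open>finite B\<close> in simp)
qed

definition piece ::
    "(nat \<Rightarrow> real ^ 'n) \<Rightarrow> nat \<Rightarrow> nat \<Rightarrow> (real ^ 'n) set \<times> (nat \<Rightarrow> nat) \<times> (nat \<Rightarrow> nat) \<Rightarrow>
     (real ^ 'n) set \<Rightarrow> 'n::finite diff_form" where
  "piece x N k b T = (if fst b \<subseteq> T then index_form x N k T b else (\<lambda>y v. 0))"

text \<open>Leads from the extensional exponent of an index back to an element of
  \<open>exponents\<close>.\<close>

definition zero_extension ::
    "(nat \<Rightarrow> real ^ 'n) \<Rightarrow> nat \<Rightarrow> (real ^ 'n) set \<times> (nat \<Rightarrow> nat) \<times> (nat \<Rightarrow> nat) \<Rightarrow>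
     nat \<Rightarrow> nat" where
  "zero_extension x N b = (\<lambda>i. if i \<in> vertex_indices x N (fst b) then fst (snd b) i else 0)"

text \<open>Shows that a face shared by two different simplices has dimension below
  \<open>n\<close>, where the trace condition applies.\<close>

lemma (in vertex_simplex) face_eq_of_full_dim:
  assumes "f \<in> faces T" "\<not> aff_dim f \<le> int CARD('n) - 1"
  shows "f = T"
proof -
  have "CARD('n) + 1 \<le> card (vertex_indices x N f)"
    using aff_dim_face[OF assms(1)] assms(2) by linarith
  then have "vertex_indices x N f = I"
    using faces_hull(1)[OF assms(1)] finite_I card_I card_seteq by metis
  then show ?thesis using faces_hull(2)[OF assms(1)] hull_I by simp
qed

context numbered_triangulation
begin

lemma subset_of_simplex:
  assumes "f \<in> all_faces \<T>"
  obtains T where "T \<in> \<T>" "f \<subseteq> T"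
proof -
  obtain T where "T \<in> \<T>" "f face_of T" using assms by (auto simp: all_faces_def faces_def)
  then show thesis using that face_of_imp_subset by blast
qed

lemma all_faces_iff: "T \<in> \<T> \<Longrightarrow> f \<in> all_faces \<T> \<and> f \<subseteq> T \<longleftrightarrow> f \<in> faces T"
  using face_in_faces[of f T] face_of_imp_subset[of f T] unfolding all_faces_def faces_def by blast

lemma index_set_on:
  assumes "T \<in> \<T>"
  shows "(f, \<alpha>, \<sigma>) \<in> index_set \<T> x N r k \<and> f \<subseteq> T \<longleftrightarrow> (f, \<alpha>, \<sigma>) \<in> index_set {T} x N r k"
  unfolding index_set_def all_faces_singleton mem_Collect_eq prod.case
    all_faces_iff[OF assms, symmetric] by (simp only: conj_ac)

lemma basis_index_set_on:
  assumes "T \<in> \<T>"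
  shows "b \<in> basis_index_set \<T> x N r k \<and> fst b \<subseteq> T \<longleftrightarrow> b \<in> basis_index_set {T} x N r k"
proof -
  obtain f \<alpha> \<sigma> where b: "b = (f, \<alpha>, \<sigma>)" by (cases b)
  show ?thesis
    using index_set_on[OF assms, of f \<alpha> \<sigma> r k]
    unfolding basis_index_set_def b mem_Collect_eq prod.case fst_conv by blast
qed

lemma basis_index_set_subset: "basis_index_set \<T> x N r k \<subseteq> index_set \<T> x N r k"
  unfolding basis_index_set_def by auto

lemma basis_index_setE:
  assumes "b \<in> basis_index_set \<T> x N r k"
  obtains T where "T \<in> \<T>" "fst b \<subseteq> T" "b \<in> basis_index_set {T} x N r k"
proof -
  have "fst b \<in> all_faces \<T>"
    using subsetD[OF basis_index_set_subset assms] by (auto simp: index_set_def)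
  then obtain T where "T \<in> \<T>" "fst b \<subseteq> T" by (rule subset_of_simplex)
  then show thesis using that basis_index_set_on assms by blast
qed

lemma finite_basis_index_set:
  assumes r: "r \<ge> 1"
  shows "finite (basis_index_set \<T> x N r k)"
proof (rule finite_subset)
  show "basis_index_set \<T> x N r k \<subseteq> (\<Union>T\<in>\<T>. basis_index_set {T} x N r k)"
    by (rule subsetI, erule basis_index_setE, rule UN_I)
  have "finite (basis_index_set {T} x N r k)" if "T \<in> \<T>" for T
  proof -
    interpret vertex_simplex x N T by (rule vertex_simplex_T[OF that])
    show ?thesis
      using bij_betw_finite[OF bij_pair_index[OF r]] finite_pairs[OF finite_I] by blast
  qed
  then show "finite (\<Union>T\<in>\<T>. basis_index_set {T} x N r k)" using finite_T by blast
qed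

lemma piecewise_form_glue: "piecewise_form \<T> x N k b = abs_ae_form (glue \<T> (piece x N k b))"
proof -
  obtain f \<alpha> \<sigma> where b: "b = (f, \<alpha>, \<sigma>)" by (cases b)
  have "(\<Sum>T | T \<in> \<T> \<and> f \<subseteq> T. if y \<in> interior T then local_form x N k \<alpha> \<sigma> f T y v else 0) =
      glue \<T> (piece x N k b) y v" for y v
    unfolding glue_def using finite_T
    by (intro sum.mono_neutral_cong_left) (auto simp: piece_def b index_form_def)
  then show ?thesis by (simp add: piecewise_form_def b)
qed

text \<open>If the common face \<open>g\<close> contains \<open>f\<close>, both simplices contain
  \<open>f\<close> and the traces agree. If not, both traces on \<open>g\<close> vanish; this covers
  the case where only one of the simplices contains \<open>f\<close>.\<close>

lemma compatible_piece:
  assumes b: "b \<in> index_set \<T> x N r k"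
  shows "compatible r k \<T> (piece x N k b)"
proof -
  obtain f \<alpha> \<sigma> where bf: "b = (f, \<alpha>, \<sigma>)" by (cases b)
  have on: "(f, \<alpha>, \<sigma>) \<in> index_set {T} x N r k" if "T \<in> \<T>" "f \<subseteq> T" for T
    using b that index_set_on unfolding bf by blast
  show ?thesis
  proof (rule compatibleI)
    fix T assume T: "T \<in> \<T>"
    show "piece x N k b T \<in> poly_forms r k T"
      using vertex_simplex.index_form_in_poly_forms[OF vertex_simplex_T[OF T] on[OF T]]
      by (simp add: piece_def bf poly_forms_zero)
  next
    fix g T T' y and v :: "nat \<Rightarrow> real ^ 'n"
    assume g: "g \<in> all_faces \<T>" and T: "T \<in> \<T>" "T' \<in> \<T>" "g \<subseteq> T" "g \<subseteq> T'"
      and y: "y \<in> g" and v: "\<forall>i\<in>{1..k}. v i \<in> tangent_space g"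
    note gT = face_in_faces[OF g T(1,3)] face_in_faces[OF g T(2,4)]
    note vs = vertex_simplex_T[OF T(1)] vertex_simplex_T[OF T(2)]
    show "piece x N k b T y v = piece x N k b T' y v"
    proof (cases "f \<subseteq> g")
      case True
      then have "f \<subseteq> T" "f \<subseteq> T'" using T by auto
      then show ?thesis
        using index_form_eq_on_face[OF vs on[OF T(1)] gT True y] v by (simp add: piece_def bf)
    next
      case False
      have "piece x N k b T y v = 0"
        using vertex_simplex.index_form_vanishes[OF vs(1) on[OF T(1)] gT(1) False y, of v] v
        by (simp add: piece_def bf)
      moreover have "piece x N k b T' y v = 0"
        using vertex_simplex.index_form_vanishes[OF vs(2) on[OF T(2)] gT(2) False y, of v] v
        by (simp add: piece_def bf)
      ultimately show ?thesis by simp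
    qed
  qed
qed

lemma piecewise_form_in_space:
  "b \<in> index_set \<T> x N r k \<Longrightarrow> piecewise_form \<T> x N k b \<in> poly_form_space r k \<T> \<Omega>"
  unfolding piecewise_form_glue poly_form_space_eq using compatible_piece by blast

text \<open>On \<open>T\<close> only the indices whose face lies in \<open>T\<close> contribute, and
  these correspond to the pairs of \<open>T\<close>.\<close>

lemma sum_pieces:
  assumes r: "r \<ge> 1" and T: "T \<in> \<T>"
  shows "(\<Sum>b\<in>basis_index_set \<T> x N r k. c b * piece x N k b T y v) =
    (\<Sum>z\<in>pairs (vertex_indices x N T) r k. c (pair_index x k z) * index_form x N k T (pair_index x k z) y v)"
proof -
  interpret vertex_simplex x N T by (rule vertex_simplex_T[OF T])
  have "(\<Sum>b\<in>basis_index_set \<T> x N r k. c b * piece x N k b T y v) =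
      (\<Sum>b\<in>basis_index_set {T} x N r k. c b * index_form x N k T b y v)"
    using finite_basis_index_set[OF r]
    by (intro sum.mono_neutral_cong_right)
       (auto simp: piece_def basis_index_set_on[OF T, symmetric] simp del: split_paired_All)
  also have "\<dots> = (\<Sum>z\<in>pairs I r k. c (pair_index x k z) * index_form x N k T (pair_index x k z) y v)"
    by (rule sum.reindex_bij_betw[OF bij_pair_index[OF r], symmetric])
  finally show ?thesis .
qed

text \<open>The coefficient of \<open>\<lambda>\<^sup>\<alpha>\<close> can be read off at points of a face containing the support of \<open>\<alpha>\<close>,
  so it is determined by the trace if the vectors are tangent to that face.\<close>

lemma coefficients_single_valued:
  assumes p: "compatible r k \<T> p" and f: "f \<in> all_faces \<T>" "int k \<le> aff_dim f"
    and T: "T \<in> \<T>" "T' \<in> \<T>" "f \<subseteq> T" "f \<subseteq> T'" "T \<noteq> T'"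
    and c: "\<And>y. y \<in> T \<Longrightarrow> p T y u = vertex_simplex.monomial_sum x N T r c y"
    and c': "\<And>y. y \<in> T' \<Longrightarrow> p T' y u = vertex_simplex.monomial_sum x N T' r c' y"
    and u: "\<And>i. i \<in> {1..k} \<Longrightarrow> u i \<in> tangent_space f"
    and \<alpha>: "\<alpha> \<in> exponents (vertex_indices x N f) r"
  shows "c \<alpha> = c' \<alpha>"
proof -
  interpret S: vertex_simplex x N T by (rule vertex_simplex_T[OF T(1)])
  interpret S': vertex_simplex x N T' by (rule vertex_simplex_T[OF T(2)])
  note fT = face_in_faces[OF f(1) T(1,3)] face_in_faces[OF f(1) T(2,4)]
  have dim: "aff_dim f \<le> int CARD('n) - 1"
    using S.face_eq_of_full_dim[OF fT(1)] S'.face_eq_of_full_dim[OF fT(2)] T(5) by blast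
  let ?K = "vertex_indices x N f"
  note K = S.faces_hull[OF fT(1)] S'.faces_hull(1)[OF fT(2)]
  have finK: "finite ?K" unfolding vertex_indices_def by simp
  have "c \<alpha> - c' \<alpha> = 0"
  proof (rule homogeneous_zero_on_simplex[OF finK K(3) _ \<alpha>])
    fix t :: "nat \<Rightarrow> real" assume t: "\<And>i. i \<in> ?K \<Longrightarrow> 0 < t i" "sum t ?K = 1"
    let ?y = "\<Sum>i\<in>?K. t i *\<^sub>R x i"
    have "?y \<in> convex hull (x ` ?K)"
      using t finK by (intro convex_sum) (auto intro: hull_inc less_imp_le)
    then have y: "?y \<in> f" using K(2) by simp
    have "p T ?y u = p T' ?y u"
      using compatible_trace[OF p f dim T(1-4) y] u by blast
    then have "S.monomial_sum r c ?y = S'.monomial_sum r c' ?y"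
      using c[OF subsetD[OF T(3) y]] c'[OF subsetD[OF T(4) y]] by simp
    then show "(\<Sum>\<alpha>\<in>exponents ?K r. (c \<alpha> - c' \<alpha>) * (\<Prod>i\<in>?K. t i ^ \<alpha> i)) = 0"
      unfolding S.monomial_sum_on_face[OF K(1) t(2)] S'.monomial_sum_on_face[OF K(4) t(2)]
      by (simp add: left_diff_distrib sum_subtractf)
  qed
  then show ?thesis by simp
qed

text \<open>Every simplex has its own expansion. Since the coefficient of an index is the same on
  all simplices containing its face, a single family \<open>c\<close> serves them all.\<close>

lemma glue_eq_sum_piecewise_forms:
  assumes r: "r \<ge> 1" and p: "compatible r k \<T> p"
  obtains c where "abs_ae_form (glue \<T> p) =
    (\<Sum>b\<in>basis_index_set \<T> x N r k. c b *\<^sub>R piecewise_form \<T> x N k b)"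
proof -
  let ?B = "basis_index_set \<T> x N r k"
  let ?I = "vertex_indices x N"
  have "\<forall>T\<in>\<T>. \<exists>C. (\<forall>\<alpha>\<in>exponents (?I T) r. alternating k (C \<alpha>)) \<and>
      (\<forall>y\<in>T. \<forall>v. p T y v = vertex_simplex.monomial_sum x N T r (\<lambda>\<alpha>. C \<alpha> v) y)"
  proof
    fix T assume T: "T \<in> \<T>"
    obtain C where "\<And>\<alpha>. \<alpha> \<in> exponents (?I T) r \<Longrightarrow> alternating k (C \<alpha>)"
      "\<And>y v. y \<in> T \<Longrightarrow> p T y v = vertex_simplex.monomial_sum x N T r (\<lambda>\<alpha>. C \<alpha> v) y"
      by (rule vertex_simplex.poly_forms_coefficients[OF vertex_simplex_T[OF T] compatible_poly_forms[OF p T]])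
         (rule that)
    then show "\<exists>C. (\<forall>\<alpha>\<in>exponents (?I T) r. alternating k (C \<alpha>)) \<and>
      (\<forall>y\<in>T. \<forall>v. p T y v = vertex_simplex.monomial_sum x N T r (\<lambda>\<alpha>. C \<alpha> v) y)" by blast
  qed
  from bchoice[OF this] obtain C where CC:
    "\<forall>T\<in>\<T>. (\<forall>\<alpha>\<in>exponents (?I T) r. alternating k (C T \<alpha>)) \<and>
      (\<forall>y\<in>T. \<forall>v. p T y v = vertex_simplex.monomial_sum x N T r (\<lambda>\<alpha>. C T \<alpha> v) y)" ..
  have alt: "alternating k (C T \<alpha>)" if "T \<in> \<T>" "\<alpha> \<in> exponents (?I T) r" for T \<alpha>
    using CC[rule_format, OF that(1)] that(2) by blast
  have C: "p T y v = vertex_simplex.monomial_sum x N T r (\<lambda>\<alpha>. C T \<alpha> v) y"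
    if "T \<in> \<T>" "y \<in> T" for T y v
    using CC[rule_format, OF that(1)] that(2) by blast
  \<comment> \<open>The coefficient that the expansion on \<open>T\<close> assigns to
    \<open>b\<close>; the dual vectors do not depend on \<open>T\<close>, only \<open>C T\<close>
    does.\<close>
  define coef where "coef T b = C T (zero_extension x N b)
      (dual_vector x r (zero_extension x N b) \<circ> snd (snd b))" for T b
  have coef_eq: "coef T b = coef T' b"
    if b: "b \<in> ?B" and T: "T \<in> \<T>" "T' \<in> \<T>" "fst b \<subseteq> T" "fst b \<subseteq> T'" for b T T'
  proof (cases "T = T'")
    case False
    obtain f \<alpha> \<sigma> where bf: "b = (f, \<alpha>, \<sigma>)" by (cases b)
    have f: "f \<in> all_faces \<T>" "int k \<le> aff_dim f" "sum \<alpha> (?I f) = r" and \<sigma>: "\<sigma> \<in> {1..k} \<rightarrow>\<^sub>E ?I f"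
      using b unfolding bf basis_index_set_def index_set_def by (auto simp del: atLeastAtMost_iff)
    have fT: "f \<subseteq> T" "f \<subseteq> T'" using T(3,4) by (simp_all add: bf)
    interpret vertex_simplex x N T by (rule vertex_simplex_T[OF T(1)])
    note K = faces_hull[OF face_in_faces[OF f(1) T(1) fT(1)]]
    have \<beta>: "zero_extension x N b \<in> exponents (?I f) r"
      using f(3) by (simp add: exponents_def zero_extension_def bf)
    have u: "(dual_vector x r (zero_extension x N b) \<circ> snd (snd b)) i \<in> tangent_space f"
      if "i \<in> {1..k}" for i
      using dual_vector_tangent[OF K(1) \<beta> r PiE_mem[OF \<sigma> that]] K(2) by (simp add: bf)
    show ?thesis
      unfolding coef_def
      by (rule coefficients_single_valued[OF p f(1,2) T(1,2) fT False C[OF T(1)] C[OF T(2)] u \<beta>])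
  qed simp
  \<comment> \<open>Any simplex containing the face may be chosen, by
    \<open>coef_eq\<close>.\<close>
  define c where "c b = coef (SOME T. T \<in> \<T> \<and> fst b \<subseteq> T) b" for b
  have c: "c b = coef T b" if "b \<in> ?B" "T \<in> \<T>" "fst b \<subseteq> T" for b T
  proof -
    have "(SOME T. T \<in> \<T> \<and> fst b \<subseteq> T) \<in> \<T> \<and> fst b \<subseteq> (SOME T. T \<in> \<T> \<and> fst b \<subseteq> T)"
      by (rule someI[of _ T]) (use that in simp)
    then show ?thesis unfolding c_def using coef_eq[OF that(1) _ that(2) _ that(3)] by blast
  qed
  have on_T: "p T y v = (\<Sum>b\<in>?B. c b * piece x N k b T y v)" if T: "T \<in> \<T>" and y: "y \<in> T" for T y v
  proof -
    interpret vertex_simplex x N T by (rule vertex_simplex_T[OF T])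
    have "p T y v = (\<Sum>z\<in>pairs I r k. C T (fst z) (dual_vector x r (fst z) \<circ> snd z) *
        index_form x N k T (pair_index x k z) y v)"
      by (rule index_forms_span[OF r y alt[OF T] C[OF T]])
    also have "\<dots> = (\<Sum>z\<in>pairs I r k. c (pair_index x k z) * index_form x N k T (pair_index x k z) y v)"
    proof (rule sum.cong[OF refl])
      fix z assume z: "z \<in> pairs I r k"
      obtain \<alpha> \<sigma> where zz: "z = (\<alpha>, \<sigma>)" by (cases z)
      have "pair_index x k z \<in> basis_index_set {T} x N r k"
        using pair_index_in_basis_index_set[OF r] z zz by blast
      then have "c (pair_index x k z) = coef T (pair_index x k z)"
        using c[OF _ T] basis_index_set_on[OF T] by blast
      moreover have "zero_extension x N (pair_index x k z) = \<alpha>"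
        unfolding zero_extension_def zz by (rule pair_index_exponent[OF r z[unfolded zz]])
      moreover have "snd (snd (pair_index x k z)) = \<sigma>" by (simp add: pair_index_def zz)
      ultimately show "C T (fst z) (dual_vector x r (fst z) \<circ> snd z) *
          index_form x N k T (pair_index x k z) y v =
          c (pair_index x k z) * index_form x N k T (pair_index x k z) y v"
        by (simp add: coef_def zz)
    qed
    also have "\<dots> = (\<Sum>b\<in>?B. c b * piece x N k b T y v)"
      by (rule sum_pieces[OF r T, symmetric])
    finally show ?thesis .
  qed
  let ?q = "\<lambda>y v. \<Sum>b\<in>?B. c b * glue \<T> (piece x N k b) y v"
  \<comment> \<open>The two agree inside each simplex and vanish outside the closure; the points
    left over form a null set.\<close>
  have "AE y in lebesgue. glue \<T> p y = ?q y"
  proof (rule AE_glue_eq)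
    show "p T y v = ?q y v" if "T \<in> \<T>" "y \<in> interior T" for T y v
      using on_T[OF that(1)] interior_subset[of T] that by (auto simp: glue_interior)
    show "?q y v = 0" if "y \<notin> closure \<Omega>" for y v
    proof -
      have "y \<notin> interior T" if "T \<in> \<T>" for T
        using that \<open>y \<notin> closure \<Omega>\<close> Union_T interior_subset[of T] by blast
      then show ?thesis by (simp add: glue_outside)
    qed
  qed
  then have "abs_ae_form (glue \<T> p) = abs_ae_form ?q" by (simp add: ae_form.abs_eq_iff)
  also have "\<dots> = (\<Sum>b\<in>?B. c b *\<^sub>R piecewise_form \<T> x N k b)"
    by (simp add: piecewise_form_glue sum_scaleR_abs_ae_form)
  finally show thesis by (rule that)
qed

text \<open>One simplex containing the face of \<open>b\<close> suffices: the combination vanishes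
  almost everywhere there, hence by continuity on the whole interior, and local independence
  applies.\<close>

lemma sum_piecewise_forms_zero:
  assumes r: "r \<ge> 1"
    and zero: "(\<Sum>b\<in>basis_index_set \<T> x N r k. c b *\<^sub>R piecewise_form \<T> x N k b) = 0"
    and b: "b \<in> basis_index_set \<T> x N r k"
  shows "c b = 0"
proof -
  let ?B = "basis_index_set \<T> x N r k"
  obtain T where T: "T \<in> \<T>" "b \<in> basis_index_set {T} x N r k"
    using basis_index_setE[OF b] by blast
  interpret vertex_simplex x N T by (rule vertex_simplex_T[OF T(1)])
  have "abs_ae_form (\<lambda>y v. \<Sum>b\<in>?B. c b * glue \<T> (piece x N k b) y v) = abs_ae_form (\<lambda>y v. 0)"
    using zero by (simp add: piecewise_form_glue sum_scaleR_abs_ae_form zero_ae_form.abs_eq)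
  then have AE: "AE y in lebesgue.
      (\<lambda>v. \<Sum>b\<in>?B. c b * glue \<T> (piece x N k b) y v) = (\<lambda>v. 0)"
    by (simp add: ae_form.abs_eq_iff)
  have "(\<Sum>b\<in>?B. c b * piece x N k b T y v) = 0" if y: "y \<in> interior T" for y v
  proof (rule AE_zero_imp_zero_on_open[OF open_interior _ _ y])
    have "continuous_on T (\<lambda>y. piece x N k b T y v)" if "b \<in> ?B" for b
      using compatible_poly_forms[OF compatible_piece T(1), of b r k] basis_index_set_subset that
      by (intro poly_forms_continuous) blast
    then show "continuous_on (interior T) (\<lambda>y. \<Sum>b\<in>?B. c b * piece x N k b T y v)"
      using interior_subset[of T]
      by (intro continuous_intros) (blast intro: continuous_on_subset)
    show "AE y in lebesgue. y \<in> interior T \<longrightarrow> (\<Sum>b\<in>?B. c b * piece x N k b T y v) = 0"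
      using AE
    proof (rule eventually_mono, intro impI)
      fix y assume *: "(\<lambda>v. \<Sum>b\<in>?B. c b * glue \<T> (piece x N k b) y v) = (\<lambda>v. 0)" "y \<in> interior T"
      from fun_cong[OF *(1), of v] show "(\<Sum>b\<in>?B. c b * piece x N k b T y v) = 0"
        by (simp add: glue_interior[OF T(1) *(2)])
    qed
  qed
  then have zero_T: "(\<Sum>z\<in>pairs I r k. c (pair_index x k z) * index_form x N k T (pair_index x k z) y v) = 0"
    if "y \<in> interior T" for y v
    using that sum_pieces[OF r T(1)] by simp
  obtain \<alpha> \<sigma> where z: "(\<alpha>, \<sigma>) \<in> pairs I r k" "b = pair_index x k (\<alpha>, \<sigma>)"
    using bij_betw_imp_surj_on[OF bij_pair_index[OF r]] T(2) by fast
  show ?thesis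
    unfolding z(2)
    by (rule index_forms_independent[where c = "\<lambda>z. c (pair_index x k z)", OF r zero_T z(1)])
qed

end

theorem mainTheorem7:
  fixes \<Omega> :: "(real ^ 'n::finite) set" and \<T> :: "(real ^ 'n) set set"
    and x :: "nat \<Rightarrow> real ^ 'n" and N r k :: nat
  assumes "bounded_polyhedral_domain \<Omega>"
    and "triangulation_of \<T> \<Omega>"
    and "vertex_numbering x N \<T>"
    and "r \<ge> 1" and "k \<le> CARD('n)"
  shows "piecewise_form \<T> x N k ` index_set \<T> x N r k \<subseteq> poly_form_space r k \<T> \<Omega>
    \<and> span (piecewise_form \<T> x N k ` index_set \<T> x N r k) = poly_form_space r k \<T> \<Omega>
    \<and> inj_on (piecewise_form \<T> x N k) (basis_index_set \<T> x N r k)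
    \<and> independent (piecewise_form \<T> x N k ` basis_index_set \<T> x N r k)
    \<and> span (piecewise_form \<T> x N k ` basis_index_set \<T> x N r k) = poly_form_space r k \<T> \<Omega>"
proof -
  interpret numbered_triangulation \<Omega> \<T> x N by standard (fact assms)+
  let ?P = "piecewise_form \<T> x N k" and ?V = "poly_form_space r k \<T> \<Omega>"
  let ?A = "index_set \<T> x N r k" and ?B = "basis_index_set \<T> x N r k"
  have A: "?P ` ?A \<subseteq> ?V" using piecewise_form_in_space by blast
  then have upper: "span (?P ` ?A) \<subseteq> ?V" using span_minimal subspace_poly_form_space by blast
  \<comment> \<open>The larger family lies between the basis and the space, so its span is squeezed
    between equal spaces.\<close>
  have mono: "span (?P ` ?B) \<subseteq> span (?P ` ?A)"
    by (intro span_mono image_mono basis_index_set_subset)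
  have lower: "?V \<subseteq> span (?P ` ?B)"
  proof
    fix \<omega> assume "\<omega> \<in> ?V"
    then obtain p where "compatible r k \<T> p" "\<omega> = abs_ae_form (glue \<T> p)"
      unfolding poly_form_space_eq by blast
    then obtain c where "\<omega> = (\<Sum>b\<in>?B. c b *\<^sub>R ?P b)"
      using glue_eq_sum_piecewise_forms[OF \<open>r \<ge> 1\<close>] by metis
    then show "\<omega> \<in> span (?P ` ?B)" by (auto intro!: span_sum span_scale intro: span_base)
  qed
  have "inj_on ?P ?B" "independent (?P ` ?B)"
    using independent_family[where g = ?P, OF finite_basis_index_set[OF \<open>r \<ge> 1\<close>, of k]]
      sum_piecewise_forms_zero[OF \<open>r \<ge> 1\<close>] by blast+
  then show ?thesis using A upper mono lower by blast
qed

end
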